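(* The Kolmogorov–Sinai entropy of the shift $S$ on the Möbius flow $X_{\mathcal{A}_3}$ equipped with the Sarnak–Veech measure $\eta_M$ is $$h_{\eta_M}(S)=\frac{6}{\pi^2}\log 2 .$$
   Context: A set $A\subset\mathbb{N}=\{1,2,\dots\}$ is admissible if for every prime $p$ the number of residue classes modulo $p^2$ represented by elements of $A$ is strictly less than $p^2$. A sequence $x=(x_n)_{n\in\mathbb{N}}$ in $\{0,1\}^{\mathbb{N}}$ or $\{-1,0,1\}^{\mathbb{N}}$ is admissible if its support $\mathrm{supp}(x)=\{n: x_n\ne0\}$ is admissible. $X_{\mathcal{A}_2}\subset\{0,1\}^{\mathbb{N}}$ and $X_{\mathcal{A}_3}\subset\{-1,0,1\}^{\mathbb{N}}$ denote the (closed, shift-invariant) sets of admissible sequences. $S$ is the shift $(x_n)\mapsto(x_{n+1})$, and $\mathrm{pr}_n$ is the $n$-th coordinate projection. Let $\mu$ be the Möbius function; then $\mu^2\in X_{\mathcal{A}_2}$ is the indicator of the square-free numbers. The Mirsky measure $m$ is the $S$-invariant Borel probability measure on $X_{\mathcal{A}_2}$ given by the weak-star limit $m=\lim_{N\to\infty}\frac1N\sum_{n=0}^{N}\delta_{S^n\mu^2}$ (that is, $\mu^2$ is generic for $m$). Let $\Omega_0=\{-1,1\}^{\mathbb{N}}$ and let $\mathbb{P}=\bigotimes\left(\frac12\delta_{-1}+\frac12\delta_1\right)$ be the Bernoulli measure on it. Define $\Phi: X_{\mathcal{A}_2}\times\Omega_0\to X_{\mathcal{A}_3}$ by $\mathrm{pr}_n(\Phi(x,\omega))=0$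 if $n\notin\mathrm{supp}(x)=\{n_1<n_2<\cdots\}$, and $\mathrm{pr}_n(\Phi(x,\omega))=\mathrm{pr}_k(\omega)$ if $n=n_k\in\mathrm{supp}(x)$. The Sarnak–Veech measure is $\eta_M=\Phi_*(m\times\mathbb{P})$, a shift-invariant Borel probability measure on $X_{\mathcal{A}_3}$. $\log$ is the natural logarithm, and $h_{\eta_M}(S)$ is the measure-theoretic entropy of $(X_{\mathcal{A}_3},\eta_M,S)$. *)

theory Defs
  imports "HOL-Probability.Probability" "HOL-Computational_Algebra.Primes"
    "HOL-Computational_Algebra.Squarefree" "HOL-Library.Disjoint_Sets"
begin

section \<open>Sequences indexed by the positive integers\<close>

text \<open>
  A sequence \<open>(x_n)\<close> with \<open>n = 1, 2, \<dots>\<close> is encoded as a function on \<^typ>\<open>nat\<close> whose value at \<open>i\<close>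
  is the coordinate number \<open>i + 1\<close>.  The topology of \<^typ>\<open>nat \<Rightarrow> int\<close> is the library's product
  topology, the topology of \<^typ>\<open>int\<close> being discrete.
\<close>

definition pr :: "nat \<Rightarrow> (nat \<Rightarrow> int) \<Rightarrow> int" where
  "pr n x = x (n - 1)"

definition seq_shift :: "(nat \<Rightarrow> int) \<Rightarrow> (nat \<Rightarrow> int)" where
  "seq_shift x = (\<lambda>i. x (Suc i))"

definition supp :: "(nat \<Rightarrow> int) \<Rightarrow> nat set" where
  "supp x = {n. n \<ge> 1 \<and> pr n x \<noteq> 0}"

definition admissible :: "nat set \<Rightarrow> bool" where
  "admissible A \<longleftrightarrow> (\<forall>p. prime p \<longrightarrow> card ((\<lambda>n. n mod p\<^sup>2) ` A) < p\<^sup>2)"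

definition XA2 :: "(nat \<Rightarrow> int) set" where
  "XA2 = {x. range x \<subseteq> {0, 1} \<and> admissible (supp x)}"

definition XA3 :: "(nat \<Rightarrow> int) set" where
  "XA3 = {x. range x \<subseteq> {-1, 0, 1} \<and> admissible (supp x)}"


section \<open>The Mirsky measure\<close>

definition moebius_mu :: "nat \<Rightarrow> int" where
  "moebius_mu n = (if squarefree n then (-1) ^ card (prime_factors n) else 0)"

definition mu_sq :: "nat \<Rightarrow> int" where
  "mu_sq = (\<lambda>i. (moebius_mu (Suc i))\<^sup>2)"

text \<open>
  Weak-star convergence is tested on the continuous real functions on the compact space
  \<^const>\<open>XA2\<close>; the integral of \<open>f\<close> with respect to the point mass at \<open>y\<close> is \<open>f y\<close>.
\<close>

definition is_mirsky :: "(nat \<Rightarrow> int) measure \<Rightarrow> bool" where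
  "is_mirsky m \<longleftrightarrow>
     prob_space m \<and>
     sets m = sets (restrict_space borel XA2) \<and>
     distr m m seq_shift = m \<and>
     (\<forall>f :: (nat \<Rightarrow> int) \<Rightarrow> real. continuous_on XA2 f \<longrightarrow>
        (\<lambda>N. 1 / real N * (\<Sum>n=0..N. f ((seq_shift ^^ n) mu_sq))) \<longlonglongrightarrow> (\<integral>x. f x \<partial>m))"

definition mirsky_measure :: "(nat \<Rightarrow> int) measure" where
  "mirsky_measure = (THE m. is_mirsky m)"


section \<open>The Sarnak--Veech measure\<close>

text \<open>The space of this measure is \<open>\<Omega>\<^sub>0\<close>, the set of all sequences with values in \<open>{-1, 1}\<close>.\<close>

definition bernoulli_measure :: "(nat \<Rightarrow> int) measure" where
  "bernoulli_measure = (\<Pi>\<^sub>M i\<in>UNIV. uniform_count_measure {-1, 1 :: int})"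

text \<open>
  If \<open>n\<close> is an element of \<open>supp x = {n_1 < n_2 < \<dots>}\<close>, then \<open>n = n_k\<close> where \<open>k\<close> is the number of
  elements of the support that are at most \<open>n\<close>.  The support may be finite.
\<close>

definition Phi :: "(nat \<Rightarrow> int) \<times> (nat \<Rightarrow> int) \<Rightarrow> (nat \<Rightarrow> int)" where
  "Phi = (\<lambda>(x, \<omega>). \<lambda>i. let n = Suc i in
     if n \<in> supp x then pr (card {j \<in> supp x. j \<le> n}) \<omega> else 0)"

definition sarnak_veech_measure :: "(nat \<Rightarrow> int) measure" where
  "sarnak_veech_measure =
     distr (mirsky_measure \<Otimes>\<^sub>M bernoulli_measure) (restrict_space borel XA3) Phi"


section \<open>Kolmogorov--Sinai entropy\<close>

text \<open>Entropy is taken with natural logarithms; a null atom contributes \<open>0 * ln 0 = 0\<close>.\<close>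

definition partition_entropy :: "'a measure \<Rightarrow> 'a set set \<Rightarrow> real" where
  "partition_entropy M \<xi> = - (\<Sum>A\<in>\<xi>. measure M A * ln (measure M A))"

definition finite_measurable_partition :: "'a measure \<Rightarrow> 'a set set \<Rightarrow> bool" where
  "finite_measurable_partition M \<xi> \<longleftrightarrow> finite \<xi> \<and> \<xi> \<subseteq> sets M \<and> partition_on (space M) \<xi>"

text \<open>Empty preimages are dropped, as \<^const>\<open>partition_on\<close> does not admit empty atoms.\<close>

definition pullback_partition :: "'a measure \<Rightarrow> ('a \<Rightarrow> 'a) \<Rightarrow> 'a set set \<Rightarrow> 'a set set" where
  "pullback_partition M T \<xi> = (\<lambda>A. T -` A \<inter> space M) ` \<xi> - {{}}"

text \<open>The join of \<open>T\<^sup>-\<^sup>i \<xi>\<close> for \<open>i = 0, \<dots>, n - 1\<close>; of interest for \<open>n > 0\<close> only.\<close>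

definition iterated_join :: "'a measure \<Rightarrow> ('a \<Rightarrow> 'a) \<Rightarrow> 'a set set \<Rightarrow> nat \<Rightarrow> 'a set set" where
  "iterated_join M T \<xi> n = common_refinement ((\<lambda>i. pullback_partition M (T ^^ i) \<xi>) ` {..<n})"

definition entropy_wrt :: "'a measure \<Rightarrow> ('a \<Rightarrow> 'a) \<Rightarrow> 'a set set \<Rightarrow> real" where
  "entropy_wrt M T \<xi> = lim (\<lambda>n. partition_entropy M (iterated_join M T \<xi> n) / real n)"

definition ks_entropy :: "'a measure \<Rightarrow> ('a \<Rightarrow> 'a) \<Rightarrow> ereal" where
  "ks_entropy M T = (SUP \<xi> \<in> {\<xi>. finite_measurable_partition M \<xi>}. ereal (entropy_wrt M T \<xi>))"

end

theory Submission
  imports Defs "HOL-Real_Asymp.Real_Asymp" "HOL-Number_Theory.Cong"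
begin

text \<open>
  The number \<open>6 / \<pi>\<^sup>2\<close> is the density of the square-free integers, and \<open>ln 2\<close> is the entropy of a
  fair coin.  A point that is typical for the Sarnak--Veech measure is a typical support pattern with
  an independent fair sign at every point of the support.  The pattern has entropy zero, so that only
  the signs count, and there are \<open>6 / \<pi>\<^sup>2\<close> of them per unit of time.

  The Mirsky measure is made explicit as a sieve.  Choose for every prime \<open>p\<close> an independent uniform
  residue \<open>z p\<close> modulo \<open>p\<^sup>2\<close> and delete all \<open>j\<close> with \<open>p\<^sup>2 dvd j + z p\<close> for some \<open>p\<close>.  If
  \<open>z p = n\<close> for all \<open>p\<close>, then this sieve produces the \<open>n\<close>-th shift of \<open>\<mu>\<^sup>2\<close>.  By the Chinese
  remainder theorem the sieve by the primes up to \<open>K\<close> is equidistributed along these shifts, and the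
  remaining primes change any given coordinate with probability, and with frequency, at most about
  \<open>1 / K\<close>.  Hence \<open>\<mu>\<^sup>2\<close> is generic for the law of the sieve (\<open>LIMSEQ_word_frequency\<close>), and
  \<open>mirsky_measure_eq\<close> identifies this law with the Mirsky measure.  The Euler product gives \<open>6 / \<pi>\<^sup>2\<close>
  as the probability of a \<open>1\<close> at a fixed place (\<open>prob_sieve\<close>).

  The map \<open>Phi\<close> reads the signs off in the order of the support, so the measure of a cylinder is the
  Mirsky measure of the unsigned word times \<open>1 / 2\<close> for each nonzero letter
  (\<open>measure_sarnak_veech_cylinder\<close>).  Summing \<open>- p ln p\<close> over the words of length \<open>n\<close> shows that their
  entropy is the entropy of the unsigned words plus exactly \<open>n * (6 / \<pi>\<^sup>2) * ln 2\<close>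
  (\<open>rv_entropy_sarnak_veech_words\<close>).  The first term is nonnegative, and it is sublinear in \<open>n\<close>
  (\<open>rv_entropy_sieve_sublinear\<close>): the finitely many residues for \<open>p \<le> K\<close> predict each letter up to a
  small probability of error, so that given these residues each letter has small entropy.

  The partition by the coordinate at time zero therefore has entropy rate \<open>6 / \<pi>\<^sup>2 * ln 2\<close>.  It is
  a generator: every event is approximated by cylinders, and an approximation of the atoms of a
  partition turns into a bound on conditional entropy.  So no finite partition has a larger rate
  (\<open>entropy_wrt_le_generator\<close>).
\<close>

section \<open>Entropy of finitely valued random variables\<close>

definition rv_entropy :: "'a measure \<Rightarrow> ('a \<Rightarrow> 'b) \<Rightarrow> real" where
  "rv_entropy M X = - (\<Sum>v\<in>X ` space M.
     measure M (X -` {v} \<inter> space M) * ln (measure M (X -` {v} \<inter> space M)))"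

lemma rv_entropy_cong:
  assumes "\<And>\<omega>. \<omega> \<in> space M \<Longrightarrow> X \<omega> = Y \<omega>"
  shows "rv_entropy M X = rv_entropy M Y"
proof -
  have "X ` space M = Y ` space M" using assms by auto
  moreover have "X -` {v} \<inter> space M = Y -` {v} \<inter> space M" for v using assms by auto
  ultimately show ?thesis by (simp add: rv_entropy_def)
qed

lemma simple_function_distr:
  assumes f: "f \<in> measurable M N" and X: "simple_function N X"
  shows "simple_function M (\<lambda>\<omega>. X (f \<omega>))"
  unfolding simple_function_def
proof (intro conjI ballI)
  have sp: "f \<omega> \<in> space N" if "\<omega> \<in> space M" for \<omega>
    using f that by (rule measurable_space)
  show "finite ((\<lambda>\<omega>. X (f \<omega>)) ` space M)"
    using simple_functionD(1)[OF X] by (rule finite_subset[rotated]) (use sp in auto)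
  fix v
  have "(\<lambda>\<omega>. X (f \<omega>)) -` {v} \<inter> space M = f -` (X -` {v} \<inter> space N) \<inter> space M"
    using sp by auto
  then show "(\<lambda>\<omega>. X (f \<omega>)) -` {v} \<inter> space M \<in> sets M"
    using measurable_sets[OF f simple_functionD(2)[OF X, of "{v}"]] by simp
qed

lemma rv_entropy_distr:
  assumes f: "f \<in> measurable M N" and X: "simple_function N X"
  shows "rv_entropy (distr M N f) X = rv_entropy M (\<lambda>\<omega>. X (f \<omega>))"
proof -
  let ?X = "\<lambda>\<omega>. X (f \<omega>)"
  have sp: "f \<omega> \<in> space N" if "\<omega> \<in> space M" for \<omega>
    using f that by (rule measurable_space)
  have eq: "measure (distr M N f) (X -` {v} \<inter> space N) = measure M (?X -` {v} \<inter> space M)" for v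
  proof -
    have "?X -` {v} \<inter> space M = f -` (X -` {v} \<inter> space N) \<inter> space M"
      using sp by auto
    then show ?thesis
      using measure_distr[OF f simple_functionD(2)[OF X, of "{v}"]] by simp
  qed
  let ?p = "\<lambda>v. measure M (?X -` {v} \<inter> space M)"
  have "(\<Sum>v\<in>X ` space N. ?p v * ln (?p v)) = (\<Sum>v\<in>?X ` space M. ?p v * ln (?p v))"
  proof (rule sum.mono_neutral_right)
    show "\<forall>v\<in>X ` space N - ?X ` space M. ?p v * ln (?p v) = 0"
    proof
      fix v assume "v \<in> X ` space N - ?X ` space M"
      then have "?X -` {v} \<inter> space M = {}" by blast
      then have "?p v = 0" by (simp only: measure_empty)
      then show "?p v * ln (?p v) = 0" by simp
    qed
  qed (use sp simple_functionD(1)[OF X] in auto)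
  then show ?thesis
    by (simp add: rv_entropy_def eq)
qed

context prob_space
begin

lemma rv_entropy_nonneg: "0 \<le> rv_entropy M X"
proof -
  have "prob A * ln (prob A) \<le> 0" for A
    by (cases "prob A = 0") (auto intro!: mult_nonneg_nonpos simp: less_le)
  then show ?thesis
    unfolding rv_entropy_def by (simp add: sum_nonpos)
qed

lemma prob_fibre_comp:
  assumes "simple_function M U"
  shows "prob ((\<lambda>\<omega>. g (U \<omega>)) -` {v} \<inter> space M) = (\<Sum>u | u \<in> U ` space M \<and> g u = v. prob (U -` {u} \<inter> space M))"
proof -
  have "(\<lambda>\<omega>. g (U \<omega>)) -` {v} \<inter> space M = (\<Union>u \<in> {u \<in> U ` space M. g u = v}. U -` {u} \<inter> space M)"
    by auto
  also have "prob \<dots> = (\<Sum>u | u \<in> U ` space M \<and> g u = v. prob (U -` {u} \<inter> space M))"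
    using assms by (intro finite_measure_finite_Union) (auto simp: simple_function_def disjoint_family_on_def)
  finally show ?thesis .
qed

lemma sum_prob_fibres:
  assumes "simple_function M U"
  shows "(\<Sum>u \<in> U ` space M. prob (U -` {u} \<inter> space M)) = 1"
  using prob_fibre_comp[OF assms, of "\<lambda>_. ()" "()"] by (simp add: prob_space)

text \<open>
  Both entropies of a pair and of its parts, once written as sums over the values of the same variable
  \<open>U\<close>, can be compared term by term.
\<close>

lemma rv_entropy_comp:
  assumes "simple_function M U"
  shows "rv_entropy M (\<lambda>\<omega>. g (U \<omega>)) =
    - (\<Sum>u \<in> U ` space M. prob (U -` {u} \<inter> space M) * ln (prob ((\<lambda>\<omega>. g (U \<omega>)) -` {g u} \<inter> space M)))"
proof -
  have fin: "finite (U ` space M)"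
    using assms by (simp add: simple_function_def)
  have "(\<Sum>u \<in> U ` space M. prob (U -` {u} \<inter> space M) * ln (prob ((\<lambda>\<omega>. g (U \<omega>)) -` {g u} \<inter> space M)))
      = (\<Sum>v \<in> g ` U ` space M. \<Sum>u | u \<in> U ` space M \<and> g u = v.
          prob (U -` {u} \<inter> space M) * ln (prob ((\<lambda>\<omega>. g (U \<omega>)) -` {g u} \<inter> space M)))"
    by (rule sum.image_gen[OF fin])
  also have "\<dots> = (\<Sum>v \<in> g ` U ` space M.
      (\<Sum>u | u \<in> U ` space M \<and> g u = v. prob (U -` {u} \<inter> space M))
        * ln (prob ((\<lambda>\<omega>. g (U \<omega>)) -` {v} \<inter> space M)))"
    by (auto simp: sum_distrib_right intro!: sum.cong)
  also have "\<dots> = - rv_entropy M (\<lambda>\<omega>. g (U \<omega>))"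
    unfolding rv_entropy_def prob_fibre_comp[OF assms, of g] by (simp add: image_image)
  finally show ?thesis by simp
qed

lemma rv_entropy_comp_le:
  assumes "simple_function M U"
  shows "rv_entropy M (\<lambda>\<omega>. g (U \<omega>)) \<le> rv_entropy M U"
proof -
  have "prob (U -` {u} \<inter> space M) * ln (prob (U -` {u} \<inter> space M))
      \<le> prob (U -` {u} \<inter> space M) * ln (prob ((\<lambda>\<omega>. g (U \<omega>)) -` {g u} \<inter> space M))" for u
  proof (cases "prob (U -` {u} \<inter> space M) = 0")
    case False
    have "simple_function M (g \<circ> U)"
      using assms by auto
    then have "(\<lambda>\<omega>. g (U \<omega>)) -` {g u} \<inter> space M \<in> sets M"
      using simple_functionD(2)[of M "g \<circ> U" "{g u}"] by (simp add: comp_def)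
    then have "prob (U -` {u} \<inter> space M) \<le> prob ((\<lambda>\<omega>. g (U \<omega>)) -` {g u} \<inter> space M)"
      by (intro finite_measure_mono) auto
    moreover have "0 < prob (U -` {u} \<inter> space M)"
      using False by (simp add: less_le)
    ultimately show ?thesis
      by (intro mult_left_mono) (auto simp: ln_mono)
  qed simp
  then show ?thesis
    unfolding rv_entropy_comp[OF assms] rv_entropy_def[of M U] by (simp add: sum_mono)
qed

lemma rv_entropy_relabel:
  assumes "simple_function M U" and "\<And>\<omega>. V \<omega> = g (U \<omega>)" and "\<And>\<omega>. U \<omega> = h (V \<omega>)"
  shows "rv_entropy M V = rv_entropy M U"
proof (rule antisym)
  have V: "V = (\<lambda>\<omega>. g (U \<omega>))" and U: "U = (\<lambda>\<omega>. h (V \<omega>))"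
    using assms by auto
  show "rv_entropy M V \<le> rv_entropy M U"
    unfolding V by (rule rv_entropy_comp_le[OF assms(1)])
  have "simple_function M (g \<circ> U)"
    using assms(1) by auto
  then have "simple_function M V"
    unfolding V by (simp add: comp_def)
  then show "rv_entropy M U \<le> rv_entropy M V"
    by (subst U) (rule rv_entropy_comp_le)
qed

text \<open>
  Conditioning on more information lowers the entropy: \<open>H(X | D) \<le> H(X | f(D))\<close>.  This is Gibbs'
  inequality: by \<open>ln t \<le> t - 1\<close> the difference is at most the total mass of
  \<open>P(X = x, f(D) = f(d)) P(D = d) / P(f(D) = f(d))\<close> minus one, and this total mass is at most one.
\<close>

lemma conditional_entropy_mono:
  assumes X: "simple_function M X" and D: "simple_function M D"
  shows "rv_entropy M (\<lambda>\<omega>. (X \<omega>, D \<omega>)) - rv_entropy M D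
    \<le> rv_entropy M (\<lambda>\<omega>. (X \<omega>, f (D \<omega>))) - rv_entropy M (\<lambda>\<omega>. f (D \<omega>))"
proof -
  define U where "U = (\<lambda>\<omega>. (X \<omega>, D \<omega>))"
  have U: "simple_function M U"
    unfolding U_def using X D by (rule simple_function_Pair)
  define p where "p u = prob (U -` {u} \<inter> space M)" for u
  define q where "q d = prob (D -` {d} \<inter> space M)" for d
  define r where "r v = prob ((\<lambda>\<omega>. (X \<omega>, f (D \<omega>))) -` {v} \<inter> space M)" for v
  define s where "s e = prob ((\<lambda>\<omega>. f (D \<omega>)) -` {e} \<inter> space M)" for e
  let ?S = "U ` space M"
  have finS: "finite ?S" and finX: "finite (X ` space M)" and finD: "finite (D ` space M)"
    using U X D by (auto simp: simple_function_def)
  have hD: "rv_entropy M D = - (\<Sum>u\<in>?S. p u * ln (q (snd u)))"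
    using rv_entropy_comp[OF U, of snd] by (simp add: p_def q_def U_def)
  have hU: "rv_entropy M U = - (\<Sum>u\<in>?S. p u * ln (p u))"
    by (simp add: rv_entropy_def p_def)
  have hXf: "rv_entropy M (\<lambda>\<omega>. (X \<omega>, f (D \<omega>))) = - (\<Sum>u\<in>?S. p u * ln (r (fst u, f (snd u))))"
    using rv_entropy_comp[OF U, of "\<lambda>(x, d). (x, f d)"] by (simp add: p_def r_def U_def case_prod_beta)
  have hf: "rv_entropy M (\<lambda>\<omega>. f (D \<omega>)) = - (\<Sum>u\<in>?S. p u * ln (s (f (snd u))))"
    using rv_entropy_comp[OF U, of "\<lambda>(x, d). f d"] by (simp add: p_def s_def U_def case_prod_beta)
  have sfXf: "simple_function M (\<lambda>\<omega>. (X \<omega>, f (D \<omega>)))" and sff: "simple_function M (\<lambda>\<omega>. f (D \<omega>))"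
    using simple_function_compose[OF U, of "\<lambda>(x, d). (x, f d)"] simple_function_compose[OF D, of f]
    by (simp_all add: U_def comp_def)
  have meas: "U -` {u} \<inter> space M \<in> events" "D -` {d} \<inter> space M \<in> events"
     "(\<lambda>\<omega>. (X \<omega>, f (D \<omega>))) -` {v} \<inter> space M \<in> events" "(\<lambda>\<omega>. f (D \<omega>)) -` {e} \<inter> space M \<in> events" for u d v e
    using U D sfXf sff by (auto intro: simple_functionD)
  have pq: "p u \<le> q (snd u)" and pr: "p u \<le> r (fst u, f (snd u))" and ps: "p u \<le> s (f (snd u))" for u
    unfolding p_def q_def r_def s_def by (rule finite_measure_mono, auto simp: U_def meas)+
  have nn: "0 \<le> p u" "0 \<le> q d" "0 \<le> r v" "0 \<le> s e" for u d v e
    by (auto simp: p_def q_def r_def s_def)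
  have qs: "q d \<le> s (f d)" for d
    unfolding q_def s_def by (rule finite_measure_mono) (auto simp: meas)
  have pointwise: "p u * (ln (q (snd u)) + ln (r (fst u, f (snd u))) - ln (p u) - ln (s (f (snd u))))
      \<le> r (fst u, f (snd u)) * (q (snd u) / s (f (snd u))) - p u" for u
  proof (cases "p u = 0")
    case False
    then have pos: "0 < p u" using nn(1)[of u] by simp
    have pos': "0 < q (snd u)" "0 < r (fst u, f (snd u))" "0 < s (f (snd u))"
      using pos pq[of u] pr[of u] ps[of u] by linarith+
    define t where "t = r (fst u, f (snd u)) * q (snd u) / (s (f (snd u)) * p u)"
    have "0 < t" unfolding t_def using pos pos' by simp
    have "ln t = ln (q (snd u)) + ln (r (fst u, f (snd u))) - ln (p u) - ln (s (f (snd u)))"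
      unfolding t_def using pos pos' by (simp add: ln_mult ln_div)
    moreover have "p u * ln t \<le> p u * (t - 1)"
      using ln_le_minus_one[OF \<open>0 < t\<close>] pos by (intro mult_left_mono) auto
    moreover have "p u * (t - 1) = r (fst u, f (snd u)) * (q (snd u) / s (f (snd u))) - p u"
      unfolding t_def using pos pos' by (simp add: field_simps)
    ultimately show ?thesis by simp
  qed (simp add: nn)
  have sum_r: "(\<Sum>x \<in> X ` space M. r (x, e)) = s e" for e
  proof -
    have "(\<Sum>x \<in> X ` space M. r (x, e)) = (\<Sum>v \<in> (\<lambda>x. (x, e)) ` X ` space M. r v)"
      by (subst sum.reindex) (auto simp: inj_on_def)
    also have "\<dots> = (\<Sum>v | v \<in> (\<lambda>\<omega>. (X \<omega>, f (D \<omega>))) ` space M \<and> snd v = e. r v)"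
    proof (rule sum.mono_neutral_right)
      show "\<forall>v\<in>(\<lambda>x. (x, e)) ` X ` space M - {v \<in> (\<lambda>\<omega>. (X \<omega>, f (D \<omega>))) ` space M. snd v = e}. r v = 0"
      proof
        fix v assume "v \<in> (\<lambda>x. (x, e)) ` X ` space M - {v \<in> (\<lambda>\<omega>. (X \<omega>, f (D \<omega>))) ` space M. snd v = e}"
        moreover from this have "snd v = e" by auto
        ultimately have "v \<notin> (\<lambda>\<omega>. (X \<omega>, f (D \<omega>))) ` space M" by blast
        then have "(\<lambda>\<omega>. (X \<omega>, f (D \<omega>))) -` {v} \<inter> space M = {}" by blast
        then show "r v = 0" unfolding r_def by (simp only: measure_empty)
      qed
    qed (use finX in auto)
    also have "\<dots> = s e"
      using prob_fibre_comp[OF sfXf, of snd e] by (simp add: s_def r_def)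
    finally show ?thesis .
  qed
  have "(\<Sum>u\<in>?S. r (fst u, f (snd u)) * (q (snd u) / s (f (snd u))))
      \<le> (\<Sum>u\<in>X ` space M \<times> D ` space M. r (fst u, f (snd u)) * (q (snd u) / s (f (snd u))))"
    using finX finD nn by (intro sum_mono2) (auto simp: U_def)
  also have "\<dots> = (\<Sum>x\<in>X ` space M. \<Sum>d\<in>D ` space M. r (x, f d) * (q d / s (f d)))"
    by (simp add: sum.cartesian_product case_prod_beta)
  also have "\<dots> = (\<Sum>d\<in>D ` space M. s (f d) * (q d / s (f d)))"
    by (subst sum.swap) (simp add: sum_distrib_right[symmetric] sum_r sum_divide_distrib[symmetric])
  also have "\<dots> \<le> (\<Sum>d\<in>D ` space M. q d)"
    using nn by (intro sum_mono) auto
  also have "\<dots> = 1"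
    unfolding q_def by (rule sum_prob_fibres[OF D])
  finally have le1: "(\<Sum>u\<in>?S. r (fst u, f (snd u)) * (q (snd u) / s (f (snd u)))) \<le> 1" .
  have sump: "(\<Sum>u\<in>?S. p u) = 1"
    unfolding p_def by (rule sum_prob_fibres[OF U])
  have "(rv_entropy M U - rv_entropy M D) - (rv_entropy M (\<lambda>\<omega>. (X \<omega>, f (D \<omega>))) - rv_entropy M (\<lambda>\<omega>. f (D \<omega>)))
     = (\<Sum>u\<in>?S. p u * (ln (q (snd u)) + ln (r (fst u, f (snd u))) - ln (p u) - ln (s (f (snd u)))))"
    unfolding hU hD hXf hf by (simp add: algebra_simps sum.distrib sum_subtractf)
  also have "\<dots> \<le> (\<Sum>u\<in>?S. r (fst u, f (snd u)) * (q (snd u) / s (f (snd u))) - p u)"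
    by (rule sum_mono) (rule pointwise)
  also have "\<dots> \<le> 0"
    using le1 sump by (simp add: sum_subtractf)
  finally show ?thesis unfolding U_def by simp
qed

lemma rv_entropy_Pair_le:
  assumes X: "simple_function M X" and Y: "simple_function M Y"
  shows "rv_entropy M (\<lambda>\<omega>. (X \<omega>, Y \<omega>)) \<le> rv_entropy M X + rv_entropy M Y"
proof -
  have "rv_entropy M (\<lambda>\<omega>. (X \<omega>, ())) = rv_entropy M X"
    by (rule rv_entropy_relabel[OF X, of _ "\<lambda>x. (x, ())" fst]) auto
  moreover have "rv_entropy M (\<lambda>_. ()) = 0"
    by (simp add: rv_entropy_def image_constant_conv prob_space)
  ultimately show ?thesis
    using conditional_entropy_mono[OF X Y, of "\<lambda>_. ()"] by simp
qed

text \<open>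
  If a function of \<open>C\<close> predicts each letter up to conditional entropy \<open>\<delta>\<close>, then a list of \<open>n\<close> letters
  costs at most \<open>n * \<delta>\<close> on top of \<open>C\<close>.  Both upper bounds for entropy rates below rest on this.
\<close>

lemma conditional_entropy_list_le:
  assumes X: "\<And>i. i < n \<Longrightarrow> simple_function M (X i)" and C: "simple_function M C"
    and h: "\<And>i. i < n \<Longrightarrow> rv_entropy M (\<lambda>\<omega>. (X i \<omega>, f i (C \<omega>))) - rv_entropy M (\<lambda>\<omega>. f i (C \<omega>)) \<le> \<delta>"
  shows "simple_function M (\<lambda>\<omega>. map (\<lambda>i. X i \<omega>) [0..<n])"
    and "rv_entropy M (\<lambda>\<omega>. (map (\<lambda>i. X i \<omega>) [0..<n], C \<omega>)) \<le> rv_entropy M C + real n * \<delta>"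
proof -
  have "simple_function M (\<lambda>\<omega>. map (\<lambda>i. X i \<omega>) [0..<n]) \<and>
    rv_entropy M (\<lambda>\<omega>. (map (\<lambda>i. X i \<omega>) [0..<n], C \<omega>)) \<le> rv_entropy M C + real n * \<delta>"
    using X h
  proof (induction n)
    case 0
    show ?case
      using rv_entropy_comp_le[OF C, of "\<lambda>c. ([], c)"] by simp
  next
    case (Suc n)
    let ?W = "\<lambda>\<omega>. map (\<lambda>i. X i \<omega>) [0..<n]"
    have IH: "simple_function M ?W" "rv_entropy M (\<lambda>\<omega>. (?W \<omega>, C \<omega>)) \<le> rv_entropy M C + real n * \<delta>"
      using Suc by auto
    have sX: "simple_function M (X n)" using Suc by auto
    have sD: "simple_function M (\<lambda>\<omega>. (?W \<omega>, C \<omega>))"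
      by (rule simple_function_Pair[OF IH(1) C])
    have sXD: "simple_function M (\<lambda>\<omega>. (X n \<omega>, ?W \<omega>, C \<omega>))"
      by (rule simple_function_Pair[OF sX sD])
    have "rv_entropy M (\<lambda>\<omega>. (X n \<omega>, ?W \<omega>, C \<omega>)) - rv_entropy M (\<lambda>\<omega>. (?W \<omega>, C \<omega>)) \<le> \<delta>"
      using conditional_entropy_mono[OF sX sD, of "\<lambda>d. f n (snd d)"] Suc.prems(2)[of n] by simp
    moreover have "rv_entropy M (\<lambda>\<omega>. (map (\<lambda>i. X i \<omega>) [0..<Suc n], C \<omega>))
        \<le> rv_entropy M (\<lambda>\<omega>. (X n \<omega>, ?W \<omega>, C \<omega>))"
      using rv_entropy_comp_le[OF sXD, of "\<lambda>(x, w, c). (w @ [x], c)"] by simp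
    moreover have "simple_function M (\<lambda>\<omega>. map (\<lambda>i. X i \<omega>) [0..<Suc n])"
      using simple_function_compose[OF sXD, of "\<lambda>(x, w, c). w @ [x]"] by (simp add: comp_def)
    ultimately show ?case
      using IH(2) by (simp add: algebra_simps)
  qed
  then show "simple_function M (\<lambda>\<omega>. map (\<lambda>i. X i \<omega>) [0..<n])"
    and "rv_entropy M (\<lambda>\<omega>. (map (\<lambda>i. X i \<omega>) [0..<n], C \<omega>)) \<le> rv_entropy M C + real n * \<delta>"
    by auto
qed

end

lemma continuous_on_mult_ln: "continuous_on {0..1::real} (\<lambda>t. t * ln t)"
proof -
  have "continuous (at t within {0..1}) (\<lambda>t. t * ln t)" if "t \<in> {0..1}" for t :: real
  proof (cases "t = 0")
    case True
    have "((\<lambda>t::real. t * ln t) \<longlongrightarrow> 0) (at_right 0)"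
      by real_asymp
    moreover have "at 0 within {0..1} = at_right (0::real)"
      by (rule at_within_Icc_at_right) simp
    ultimately show ?thesis
      by (simp add: continuous_within True)
  next
    case False
    then show ?thesis
      by (intro continuous_intros) auto
  qed
  then show ?thesis
    by (simp add: continuous_on_eq_continuous_within)
qed

text \<open>
  A qualitative form of Fano's inequality: a good guess \<open>Y\<close> of \<open>X\<close> makes \<open>H(X | Y)\<close> small.
  The joint law is close to the law of \<open>Y\<close> on the diagonal and close to zero off the diagonal, and
  \<open>t ln t\<close> is uniformly continuous on the unit interval.  The bound depends on the set of values only,
  so that one \<open>\<epsilon>\<close> serves all coordinates at once.
\<close>

lemma (in prob_space) fano_continuity:
  fixes V :: "'b set"
  assumes V: "finite V" and "0 < \<delta>"
  shows "\<exists>\<epsilon>>0. \<forall>X Y. simple_function M X \<longrightarrow> simple_function M Y \<longrightarrow>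
      X ` space M \<subseteq> V \<longrightarrow> Y ` space M \<subseteq> V \<longrightarrow> prob {\<omega> \<in> space M. X \<omega> \<noteq> Y \<omega>} < \<epsilon> \<longrightarrow>
      rv_entropy M (\<lambda>\<omega>. (X \<omega>, Y \<omega>)) - rv_entropy M Y \<le> \<delta>"
proof -
  let ?n = "real (card V) + 1"
  define \<delta>' where "\<delta>' = \<delta> / (?n * ?n)"
  have "0 < \<delta>'" unfolding \<delta>'_def using \<open>0 < \<delta>\<close> by (intro divide_pos_pos mult_pos_pos) auto
  have "uniformly_continuous_on {0..1::real} (\<lambda>t. t * ln t)"
    by (rule compact_uniformly_continuous[OF continuous_on_mult_ln]) simp
  then obtain \<epsilon> where \<epsilon>: "0 < \<epsilon>" "\<And>s t. s \<in> {0..1} \<Longrightarrow> t \<in> {0..1} \<Longrightarrow> \<bar>t - s\<bar> < \<epsilon> \<Longrightarrow> \<bar>t * ln t - s * ln s\<bar> < \<delta>'"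
    using \<open>0 < \<delta>'\<close> unfolding uniformly_continuous_on_def dist_real_def by metis
  show ?thesis
  proof (intro exI[of _ \<epsilon>] conjI allI impI \<epsilon>(1))
    fix X Y :: "'a \<Rightarrow> 'b"
    assume X: "simple_function M X" and Y: "simple_function M Y"
      and XV: "X ` space M \<subseteq> V" and YV: "Y ` space M \<subseteq> V"
      and small: "prob {\<omega> \<in> space M. X \<omega> \<noteq> Y \<omega>} < \<epsilon>"
    define p where "p u = prob ((\<lambda>\<omega>. (X \<omega>, Y \<omega>)) -` {u} \<inter> space M)" for u
    define q where "q b = prob (Y -` {b} \<inter> space M)" for b
    have XY: "simple_function M (\<lambda>\<omega>. (X \<omega>, Y \<omega>))"
      by (rule simple_function_Pair[OF X Y])
    have ev: "{\<omega> \<in> space M. X \<omega> \<noteq> Y \<omega>} \<in> events"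
    proof -
      have "{\<omega> \<in> space M. X \<omega> \<noteq> Y \<omega>} = (\<lambda>\<omega>. (X \<omega>, Y \<omega>)) -` {u. fst u \<noteq> snd u} \<inter> space M" by auto
      then show ?thesis using simple_functionD(2)[OF XY] by metis
    qed
    have meas: "(\<lambda>\<omega>. (X \<omega>, Y \<omega>)) -` {u} \<inter> space M \<in> events" "Y -` {b} \<inter> space M \<in> events" for u b
      using simple_functionD(2)[OF XY] simple_functionD(2)[OF Y] by auto
    have p01: "p u \<in> {0..1}" and q01: "q b \<in> {0..1}" for u b
      unfolding p_def q_def by auto
    have off: "p (a, b) < \<epsilon>" if "a \<noteq> b" for a b
    proof -
      have "p (a, b) \<le> prob {\<omega> \<in> space M. X \<omega> \<noteq> Y \<omega>}"
        unfolding p_def using that ev by (intro finite_measure_mono) auto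
      then show ?thesis using small by simp
    qed
    have diag: "\<bar>p (b, b) - q b\<bar> < \<epsilon>" for b
    proof -
      have "p (b, b) \<le> q b"
        unfolding p_def q_def using meas by (intro finite_measure_mono) auto
      moreover have "q b \<le> prob (((\<lambda>\<omega>. (X \<omega>, Y \<omega>)) -` {(b, b)} \<inter> space M) \<union> {\<omega> \<in> space M. X \<omega> \<noteq> Y \<omega>})"
        unfolding q_def using meas ev by (intro finite_measure_mono) auto
      moreover have "\<dots> \<le> p (b, b) + prob {\<omega> \<in> space M. X \<omega> \<noteq> Y \<omega>}"
        unfolding p_def using meas ev by (intro measure_Un_le) auto
      ultimately show ?thesis using small by linarith
    qed
    have hXY: "rv_entropy M (\<lambda>\<omega>. (X \<omega>, Y \<omega>)) = - (\<Sum>a\<in>V. \<Sum>b\<in>V. p (a, b) * ln (p (a, b)))"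
    proof -
      have "(\<Sum>u\<in>V \<times> V. p u * ln (p u)) = (\<Sum>u\<in>(\<lambda>\<omega>. (X \<omega>, Y \<omega>)) ` space M. p u * ln (p u))"
      proof (rule sum.mono_neutral_right)
        show "\<forall>u\<in>V \<times> V - (\<lambda>\<omega>. (X \<omega>, Y \<omega>)) ` space M. p u * ln (p u) = 0"
        proof
          fix u assume "u \<in> V \<times> V - (\<lambda>\<omega>. (X \<omega>, Y \<omega>)) ` space M"
          then have "(\<lambda>\<omega>. (X \<omega>, Y \<omega>)) -` {u} \<inter> space M = {}" by auto
          then have "p u = 0" unfolding p_def by (simp only: measure_empty)
          then show "p u * ln (p u) = 0" by simp
        qed
      qed (use V XV YV in auto)
      then show ?thesis
        by (simp add: rv_entropy_def p_def[symmetric] sum.cartesian_product)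
    qed
    have hY: "rv_entropy M Y = - (\<Sum>b\<in>V. q b * ln (q b))"
    proof -
      have "(\<Sum>b\<in>V. q b * ln (q b)) = (\<Sum>b\<in>Y ` space M. q b * ln (q b))"
      proof (rule sum.mono_neutral_right)
        show "\<forall>b\<in>V - Y ` space M. q b * ln (q b) = 0"
        proof
          fix b assume "b \<in> V - Y ` space M"
          then have "Y -` {b} \<inter> space M = {}" by auto
          then have "q b = 0" unfolding q_def by (simp only: measure_empty)
          then show "q b * ln (q b) = 0" by simp
        qed
      qed (use V YV in auto)
      then show ?thesis
        by (simp add: rv_entropy_def q_def[symmetric])
    qed
    have hY': "rv_entropy M Y = - (\<Sum>a\<in>V. \<Sum>b\<in>V. if a = b then q b * ln (q b) else 0)"
      unfolding hY using V by simp
    have term_le: "(if a = b then q b * ln (q b) else 0) - p (a, b) * ln (p (a, b)) \<le> \<delta>'" for a b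
    proof (cases "a = b")
      case True
      then show ?thesis using \<epsilon>(2)[OF q01[of b] p01[of "(b, b)"]] diag[of b] by auto
    next
      case False
      have "\<bar>p (a, b) * ln (p (a, b)) - 0 * ln 0\<bar> < \<delta>'"
        using \<epsilon>(2)[of 0 "p (a, b)"] p01[of "(a, b)"] off[OF False] by auto
      then show ?thesis using False by simp
    qed
    have "rv_entropy M (\<lambda>\<omega>. (X \<omega>, Y \<omega>)) - rv_entropy M Y
        = (\<Sum>a\<in>V. \<Sum>b\<in>V. (if a = b then q b * ln (q b) else 0) - p (a, b) * ln (p (a, b)))"
      unfolding hXY hY' by (simp add: sum_subtractf)
    also have "\<dots> \<le> (\<Sum>a\<in>V. \<Sum>b\<in>V. \<delta>')"
      by (intro sum_mono term_le)
    also have "\<dots> = (real (card V) * real (card V)) * \<delta>'"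
      by simp
    also have "\<dots> \<le> (?n * ?n) * \<delta>'"
      using \<open>0 < \<delta>'\<close> by (intro mult_right_mono mult_mono) auto
    also have "\<dots> = \<delta>"
      unfolding \<delta>'_def by (simp add: add_nonneg_eq_0_iff)
    finally show "rv_entropy M (\<lambda>\<omega>. (X \<omega>, Y \<omega>)) - rv_entropy M Y \<le> \<delta>" .
  qed
qed

section \<open>Partitions, itineraries and the entropy rate\<close>

text \<open>
  Fekete's lemma: the limit is the infimum of the quotients, because division of \<open>n\<close> by \<open>m\<close> with
  remainder compares \<open>a n / n\<close> with \<open>a m / m\<close> up to a bounded multiple of \<open>1 / n\<close>.
\<close>

lemma subadditive_limit_exists:
  fixes a :: "nat \<Rightarrow> real"
  assumes nonneg: "\<And>n. 0 \<le> a n" and sub: "\<And>m n. a (m + n) \<le> a m + a n"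
  shows "convergent (\<lambda>n. a n / real n)"
proof -
  define L where "L = (INF n\<in>{1..}. a n / real n)"
  have bdd: "bdd_below ((\<lambda>n. a n / real n) ` {1..})"
    using nonneg by (intro bdd_belowI2[of _ 0]) auto
  have lower: "L \<le> a n / real n" if "1 \<le> n" for n
    unfolding L_def using that bdd by (intro cINF_lower) auto
  have mult: "a (k * m + r) \<le> real k * a m + a r" for k m r
  proof (induction k)
    case (Suc k)
    have "a (Suc k * m + r) \<le> a m + a (k * m + r)"
      using sub[of m "k * m + r"] by (simp add: add.assoc)
    with Suc show ?case by (simp add: algebra_simps)
  qed simp
  have "(\<lambda>n. a n / real n) \<longlonglongrightarrow> L"
  proof (rule LIMSEQ_I)
    fix \<epsilon> :: real assume "0 < \<epsilon>"
    have "(INF n\<in>{1::nat..}. a n / real n) < L + \<epsilon> / 2"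
      using \<open>0 < \<epsilon>\<close> unfolding L_def by simp
    then obtain m where m: "1 \<le> m" "a m / real m < L + \<epsilon> / 2"
      using bdd by (subst (asm) cINF_less_iff) auto
    define B where "B = Max (a ` {..<m})"
    have B: "a r \<le> B" if "r < m" for r
      unfolding B_def using that by (intro Max_ge) auto
    have "0 \<le> B" using B[of 0] nonneg[of 0] m by auto
    obtain N where N: "2 * B / \<epsilon> < real N"
      using reals_Archimedean2 by blast
    have "norm (a n / real n - L) < \<epsilon>" if n: "n \<ge> max 1 N" for n
    proof -
      have n0: "0 < real n" using n by auto
      have "a n = a (n div m * m + n mod m)" by simp
      also have "\<dots> \<le> real (n div m) * a m + a (n mod m)"
        by (rule mult)
      also have "\<dots> \<le> real (n div m) * a m + B"
        using B[of "n mod m"] m by simp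
      also have "real (n div m) * a m = (real (n div m) * real m) * (a m / real m)"
        using m by simp
      also have "\<dots> \<le> real n * (a m / real m)"
        using nonneg[of m] by (intro mult_right_mono)
          (simp_all flip: of_nat_mult)
      finally have "a n / real n \<le> a m / real m + B / real n"
        using n0 by (simp add: field_simps)
      moreover have "B / real n < \<epsilon> / 2"
      proof -
        have "2 * B / \<epsilon> < real n" using N n by linarith
        then show ?thesis using n0 \<open>0 < \<epsilon>\<close> by (simp add: field_simps)
      qed
      ultimately have "a n / real n - L < \<epsilon>"
        using m(2) by linarith
      then show ?thesis
        using lower[of n] n by simp
    qed
    then show "\<exists>no. \<forall>n\<ge>no. norm (a n / real n - L) < \<epsilon>" by blast
  qed
  then show ?thesis by (rule convergentI)
qed

lemma partition_on_eq_classes: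
  assumes P: "partition_on \<Omega> P"
    and R: "\<And>x y. x \<in> \<Omega> \<Longrightarrow> y \<in> \<Omega> \<Longrightarrow> R x y \<longleftrightarrow> (\<exists>A\<in>P. x \<in> A \<and> y \<in> A)"
  shows "P = (\<lambda>y. {x \<in> \<Omega>. R x y}) ` \<Omega>"
proof -
  have un: "\<Union>P = \<Omega>" and ne: "{} \<notin> P"
    and disj: "\<And>A B x. A \<in> P \<Longrightarrow> B \<in> P \<Longrightarrow> x \<in> A \<Longrightarrow> x \<in> B \<Longrightarrow> A = B"
    using P by (auto simp: partition_on_def disjoint_def)
  have cls: "{x \<in> \<Omega>. R x y} = A" if "A \<in> P" "y \<in> A" for A y
  proof -
    have sub: "A \<subseteq> \<Omega>" using un \<open>A \<in> P\<close> by auto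
    then have "y \<in> \<Omega>" using \<open>y \<in> A\<close> by auto
    show ?thesis
    proof (intro set_eqI iffI)
      fix x assume "x \<in> {x \<in> \<Omega>. R x y}"
      then obtain B where "B \<in> P" "x \<in> B" "y \<in> B"
        using R[of x y] \<open>y \<in> \<Omega>\<close> by auto
      then show "x \<in> A" using disj that by blast
    next
      fix x assume "x \<in> A"
      then show "x \<in> {x \<in> \<Omega>. R x y}"
        using R[of x y] that sub by auto
    qed
  qed
  show ?thesis
  proof (intro set_eqI iffI)
    fix A assume "A \<in> P"
    moreover from this obtain y where "y \<in> A" using ne by (metis all_not_in_conv)
    ultimately show "A \<in> (\<lambda>y. {x \<in> \<Omega>. R x y}) ` \<Omega>"
      using cls[of A y] un by blast
  next
    fix A assume "A \<in> (\<lambda>y. {x \<in> \<Omega>. R x y}) ` \<Omega>"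
    then obtain y where y: "y \<in> \<Omega>" "A = {x \<in> \<Omega>. R x y}" by auto
    moreover from y obtain B where "B \<in> P" "y \<in> B" using un by auto
    ultimately show "A \<in> P" using cls by metis
  qed
qed

text \<open>
  The label is the set of all indices whose set contains the point.  For a partition this is a
  singleton, but the approximations of its atoms may overlap or leave gaps, and then the label still
  takes values in the finite set \<open>Pow I\<close>.
\<close>

definition atom_label :: "'i set \<Rightarrow> ('i \<Rightarrow> 'a set) \<Rightarrow> 'a \<Rightarrow> 'i set" where
  "atom_label I B y = {i \<in> I. y \<in> B i}"

lemma simple_function_atom_label:
  assumes "finite I" "\<And>i. i \<in> I \<Longrightarrow> B i \<in> sets M"
  shows "simple_function M (atom_label I B)"
  unfolding simple_function_def
proof (intro conjI ballI)
  show "finite (atom_label I B ` space M)"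
    by (rule finite_subset[of _ "Pow I"]) (auto simp: atom_label_def assms)
  fix w assume "w \<in> atom_label I B ` space M"
  then have "w \<subseteq> I" by (auto simp: atom_label_def)
  then have eq: "atom_label I B -` {w} \<inter> space M = {y \<in> space M. \<forall>i\<in>I. (y \<in> B i) = (i \<in> w)}"
    unfolding atom_label_def by blast
  have "{y \<in> space M. \<forall>i\<in>I. (y \<in> B i) = (i \<in> w)} \<in> sets M"
  proof (rule sets.sets_Collect_finite_All[where P="\<lambda>i y. (y \<in> B i) = (i \<in> w)"])
    fix i assume "i \<in> I"
    have "{y \<in> space M. (y \<in> B i) = (i \<in> w)} = (if i \<in> w then B i \<inter> space M else space M - B i)"
      by auto
    then show "{y \<in> space M. (y \<in> B i) = (i \<in> w)} \<in> sets M"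
      using assms(2)[OF \<open>i \<in> I\<close>] by auto
  qed (rule assms(1))
  then show "atom_label I B -` {w} \<inter> space M \<in> sets M"
    by (simp only: eq)
qed

definition itinerary :: "('a \<Rightarrow> 'a) \<Rightarrow> ('a \<Rightarrow> 'b) \<Rightarrow> nat \<Rightarrow> 'a \<Rightarrow> 'b list" where
  "itinerary T X n y = map (\<lambda>i. X ((T ^^ i) y)) [0..<n]"

text \<open>
  Two points lie in the same atom of the join exactly if their orbits visit the same atoms at the
  times \<open>0, \<dots>, n - 1\<close>.  This turns the entropy of a join into the entropy of a random word.
\<close>

lemma iterated_join_eq_fibres:
  assumes T: "T \<in> measurable M M" and \<xi>: "finite_measurable_partition M \<xi>" and n: "0 < n"
  defines "W \<equiv> itinerary T (atom_label \<xi> id) n"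
  shows "iterated_join M T \<xi> n = (\<lambda>w. W -` {w} \<inter> space M) ` W ` space M"
proof -
  let ?P = "\<lambda>i. pullback_partition M (T ^^ i) \<xi>"
  let ?g = "atom_label \<xi> id"
  have Tsp: "(T ^^ i) y \<in> space M" if "y \<in> space M" for i y
    using that T by (induction i) (auto simp: measurable_space)
  have part: "partition_on (space M) \<xi>"
    using \<xi> by (simp add: finite_measurable_partition_def)
  have un: "\<Union>\<xi> = space M"
    and disj: "\<And>A B x. A \<in> \<xi> \<Longrightarrow> B \<in> \<xi> \<Longrightarrow> x \<in> A \<Longrightarrow> x \<in> B \<Longrightarrow> A = B"
    using part by (auto simp: partition_on_def disjoint_def)
  have ex: "\<exists>A\<in>\<xi>. y \<in> A" if "y \<in> space M" for y using un that by blast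
  have lab: "?g x = ?g y \<longleftrightarrow> (\<exists>A\<in>\<xi>. x \<in> A \<and> y \<in> A)" if "x \<in> space M" "y \<in> space M" for x y
    using ex[OF that(1)] ex[OF that(2)] disj unfolding atom_label_def set_eq_iff by (simp) metis
  have pP: "partition_on (space M) (?P i)" for i
  proof (rule partition_onI)
    show "\<Union> (?P i) = space M"
    proof (intro set_eqI iffI)
      fix y assume y: "y \<in> space M"
      obtain A where "A \<in> \<xi>" "(T ^^ i) y \<in> A" using ex[OF Tsp[OF y]] by blast
      then have "(T ^^ i) -` A \<inter> space M \<in> ?P i" "y \<in> (T ^^ i) -` A \<inter> space M"
        using y by (auto simp: pullback_partition_def)
      then show "y \<in> \<Union> (?P i)" by blast
    qed (auto simp: pullback_partition_def)
    show "{} \<notin> ?P i" by (simp add: pullback_partition_def)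
    fix p q assume "p \<in> ?P i" "q \<in> ?P i" "p \<noteq> q"
    then obtain A B where AB: "A \<in> \<xi>" "p = (T ^^ i) -` A \<inter> space M" "B \<in> \<xi>" "q = (T ^^ i) -` B \<inter> space M"
      by (auto simp: pullback_partition_def)
    with \<open>p \<noteq> q\<close> have "A \<noteq> B" by auto
    then show "disjnt p q"
      using AB disj by (auto simp: disjnt_iff)
  qed
  have same: "(\<exists>A\<in>?P i. x \<in> A \<and> y \<in> A) \<longleftrightarrow> ?g ((T ^^ i) x) = ?g ((T ^^ i) y)"
    if "x \<in> space M" "y \<in> space M" for i x y
  proof -
    have "(\<exists>A\<in>?P i. x \<in> A \<and> y \<in> A) \<longleftrightarrow> (\<exists>A\<in>\<xi>. (T ^^ i) x \<in> A \<and> (T ^^ i) y \<in> A)"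
    proof
      assume "\<exists>A\<in>?P i. x \<in> A \<and> y \<in> A"
      then obtain B where B: "B \<in> ?P i" "x \<in> B" "y \<in> B" by (elim bexE conjE)
      from B(1) obtain A where A: "A \<in> \<xi>" "B = (T ^^ i) -` A \<inter> space M"
        by (auto simp: pullback_partition_def)
      show "\<exists>A\<in>\<xi>. (T ^^ i) x \<in> A \<and> (T ^^ i) y \<in> A"
        using A(1) by (rule bexI[rotated]) (use A(2) B in simp)
    next
      assume "\<exists>A\<in>\<xi>. (T ^^ i) x \<in> A \<and> (T ^^ i) y \<in> A"
      then obtain A where A: "A \<in> \<xi>" "(T ^^ i) x \<in> A" "(T ^^ i) y \<in> A" by (elim bexE conjE)
      have "(T ^^ i) -` A \<inter> space M \<in> ?P i"
        using A that unfolding pullback_partition_def by auto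
      then show "\<exists>A\<in>?P i. x \<in> A \<and> y \<in> A"
        by (rule bexI[rotated]) (use A that in simp)
    qed
    then show ?thesis
      using lab[OF Tsp[OF that(1), of i] Tsp[OF that(2), of i]] by simp
  qed
  have pJ: "partition_on (space M) (iterated_join M T \<xi> n)"
    unfolding iterated_join_def using pP n by (intro partition_on_common_refinement) auto
  have rel: "W x = W y \<longleftrightarrow> (\<exists>A\<in>iterated_join M T \<xi> n. x \<in> A \<and> y \<in> A)"
    if xy: "x \<in> space M" "y \<in> space M" for x y
  proof
    assume "W x = W y"
    then have "\<forall>i<n. ?g ((T ^^ i) x) = ?g ((T ^^ i) y)"
      by (auto simp: W_def itinerary_def list_eq_iff_nth_eq)
    then have "\<forall>p\<in>?P ` {..<n}. \<exists>A\<in>p. x \<in> A \<and> y \<in> A"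
      using same[OF xy] by auto
    then obtain F where F: "\<And>p. p \<in> ?P ` {..<n} \<Longrightarrow> F p \<in> p \<and> x \<in> F p \<and> y \<in> F p"
      by metis
    have "x \<in> \<Inter> (F ` ?P ` {..<n})" using F by auto
    moreover have "F \<in> (\<Pi> p\<in>?P ` {..<n}. p)" using F by auto
    ultimately have "\<Inter> (F ` ?P ` {..<n}) \<in> iterated_join M T \<xi> n"
      unfolding iterated_join_def common_refinement by blast
    then show "\<exists>A\<in>iterated_join M T \<xi> n. x \<in> A \<and> y \<in> A"
      using F by blast
  next
    assume "\<exists>A\<in>iterated_join M T \<xi> n. x \<in> A \<and> y \<in> A"
    then obtain A where A: "A \<in> common_refinement (?P ` {..<n})" "x \<in> A" "y \<in> A"
      unfolding iterated_join_def by auto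
    have "?g ((T ^^ i) x) = ?g ((T ^^ i) y)" if "i < n" for i
    proof -
      have "?P i \<in> ?P ` {..<n}" using that by simp
      then have "\<exists>R\<in>?P i. A \<subseteq> R" by (rule common_refinement_exists[OF A(1)])
      then obtain R where R: "R \<in> ?P i" "A \<subseteq> R" by (elim bexE)
      have "\<exists>A\<in>?P i. x \<in> A \<and> y \<in> A"
        using R(1) by (rule bexI[rotated]) (use R(2) A(2,3) in \<open>simp add: subsetD\<close>)
      then show ?thesis using same[OF xy, of i] by simp
    qed
    then show "W x = W y"
      by (simp add: W_def itinerary_def)
  qed
  have "iterated_join M T \<xi> n = (\<lambda>y. {x \<in> space M. W x = W y}) ` space M"
    by (rule partition_on_eq_classes[OF pJ rel])
  also have "\<dots> = (\<lambda>w. W -` {w} \<inter> space M) ` W ` space M"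
    unfolding image_image by (intro image_cong) auto
  finally show ?thesis .
qed

lemma partition_entropy_fibres:
  "partition_entropy M ((\<lambda>w. W -` {w} \<inter> space M) ` W ` space M) = rv_entropy M W"
proof -
  have "inj_on (\<lambda>w. W -` {w} \<inter> space M) (W ` space M)"
    by (rule inj_onI) blast
  then show ?thesis
    unfolding partition_entropy_def rv_entropy_def by (subst sum.reindex) auto
qed

locale measure_preserving_system = prob_space +
  fixes T :: "'a \<Rightarrow> 'a"
  assumes T_meas: "T \<in> measurable M M" and T_inv: "distr M M T = M"
begin

lemma iterate_measurable: "T ^^ i \<in> measurable M M"
  by (induction i) (use T_meas in \<open>auto intro: measurable_comp simp: comp_def\<close>)

lemma iterate_inv: "distr M M (T ^^ i) = M"
proof (induction i)
  case 0
  have "distr M M (\<lambda>x. x) = M" by (rule distr_id)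
  then show ?case by (simp add: id_def)
next
  case (Suc i)
  have "distr M M (T \<circ> (T ^^ i)) = distr (distr M M (T ^^ i)) M T"
    by (rule distr_distr[symmetric]) (auto intro: T_meas iterate_measurable)
  then show ?case using Suc T_inv by (simp add: comp_def)
qed

lemma simple_function_iterate:
  assumes "simple_function M X"
  shows "simple_function M (\<lambda>\<omega>. X ((T ^^ i) \<omega>))"
  by (rule simple_function_distr[OF iterate_measurable assms])

lemma rv_entropy_iterate:
  assumes "simple_function M X"
  shows "rv_entropy M (\<lambda>\<omega>. X ((T ^^ i) \<omega>)) = rv_entropy M X"
  using rv_entropy_distr[OF iterate_measurable assms, of i] by (simp add: iterate_inv)

lemma simple_function_itinerary:
  assumes "simple_function M X"
  shows "simple_function M (itinerary T X n)"
proof (induction n)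
  case (Suc n)
  have "simple_function M ((\<lambda>(w, x). w @ [x]) \<circ> (\<lambda>\<omega>. (itinerary T X n \<omega>, X ((T ^^ n) \<omega>))))"
    using simple_function_Pair[OF Suc simple_function_iterate[OF assms, of n]] by (rule simple_function_compose)
  then show ?case
    by (simp add: itinerary_def comp_def)
qed (simp add: itinerary_def)

lemma itinerary_add: "itinerary T X (m + n) y = itinerary T X m y @ itinerary T X n ((T ^^ m) y)"
  by (rule nth_equalityI)
    (auto simp: itinerary_def nth_append simp flip: comp_apply[of "T ^^ _" "T ^^ _" y] funpow_add)

lemma rv_entropy_itinerary_subadditive:
  assumes X: "simple_function M X"
  shows "rv_entropy M (itinerary T X (m + n)) \<le> rv_entropy M (itinerary T X m) + rv_entropy M (itinerary T X n)"
proof -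
  let ?U = "\<lambda>\<omega>. (itinerary T X m \<omega>, itinerary T X n ((T ^^ m) \<omega>))"
  note sm = simple_function_itinerary[OF X, of m]
  note sn = simple_function_iterate[OF simple_function_itinerary[OF X, of n], of m]
  have "rv_entropy M (itinerary T X (m + n)) = rv_entropy M (\<lambda>\<omega>. (\<lambda>(a, b). a @ b) (?U \<omega>))"
    by (simp add: itinerary_add[abs_def])
  also have "\<dots> \<le> rv_entropy M ?U"
    by (rule rv_entropy_comp_le[OF simple_function_Pair[OF sm sn]])
  also have "\<dots> \<le> rv_entropy M (itinerary T X m) + rv_entropy M (\<lambda>\<omega>. itinerary T X n ((T ^^ m) \<omega>))"
    by (rule rv_entropy_Pair_le[OF sm sn])
  finally show ?thesis
    by (simp add: rv_entropy_iterate[OF simple_function_itinerary[OF X]])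
qed

text \<open>
  Subadditivity guarantees that the limit in the definition of \<^const>\<open>entropy_wrt\<close> exists; without
  it \<^const>\<open>lim\<close> would have no known value.
\<close>

lemma entropy_wrt_LIMSEQ:
  assumes \<xi>: "finite_measurable_partition M \<xi>"
  shows "(\<lambda>n. rv_entropy M (itinerary T (atom_label \<xi> id) n) / real n) \<longlonglongrightarrow> entropy_wrt M T \<xi>"
proof -
  let ?h = "\<lambda>n. rv_entropy M (itinerary T (atom_label \<xi> id) n) / real n"
  have sf: "simple_function M (atom_label \<xi> id)"
    using \<xi> by (intro simple_function_atom_label) (auto simp: finite_measurable_partition_def)
  have "convergent ?h"
    by (rule subadditive_limit_exists[OF rv_entropy_nonneg rv_entropy_itinerary_subadditive[OF sf]])
  then have lim: "?h \<longlonglongrightarrow> lim ?h"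
    by (simp add: convergent_LIMSEQ_iff)
  have ev: "eventually (\<lambda>n. ?h n = partition_entropy M (iterated_join M T \<xi> n) / real n) sequentially"
    using eventually_gt_at_top[of 0]
    by eventually_elim (simp add: iterated_join_eq_fibres[OF T_meas \<xi>] partition_entropy_fibres)
  have "(\<lambda>n. partition_entropy M (iterated_join M T \<xi> n) / real n) \<longlonglongrightarrow> lim ?h"
    using lim by (rule Lim_transform_eventually[OF _ ev])
  then have "entropy_wrt M T \<xi> = lim ?h"
    unfolding entropy_wrt_def by (rule limI)
  with lim show ?thesis by simp
qed

text \<open>
  The upper half of the Kolmogorov--Sinai generator theorem.  Approximate the atoms of \<open>\<xi>\<close> by events
  that depend on the first \<open>K\<close> letters of \<open>Y\<close>.  Then \<open>n + K\<close> letters of \<open>Y\<close> predict each of the first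
  \<open>n\<close> labels up to a small conditional entropy, by Fano's inequality and invariance.
\<close>

theorem entropy_wrt_le_generator:
  assumes Y: "simple_function M Y"
    and gen: "\<And>A \<epsilon>. A \<in> events \<Longrightarrow> 0 < \<epsilon> \<Longrightarrow>
      \<exists>L S. prob (sym_diff A (itinerary T Y L -` S \<inter> space M)) < \<epsilon>"
    and growth: "\<And>\<delta>. 0 < \<delta> \<Longrightarrow> \<exists>C. \<forall>n. rv_entropy M (itinerary T Y n) \<le> C + real n * (c + \<delta>)"
    and \<xi>: "finite_measurable_partition M \<xi>"
  shows "entropy_wrt M T \<xi> \<le> c"
proof (rule field_le_epsilon)
  fix e :: real assume "0 < e"
  define \<delta> where "\<delta> = e / 2"
  have "0 < \<delta>" using \<open>0 < e\<close> by (simp add: \<delta>_def)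
  have fin: "finite \<xi>" and \<xi>s: "\<And>A. A \<in> \<xi> \<Longrightarrow> A \<in> events"
    using \<xi> by (auto simp: finite_measurable_partition_def)
  let ?g = "atom_label \<xi> id"
  have sg: "simple_function M ?g"
    using \<xi>s fin by (intro simple_function_atom_label) auto
  obtain \<epsilon> where \<epsilon>: "0 < \<epsilon>"
    "\<And>X Y. simple_function M X \<Longrightarrow> simple_function M Y \<Longrightarrow> X ` space M \<subseteq> Pow \<xi> \<Longrightarrow> Y ` space M \<subseteq> Pow \<xi> \<Longrightarrow>
       prob {\<omega> \<in> space M. X \<omega> \<noteq> Y \<omega>} < \<epsilon> \<Longrightarrow>
       rv_entropy M (\<lambda>\<omega>. (X \<omega>, Y \<omega>)) - rv_entropy M Y \<le> \<delta>"
    using fano_continuity[OF _ \<open>0 < \<delta>\<close>, of "Pow \<xi>"] fin by (simp only: finite_Pow_iff) blast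
  (* Each atom gets an equal share of the admissible error. *)
  define \<epsilon>' where "\<epsilon>' = \<epsilon> / (real (card \<xi>) + 1)"
  have "0 < \<epsilon>'" unfolding \<epsilon>'_def using \<epsilon>(1) by (intro divide_pos_pos) auto
  have "\<forall>A\<in>\<xi>. \<exists>L S. prob (sym_diff A (itinerary T Y L -` S \<inter> space M)) < \<epsilon>'"
    using gen \<xi>s \<open>0 < \<epsilon>'\<close> by blast
  then obtain L S where LS: "\<And>A. A \<in> \<xi> \<Longrightarrow> prob (sym_diff A (itinerary T Y (L A) -` S A \<inter> space M)) < \<epsilon>'"
    by metis
  define B where "B A = itinerary T Y (L A) -` S A \<inter> space M" for A
  have Bs: "B A \<in> events" for A
    unfolding B_def by (rule simple_functionD(2)[OF simple_function_itinerary[OF Y]])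
  let ?g' = "atom_label \<xi> B"
  have sg': "simple_function M ?g'"
    using Bs fin by (intro simple_function_atom_label) auto
  have "prob {\<omega> \<in> space M. ?g \<omega> \<noteq> ?g' \<omega>} \<le> prob (\<Union>A\<in>\<xi>. sym_diff A (B A))"
    using fin \<xi>s Bs by (intro finite_measure_mono) (auto simp: atom_label_def)
  also have "\<dots> \<le> (\<Sum>A\<in>\<xi>. prob (sym_diff A (B A)))"
    using fin \<xi>s Bs by (intro finite_measure_subadditive_finite) auto
  also have "\<dots> \<le> (\<Sum>A\<in>\<xi>. \<epsilon>')"
    using LS by (intro sum_mono less_imp_le) (auto simp: B_def)
  also have "\<dots> = real (card \<xi>) * \<epsilon>'" by simp
  also have "\<dots> < (real (card \<xi>) + 1) * \<epsilon>'" using \<open>0 < \<epsilon>'\<close> by (simp add: algebra_simps)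
  also have "\<dots> = \<epsilon>" unfolding \<epsilon>'_def by simp
  finally have close: "rv_entropy M (\<lambda>\<omega>. (?g \<omega>, ?g' \<omega>)) - rv_entropy M ?g' \<le> \<delta>"
    by (intro \<epsilon>(2) sg sg') (auto simp: atom_label_def)
  define K where "K = Max (insert 0 (L ` \<xi>))"
  have LK: "L A \<le> K" if "A \<in> \<xi>" for A
    unfolding K_def using fin that by (intro Max_ge) auto
  (* The label of the i-th iterate, read off from the word of length n + K. *)
  define f where "f i w = {A \<in> \<xi>. take (L A) (drop i w) \<in> S A}" for i and w :: "'b list"
  have f: "f i (itinerary T Y (n + K) \<omega>) = ?g' ((T ^^ i) \<omega>)" if "\<omega> \<in> space M" "i < n" for i n \<omega>
  proof -
    have "take (L A) (drop i (itinerary T Y (n + K) \<omega>)) = itinerary T Y (L A) ((T ^^ i) \<omega>)"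
      if A: "A \<in> \<xi>" for A
    proof -
      have "n + K = i + (L A + (n + K - i - L A))"
        using \<open>i < n\<close> LK[OF A] by simp
      then have "itinerary T Y (n + K) \<omega> = itinerary T Y (i + (L A + (n + K - i - L A))) \<omega>"
        by simp
      also have "\<dots> = itinerary T Y i \<omega> @ itinerary T Y (L A) ((T ^^ i) \<omega>)
          @ itinerary T Y (n + K - i - L A) ((T ^^ L A) ((T ^^ i) \<omega>))"
        by (simp only: itinerary_add)
      finally show ?thesis
        by (simp add: itinerary_def)
    qed
    moreover have "(T ^^ i) \<omega> \<in> space M"
      using iterate_measurable that(1) by (rule measurable_space)
    ultimately show ?thesis
      by (auto simp: f_def atom_label_def B_def)
  qed
  obtain C where C: "\<And>n. rv_entropy M (itinerary T Y n) \<le> C + real n * (c + \<delta>)"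
    using growth[OF \<open>0 < \<delta>\<close>] by blast
  have upper: "rv_entropy M (itinerary T ?g n) \<le> C + real (n + K) * (c + \<delta>) + real n * \<delta>" for n
  proof -
    let ?C = "itinerary T Y (n + K)"
    note sC = simple_function_itinerary[OF Y, of "n + K"]
    have step: "rv_entropy M (\<lambda>\<omega>. (?g ((T ^^ i) \<omega>), f i (?C \<omega>))) - rv_entropy M (\<lambda>\<omega>. f i (?C \<omega>)) \<le> \<delta>"
      if "i < n" for i
    proof -
      have "rv_entropy M (\<lambda>\<omega>. (?g ((T ^^ i) \<omega>), f i (?C \<omega>))) = rv_entropy M (\<lambda>\<omega>. (\<lambda>\<omega>. (?g \<omega>, ?g' \<omega>)) ((T ^^ i) \<omega>))"
        by (rule rv_entropy_cong) (simp add: f that)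
      also have "\<dots> = rv_entropy M (\<lambda>\<omega>. (?g \<omega>, ?g' \<omega>))"
        by (rule rv_entropy_iterate[OF simple_function_Pair[OF sg sg']])
      finally have 1: "rv_entropy M (\<lambda>\<omega>. (?g ((T ^^ i) \<omega>), f i (?C \<omega>))) = rv_entropy M (\<lambda>\<omega>. (?g \<omega>, ?g' \<omega>))" .
      have "rv_entropy M (\<lambda>\<omega>. f i (?C \<omega>)) = rv_entropy M (\<lambda>\<omega>. ?g' ((T ^^ i) \<omega>))"
        by (rule rv_entropy_cong) (simp add: f that)
      also have "\<dots> = rv_entropy M ?g'"
        by (rule rv_entropy_iterate[OF sg'])
      finally show ?thesis using 1 close by simp
    qed
    have "rv_entropy M (\<lambda>\<omega>. (itinerary T ?g n \<omega>, ?C \<omega>)) \<le> rv_entropy M ?C + real n * \<delta>"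
      and "simple_function M (itinerary T ?g n)"
      using conditional_entropy_list_le[of n "\<lambda>i \<omega>. ?g ((T ^^ i) \<omega>)" ?C f \<delta>,
          OF simple_function_iterate[OF sg] sC step]
      by (simp_all add: itinerary_def[abs_def])
    moreover have "rv_entropy M (itinerary T ?g n) \<le> rv_entropy M (\<lambda>\<omega>. (itinerary T ?g n \<omega>, ?C \<omega>))"
      using rv_entropy_comp_le[OF simple_function_Pair[OF simple_function_itinerary[OF sg] sC], of fst] by simp
    ultimately show ?thesis using C[of "n + K"] by linarith
  qed
  have "(\<lambda>n. (C + real (n + K) * (c + \<delta>) + real n * \<delta>) / real n) \<longlonglongrightarrow> c + \<delta> + \<delta>"
    by real_asymp
  then have "entropy_wrt M T \<xi> \<le> c + \<delta> + \<delta>"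
    using upper by (intro LIMSEQ_le[OF entropy_wrt_LIMSEQ[OF \<xi>]]) (auto intro!: exI[of _ 1] divide_right_mono)
  then show "entropy_wrt M T \<xi> \<le> c + e"
    by (simp add: \<delta>_def)
qed

end

definition fibre_partition :: "'a measure \<Rightarrow> ('a \<Rightarrow> 'b) \<Rightarrow> 'a set set" where
  "fibre_partition M X = (\<lambda>v. X -` {v} \<inter> space M) ` X ` space M"

lemma finite_measurable_partition_fibres:
  assumes "simple_function M X"
  shows "finite_measurable_partition M (fibre_partition M X)"
  using assms unfolding finite_measurable_partition_def fibre_partition_def
  by (auto simp: simple_function_def partition_on_def disjoint_def)

text \<open>
  The value of \<open>X\<close> can be recovered from the atom of its fibre partition that contains the point.
\<close>

lemma (in measure_preserving_system) rv_entropy_itinerary_le_fibre_labels: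
  assumes X: "simple_function M X"
  shows "rv_entropy M (itinerary T X n) \<le> rv_entropy M (itinerary T (atom_label (fibre_partition M X) id) n)"
proof -
  let ?\<xi> = "fibre_partition M X"
  (* Any point of the atom determines the value of X. *)
  define h where "h S = X (SOME y. y \<in> \<Union>S)" for S
  have h: "h (atom_label ?\<xi> id y) = X y" if y: "y \<in> space M" for y
  proof -
    have "\<Union>(atom_label ?\<xi> id y) = X -` {X y} \<inter> space M"
      using y by (auto simp: atom_label_def fibre_partition_def)
    then have "(SOME y'. y' \<in> \<Union>(atom_label ?\<xi> id y)) \<in> X -` {X y} \<inter> space M"
      using y by (metis IntI someI vimage_singleton_eq)
    then show ?thesis by (simp add: h_def)
  qed
  have sf: "simple_function M (atom_label ?\<xi> id)"
    using finite_measurable_partition_fibres[OF X]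
    by (intro simple_function_atom_label) (auto simp: finite_measurable_partition_def)
  have "rv_entropy M (itinerary T X n) = rv_entropy M (\<lambda>y. map h (itinerary T (atom_label ?\<xi> id) n y))"
  proof (rule rv_entropy_cong)
    fix y assume y: "y \<in> space M"
    have "(T ^^ i) y \<in> space M" for i
      using iterate_measurable y by (rule measurable_space)
    then show "itinerary T X n y = map h (itinerary T (atom_label ?\<xi> id) n y)"
      by (simp add: itinerary_def h)
  qed
  also have "\<dots> \<le> rv_entropy M (itinerary T (atom_label ?\<xi> id) n)"
    by (rule rv_entropy_comp_le[OF simple_function_itinerary[OF sf]])
  finally show ?thesis .
qed

section \<open>Cylinder sets\<close>

text \<open>
  The Borel sets of a countable product are generated by the coordinates if the factors are second
  countable.
\<close>

instance int :: second_countable_topology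
proof
  have "open = generate_topology (range (\<lambda>k::int. {k}))"
  proof (rule ext, rule iffI)
    fix A :: "int set"
    have "generate_topology (range (\<lambda>k::int. {k})) (\<Union>((\<lambda>k. {k}) ` A))"
      by (rule generate_topology.UN) (auto intro: generate_topology.Basis)
    then show "generate_topology (range (\<lambda>k::int. {k})) A" by simp
  qed (rule Topological_Spaces.open_discrete)
  then show "\<exists>B :: int set set. countable B \<and> open = generate_topology B"
    by (intro exI[of _ "range (\<lambda>k. {k})"]) auto
qed

definition cylinder :: "(nat \<Rightarrow> int) set \<Rightarrow> int list \<Rightarrow> (nat \<Rightarrow> int) set" where
  "cylinder X w = {x \<in> X. map x [0..<length w] = w}"

lemma map_upt_eq_iff: "map x [0..<length w] = w \<longleftrightarrow> (\<forall>i<length w. x i = w ! i)"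
  unfolding list_eq_iff_nth_eq[of "map x [0..<length w]"] by simp

lemma cylinder_Int:
  assumes "length v \<le> length w"
  shows "cylinder X v \<inter> cylinder X w = (if take (length v) w = v then cylinder X w else {})"
proof -
  have *: "map x [0..<length v] = v \<longleftrightarrow> take (length v) w = v" if "map x [0..<length w] = w" for x :: "nat \<Rightarrow> int"
  proof -
    have "take (length v) w = take (length v) (map x [0..<length w])"
      using that by simp
    also have "\<dots> = map x [0..<length v]"
      using assms by (simp add: take_map take_upt)
    finally show ?thesis by simp
  qed
  show ?thesis
    using * by (auto simp: cylinder_def)
qed

lemma Int_stable_cylinders: "Int_stable (insert {} (range (cylinder X)))"
proof (rule Int_stableI)
  have "cylinder X v \<inter> cylinder X w \<in> insert {} (range (cylinder X))" for v w
  proof (cases "length v \<le> length w")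
    case True
    then show ?thesis by (simp add: cylinder_Int)
  next
    case False
    then show ?thesis
      by (subst Int_commute) (simp add: cylinder_Int)
  qed
  then show "a \<inter> b \<in> insert {} (range (cylinder X))"
    if "a \<in> insert {} (range (cylinder X))" "b \<in> insert {} (range (cylinder X))" for a b
    using that by auto
qed

lemma measurable_coordinate: "(\<lambda>x :: nat \<Rightarrow> int. x i) \<in> borel_measurable borel"
  by (rule measurable_product_then_coordinatewise) simp

lemma measurable_prefix:
  "(\<lambda>x :: nat \<Rightarrow> int. map x [0..<n]) \<in> measurable borel (count_space UNIV)"
proof -
  have "{x :: nat \<Rightarrow> int. map x [0..<n] = w} \<in> sets borel" for w
  proof (cases "length w = n")
    case True
    have "{x \<in> space borel. \<forall>i\<in>{..<n}. x i = w ! i} \<in> sets (borel :: (nat \<Rightarrow> int) measure)"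
    proof (rule sets.sets_Collect_finite_All)
      fix i
      have "(\<lambda>x :: nat \<Rightarrow> int. x i) -` {w ! i} \<inter> space borel \<in> sets borel"
        by (rule measurable_sets[OF measurable_coordinate]) simp
      then show "{x \<in> space borel. x i = w ! i} \<in> sets (borel :: (nat \<Rightarrow> int) measure)"
        by (simp add: vimage_def)
    qed simp
    moreover have "{x :: nat \<Rightarrow> int. map x [0..<n] = w} = {x \<in> space borel. \<forall>i\<in>{..<n}. x i = w ! i}"
      using map_upt_eq_iff[of _ w] True by auto
    ultimately show ?thesis by simp
  next
    case False
    then have "{x :: nat \<Rightarrow> int. map x [0..<n] = w} = {}" by auto
    then show ?thesis by (metis sets.empty_sets)
  qed
  then show ?thesis
    by (simp add: measurable_count_space_eq2_countable vimage_def)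
qed

lemma prefix_event:
  "(\<lambda>x. map x [0..<n]) -` S \<inter> X \<in> sets (restrict_space borel X)"
  for X :: "(nat \<Rightarrow> int) set"
proof -
  have "(\<lambda>x :: nat \<Rightarrow> int. map x [0..<n]) \<in> measurable (restrict_space borel X) (count_space UNIV)"
    by (intro measurable_restrict_space1 measurable_prefix)
  from measurable_sets[OF this, of S] show ?thesis
    by (simp add: space_restrict_space)
qed

lemma cylinder_event: "cylinder X w \<in> sets (restrict_space borel X)"
proof -
  have "cylinder X w = (\<lambda>x. map x [0..<length w]) -` {w} \<inter> X"
    by (auto simp: cylinder_def)
  then show ?thesis by (simp only: prefix_event)
qed

lemma coordinate_eq_Union_cylinders:
  "{x \<in> X. x i = k} = (\<Union>w \<in> {w. length w = Suc i \<and> w ! i = k}. cylinder X w)"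
proof (intro set_eqI iffI)
  fix x assume x: "x \<in> {x \<in> X. x i = k}"
  have "(map x [0..<Suc i]) ! i = k" using x by (simp del: upt_Suc)
  moreover have "x \<in> cylinder X (map x [0..<Suc i])" using x by (simp add: cylinder_def del: upt_Suc)
  ultimately show "x \<in> (\<Union>w \<in> {w. length w = Suc i \<and> w ! i = k}. cylinder X w)"
    by (intro UN_I[of "map x [0..<Suc i]"]) (auto simp del: upt_Suc)
next
  fix x assume "x \<in> (\<Union>w \<in> {w. length w = Suc i \<and> w ! i = k}. cylinder X w)"
  then obtain w where w: "length w = Suc i" "w ! i = k" and x: "x \<in> cylinder X w" by blast
  have "x \<in> X" "\<forall>j<length w. x j = w ! j"
    using x unfolding cylinder_def map_upt_eq_iff by simp_all
  then show "x \<in> {x \<in> X. x i = k}" using w by simp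
qed

text \<open>
  The alphabet is countable, so the Borel sets of the product topology are generated by the countable
  family of cylinders.  A measure is therefore determined by its values on cylinders, and every event
  can be approximated by finite unions of them.
\<close>

lemma sets_borel_eq_cylinders:
  "sets (restrict_space borel X) = sigma_sets X (insert {} (range (cylinder X)))"
proof
  have sub: "insert {} (range (cylinder X)) \<subseteq> Pow X"
    by (auto simp: cylinder_def)
  let ?N = "sigma X (insert {} (range (cylinder X)))"
  have N: "sets ?N = sigma_sets X (insert {} (range (cylinder X)))" "space ?N = X"
    using sub by auto
  show "sigma_sets X (insert {} (range (cylinder X))) \<subseteq> sets (restrict_space borel X)"
    using sets.sigma_sets_subset[of "insert {} (range (cylinder X))" "restrict_space borel X"] cylinder_event[of X]
    by (auto simp: space_restrict_space)
  have "(\<lambda>x. x i) \<in> measurable ?N (borel :: int measure)" for i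
  proof -
    have "(\<lambda>x. x i) -` {k} \<inter> X \<in> sets ?N" for k
    proof -
      have "(\<Union>w \<in> {w. length w = Suc i \<and> w ! i = k}. cylinder X w) \<in> sets ?N"
        by (intro sets.countable_UN') (auto simp: N countable_subset[OF subset_UNIV])
      then show ?thesis
        using coordinate_eq_Union_cylinders[of X i k] by (simp add: vimage_def Int_def conj_commute)
    qed
    then have "(\<lambda>x. x i) \<in> measurable ?N (count_space UNIV)"
      by (simp add: measurable_count_space_eq2_countable N)
    then show ?thesis
      by (simp add: measurable_cong_sets[OF refl sets_borel_eq_count_space])
  qed
  then have id: "(\<lambda>x. x) \<in> measurable ?N (borel :: (nat \<Rightarrow> int) measure)"
    by (intro measurable_coordinatewise_then_product)
  show "sets (restrict_space borel X) \<subseteq> sigma_sets X (insert {} (range (cylinder X)))"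
  proof
    fix A assume "A \<in> sets (restrict_space borel X)"
    then obtain B where "B \<in> sets borel" "A = B \<inter> X"
      by (auto simp: sets_restrict_space)
    then show "A \<in> sigma_sets X (insert {} (range (cylinder X)))"
      using measurable_sets[OF id, of B] by (simp add: N Int_commute)
  qed
qed

lemma prob_measure_eqI_cylinders:
  assumes "prob_space M" "prob_space N"
    and M: "sets M = sets (restrict_space borel X)" and N: "sets N = sets (restrict_space borel X)"
    and eq: "\<And>w. measure M (cylinder X w) = measure N (cylinder X w)"
  shows "M = N"
proof -
  interpret M: prob_space M by fact
  interpret N: prob_space N by fact
  show ?thesis
  proof (rule measure_eqI_generator_eq[OF Int_stable_cylinders[of X], of X _ _ "\<lambda>_. X"])
    have [simp]: "cylinder X [] = X" by (simp add: cylinder_def)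
    show "range (\<lambda>_ :: nat. X) \<subseteq> insert {} (range (cylinder X))"
      by (auto intro!: range_eqI[of _ _ "[]"])
    show "insert {} (range (cylinder X)) \<subseteq> Pow X" by (auto simp: cylinder_def)
    show "emeasure M A = emeasure N A" if "A \<in> insert {} (range (cylinder X))" for A
      using that eq by (auto simp: M.emeasure_eq_measure N.emeasure_eq_measure)
  qed (use M N sets_borel_eq_cylinders in auto)
qed

text \<open>
  The approximable events form a \<open>\<sigma>\<close>-algebra: for a countable union take a finite partial union with
  almost the full measure and approximate its finitely many members.
\<close>

lemma approximate_by_cylinders:
  fixes X :: "(nat \<Rightarrow> int) set"
  assumes fin: "finite_measure M" and M: "sets M = sets (restrict_space borel X)"
    and A: "A \<in> sets M" and \<epsilon>: "0 < \<epsilon>"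
  shows "\<exists>L S. measure M (sym_diff A ((\<lambda>x. map x [0..<L]) -` S \<inter> X)) < \<epsilon>"
proof -
  interpret finite_measure M by fact
  let ?B = "\<lambda>L S. (\<lambda>x :: nat \<Rightarrow> int. map x [0..<L]) -` S \<inter> X"
  have B: "?B L S \<in> sets M" for L S
    unfolding M by (rule prefix_event)
  have Asig: "A \<in> sigma_sets X (insert {} (range (cylinder X)))"
    using A by (simp add: M sets_borel_eq_cylinders)
  have sets: "a \<in> sets M" if "a \<in> sigma_sets X (insert {} (range (cylinder X)))" for a
    using that by (simp add: M sets_borel_eq_cylinders)
  have "\<forall>\<epsilon>>0. \<exists>L S. measure M (sym_diff A (?B L S)) < \<epsilon>"
    using Asig
  proof induction
    case (Basic a)
    show ?case
    proof (cases "a = {}")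
      case True
      then show ?thesis by (auto intro!: exI[of _ "{}"])
    next
      case False
      then obtain w where "a = ?B (length w) {w}"
        using Basic by (auto simp: cylinder_def)
      then have "sym_diff a (?B (length w) {w}) = {}" by simp
      then show ?thesis by (metis measure_empty)
    qed
  next
    case Empty
    then show ?case by (auto intro!: exI[of _ "{}"])
  next
    case (Compl a)
    have "a \<subseteq> X"
      using Compl.hyps sigma_sets_into_sp[of "insert {} (range (cylinder X))" X] by (auto simp: cylinder_def)
    then have "sym_diff (X - a) (?B L (- S)) = sym_diff a (?B L S)" for L S
      by auto
    then show ?case using Compl.IH by metis
  next
    case (Union a)
    show ?case
    proof (intro allI impI)
      fix \<epsilon> :: real assume "0 < \<epsilon>"
      have as: "a i \<in> sets M" for i using sets[OF Union.hyps] .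
      define b where "b n = (\<Union>i<n. a i)" for n
      have bs: "b n \<in> sets M" for n unfolding b_def using as by auto
      have "incseq b" unfolding b_def by (rule monoI) (auto intro: less_le_trans)
      then have "(\<lambda>n. measure M (b n)) \<longlonglongrightarrow> measure M (\<Union>n. b n)"
        using bs by (intro finite_Lim_measure_incseq) auto
      moreover have "(\<Union>n. b n) = (\<Union>i. a i)" unfolding b_def by auto
      ultimately have "(\<lambda>n. measure M (b n)) \<longlonglongrightarrow> measure M (\<Union>i. a i)" by simp
      then have "eventually (\<lambda>n. measure M (b n) > measure M (\<Union>i. a i) - \<epsilon> / 2) sequentially"
        using \<open>0 < \<epsilon>\<close> by (intro order_tendstoD) auto
      then obtain n where n: "measure M (b n) > measure M (\<Union>i. a i) - \<epsilon> / 2"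
        by (auto simp: eventually_sequentially)
      define \<delta> where "\<delta> = \<epsilon> / 2 / (real n + 1)"
      have "0 < \<delta>" unfolding \<delta>_def using \<open>0 < \<epsilon>\<close> by simp
      have "\<forall>i. \<exists>L S. measure M (sym_diff (a i) (?B L S)) < \<delta>"
        using Union.IH \<open>0 < \<delta>\<close> by blast
      then obtain L S where LS: "\<And>i. measure M (sym_diff (a i) (?B (L i) (S i))) < \<delta>"
        by metis
      define K where "K = Max (insert 0 (L ` {..<n}))"
      have LK: "L i \<le> K" if "i < n" for i
        unfolding K_def using that by (intro Max_ge) auto
      define R where "R = {w. \<exists>i<n. take (L i) w \<in> S i}"
      have R: "?B K R = (\<Union>i<n. ?B (L i) (S i))"
        using LK by (auto simp: R_def take_map take_upt)
      have "sym_diff (\<Union>i. a i) (?B K R) \<subseteq> ((\<Union>i. a i) - b n) \<union> (\<Union>i<n. sym_diff (a i) (?B (L i) (S i)))"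
        unfolding R b_def by blast
      then have "measure M (sym_diff (\<Union>i. a i) (?B K R))
          \<le> measure M (((\<Union>i. a i) - b n) \<union> (\<Union>i<n. sym_diff (a i) (?B (L i) (S i))))"
        using as bs B by (intro finite_measure_mono) auto
      also have "\<dots> \<le> measure M ((\<Union>i. a i) - b n) + measure M (\<Union>i<n. sym_diff (a i) (?B (L i) (S i)))"
        using as bs B by (intro measure_Un_le) auto
      also have "measure M ((\<Union>i. a i) - b n) = measure M (\<Union>i. a i) - measure M (b n)"
        using as bs by (intro finite_measure_Diff) (auto simp: b_def)
      also have "\<dots> < \<epsilon> / 2" using n by simp
      also have "measure M (\<Union>i<n. sym_diff (a i) (?B (L i) (S i))) \<le> (\<Sum>i<n. measure M (sym_diff (a i) (?B (L i) (S i))))"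
        using as B by (intro finite_measure_subadditive_finite) auto
      also have "\<dots> \<le> (\<Sum>i<n. \<delta>)" using LS by (intro sum_mono less_imp_le) auto
      also have "\<dots> \<le> (real n + 1) * \<delta>" using \<open>0 < \<delta>\<close> by simp
      also have "\<dots> = \<epsilon> / 2" unfolding \<delta>_def by (simp add: field_simps)
      finally show "\<exists>L S. measure M (sym_diff (\<Union>i. a i) (?B L S)) < \<epsilon>"
        by (intro exI[of _ K] exI[of _ R]) simp
    qed
  qed
  then show ?thesis using \<epsilon> by blast
qed

section \<open>The square sieve on random residues\<close>

text \<open>
  Comparison with the telescoping sum of \<open>1 / (d - 1) - 1 / d\<close>.  This single estimate bounds the
  effect of all primes larger than \<open>K\<close>, both in probability and in frequency.
\<close>

lemma sum_inverse_squares_le: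
  assumes "finite D" "D \<subseteq> {K<..}" "0 < K"
  shows "(\<Sum>d\<in>D. 1 / real d ^ 2) \<le> 1 / real K"
proof -
  have Icc: "(\<Sum>d\<in>{K<..K + n}. 1 / real d ^ 2) \<le> 1 / real K - 1 / real (K + n)" for n
  proof (induction n)
    case (Suc n)
    have "{K<..K + Suc n} = insert (K + Suc n) {K<..K + n}" by auto
    then have "(\<Sum>d\<in>{K<..K + Suc n}. 1 / real d ^ 2) \<le> 1 / real (K + Suc n) ^ 2 + (1 / real K - 1 / real (K + n))"
      using Suc by simp
    also have "\<dots> \<le> 1 / real K - 1 / real (K + Suc n)"
    proof -
      have pos: "0 < real (K + n)" using \<open>0 < K\<close> by simp
      have "1 / real (K + n) - 1 / real (K + Suc n) = 1 / (real (K + n) * real (K + Suc n))"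
        using pos by (simp add: field_simps)
      moreover have "1 / real (K + Suc n) ^ 2 \<le> 1 / (real (K + n) * real (K + Suc n))"
        unfolding power2_eq_square using pos by (intro divide_left_mono mult_right_mono mult_pos_pos) auto
      ultimately show ?thesis by linarith
    qed
    finally show ?case .
  qed simp
  obtain n where n: "D \<subseteq> {..n}" using assms(1) finite_nat_iff_bounded_le by auto
  have "(\<Sum>d\<in>D. 1 / real d ^ 2) \<le> (\<Sum>d\<in>{K<..K + n}. 1 / real d ^ 2)"
  proof (rule sum_mono2)
    show "D \<subseteq> {K<..K + n}"
      using assms(2) n by (auto simp: subset_iff intro: trans_le_add2)
  qed auto
  also have "\<dots> \<le> 1 / real K - 1 / real (K + n)" by (rule Icc)
  also have "\<dots> \<le> 1 / real K" by simp
  finally show ?thesis .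
qed

lemma summable_on_inverse_squares: "(\<lambda>n::nat. 1 / real n ^ 2) summable_on A"
proof -
  have "(\<lambda>n::nat. 1 / real n ^ 2) summable_on UNIV"
    using inverse_power_summable[of 2, where 'a=real]
    by (intro norm_summable_imp_summable_on) (simp add: field_simps)
  then show ?thesis by (rule summable_on_subset_banach) simp
qed

lemma infsum_inverse_squares: "infsum (\<lambda>n::nat. 1 / real n ^ 2) {1..} = pi\<^sup>2 / 6"
proof -
  have sums: "(\<lambda>n. 1 / real (n + 1) ^ 2) sums (pi\<^sup>2 / 6)"
    using inverse_squares_sums by (simp add: add.commute)
  then have "((\<lambda>n. 1 / real (n + 1) ^ 2) has_sum (pi\<^sup>2 / 6)) UNIV"
    by (intro norm_summable_imp_has_sum) (auto dest: sums_summable)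
  then have "((\<lambda>n. 1 / real n ^ 2) \<circ> Suc has_sum (pi\<^sup>2 / 6)) UNIV"
    by (simp add: comp_def)
  then have "((\<lambda>n. 1 / real n ^ 2) has_sum (pi\<^sup>2 / 6)) (Suc ` UNIV)"
    by (subst has_sum_reindex) auto
  moreover have "Suc ` UNIV = {1..}" by (auto simp: image_iff Suc_le_eq gr0_conv_Suc)
  ultimately show ?thesis by (simp add: infsumI)
qed

text \<open>
  Removing the multiples of a prime \<open>p\<close> from a set that is closed under multiplication and division by
  \<open>p\<close> removes the fraction \<open>1 / p\<^sup>2\<close> of the sum, since these multiples are the dilate of the set by \<open>p\<close>.
\<close>

lemma infsum_inverse_squares_sieved:
  assumes "finite P" "\<And>p. p \<in> P \<Longrightarrow> prime (p :: nat)"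
  shows "infsum (\<lambda>n. 1 / real n ^ 2) {n. 1 \<le> n \<and> (\<forall>p\<in>P. \<not> p dvd n)} = pi\<^sup>2 / 6 * (\<Prod>p\<in>P. 1 - 1 / real p ^ 2)"
  using assms
proof (induction P rule: finite_induct)
  case empty
  have "{n::nat. 1 \<le> n \<and> (\<forall>p\<in>{}. \<not> p dvd n)} = {1..}" by auto
  then show ?case by (simp only: infsum_inverse_squares) simp
next
  case (insert p P)
  let ?A = "\<lambda>P. {n::nat. 1 \<le> n \<and> (\<forall>p\<in>P. \<not> p dvd n)}"
  let ?f = "\<lambda>n::nat. 1 / real n ^ 2"
  have p: "prime p" "0 < p" using insert.prems prime_gt_0_nat by auto
  have dvd: "q dvd p * n \<longleftrightarrow> q dvd n" if "q \<in> P" for q n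
  proof -
    have "prime q" "q \<noteq> p" using that insert by auto
    then show ?thesis using p primes_dvd_imp_eq prime_dvd_mult_iff by blast
  qed
  have split: "?A P = ?A (insert p P) \<union> (*) p ` ?A P"
  proof (intro set_eqI iffI)
    fix n assume n: "n \<in> ?A P"
    show "n \<in> ?A (insert p P) \<union> (*) p ` ?A P"
    proof (cases "p dvd n")
      case True
      then obtain k where k: "n = p * k" by blast
      have "1 \<le> k" using n k by (cases k) auto
      then have "k \<in> ?A P" using n k dvd by auto
      then show ?thesis using k by blast
    qed (use n in auto)
  next
    fix n assume "n \<in> ?A (insert p P) \<union> (*) p ` ?A P"
    then show "n \<in> ?A P" using p dvd by auto
  qed
  have "infsum ?f (?A P) = infsum ?f (?A (insert p P)) + infsum ?f ((*) p ` ?A P)"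
    by (subst split, rule infsum_Un_disjoint) (auto intro: summable_on_inverse_squares)
  also have "infsum ?f ((*) p ` ?A P) = infsum (?f \<circ> (*) p) (?A P)"
    using p by (intro infsum_reindex) (auto simp: inj_on_def)
  also have "?f \<circ> (*) p = (\<lambda>n. 1 / real p ^ 2 * ?f n)"
    by (auto simp: power_mult_distrib)
  also have "infsum (\<lambda>n. 1 / real p ^ 2 * ?f n) (?A P) = 1 / real p ^ 2 * infsum ?f (?A P)"
    by (intro infsum_cmult_right summable_on_inverse_squares)
  finally have "infsum ?f (?A (insert p P)) = (1 - 1 / real p ^ 2) * infsum ?f (?A P)"
    by (simp add: algebra_simps)
  then show ?case
    using insert by simp
qed

definition primes_upto :: "nat \<Rightarrow> nat set" where
  "primes_upto K = {p. prime p \<and> p \<le> K}"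

lemma finite_primes_upto: "finite (primes_upto K)"
  by (simp add: primes_upto_def)

text \<open>
  After sieving by all primes up to \<open>K\<close> the sum of the inverse squares consists of the term for \<open>1\<close>
  and a part of the tail beyond \<open>K\<close>, so it tends to \<open>1\<close>.  Thus the Euler product tends to \<open>1 / \<zeta>(2)\<close>.
\<close>

lemma LIMSEQ_euler_product: "(\<lambda>K. \<Prod>p\<in>primes_upto K. 1 - 1 / real p ^ 2) \<longlonglongrightarrow> 6 / pi\<^sup>2"
proof -
  let ?A = "\<lambda>K. {n::nat. 1 \<le> n \<and> (\<forall>p\<in>primes_upto K. \<not> p dvd n)}"
  let ?f = "\<lambda>n::nat. 1 / real n ^ 2"
  let ?p = "\<lambda>K. \<Prod>p\<in>primes_upto K. 1 - 1 / real p ^ 2"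
  have eq: "infsum ?f (?A K) = pi\<^sup>2 / 6 * ?p K" for K
    by (rule infsum_inverse_squares_sieved[OF finite_primes_upto]) (auto simp: primes_upto_def)
  have lower: "1 \<le> infsum ?f (?A K)" for K
  proof -
    have "infsum ?f {1} \<le> infsum ?f (?A K)"
      by (intro infsum_mono2 summable_on_inverse_squares) (auto simp: primes_upto_def)
    then show ?thesis by simp
  qed
  have upper: "infsum ?f (?A K) \<le> 1 + 1 / real K" if "0 < K" for K
  proof -
    have "?A K \<subseteq> insert 1 {K<..}"
    proof
      fix n assume n: "n \<in> ?A K"
      show "n \<in> insert 1 {K<..}"
      proof (rule ccontr)
        assume *: "n \<notin> insert 1 {K<..}"
        then obtain p where "prime p" "p dvd n" using prime_factor_nat[of n] by auto
        moreover from this have "p \<le> n" using n by (intro dvd_imp_le) auto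
        ultimately show False using n * by (auto simp: primes_upto_def)
      qed
    qed
    then have "infsum ?f (?A K) \<le> infsum ?f (insert 1 {K<..})"
      by (intro infsum_mono2 summable_on_inverse_squares) auto
    also have "\<dots> = 1 + infsum ?f {K<..}"
      using that by (subst infsum_insert) (auto intro: summable_on_inverse_squares)
    also have "infsum ?f {K<..} \<le> 1 / real K"
      using that by (intro infsum_le_finite_sums summable_on_inverse_squares sum_inverse_squares_le)
    finally show ?thesis by simp
  qed
  have "(\<lambda>K. infsum ?f (?A K)) \<longlonglongrightarrow> 1"
  proof (rule tendsto_sandwich[where f="\<lambda>_. 1" and h="\<lambda>K. 1 + 1 / real K"])
    show "\<forall>\<^sub>F K in sequentially. infsum ?f (?A K) \<le> 1 + 1 / real K"
      using eventually_gt_at_top[of 0] by eventually_elim (rule upper)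
    show "(\<lambda>K. 1 + 1 / real K) \<longlonglongrightarrow> 1" by real_asymp
  qed (use lower in auto)
  then have "(\<lambda>K. 6 / pi\<^sup>2 * infsum ?f (?A K)) \<longlonglongrightarrow> 6 / pi\<^sup>2 * 1"
    by (intro tendsto_intros)
  then show ?thesis unfolding eq by simp
qed

text \<open>
  All natural numbers serve as indices, so that the underlying space is the whole function type; only
  the coordinates at primes are ever used.  At these, the coordinate is uniform modulo \<open>p\<^sup>2\<close>.
\<close>

definition residue_space :: "(nat \<Rightarrow> nat) measure" where
  "residue_space = (\<Pi>\<^sub>M p\<in>UNIV. measure_pmf (pmf_of_set {..<p\<^sup>2}))"

text \<open>
  The coordinate \<open>i\<close> of a sequence belongs to the integer \<open>Suc i\<close>.  A constant function \<open>z = (\<lambda>_. n)\<close> is a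
  legitimate argument: it gives the sieve of the integers from \<open>n + 1\<close> on.
\<close>

definition sieve :: "nat set \<Rightarrow> (nat \<Rightarrow> nat) \<Rightarrow> nat \<Rightarrow> int" where
  "sieve P z i = of_bool (\<forall>p\<in>P. \<not> p\<^sup>2 dvd Suc i + z p)"

interpretation residues: product_prob_space "\<lambda>p. measure_pmf (pmf_of_set {..<p\<^sup>2})" UNIV
  by unfold_locales

interpretation residue_space: prob_space residue_space
  unfolding residue_space_def by unfold_locales

lemma space_residue_space [simp]: "space residue_space = UNIV"
  by (simp add: residue_space_def space_PiM)

lemma measurable_residue [measurable]: "(\<lambda>z. z p) \<in> measurable residue_space (count_space UNIV)"
proof -
  have "(\<lambda>z. z p) \<in> measurable residue_space (measure_pmf (pmf_of_set {..<p\<^sup>2}))"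
    unfolding residue_space_def by measurable
  then show ?thesis by simp
qed

lemma pred_square_dvd [measurable]: "Measurable.pred residue_space (\<lambda>z. p\<^sup>2 dvd j + z p)"
  by (rule measurable_compose[OF measurable_residue]) simp

lemma residue_event: "Measurable.pred residue_space R \<Longrightarrow> {z. R z} \<in> sets residue_space"
  by (simp add: pred_def)

lemma measurable_sieve [measurable]: "(\<lambda>z. sieve P z i) \<in> measurable residue_space (count_space UNIV)"
proof -
  have "Measurable.pred residue_space (\<lambda>z. \<forall>p\<in>P. \<not> p\<^sup>2 dvd Suc i + z p)"
    by measurable
  then show ?thesis
    unfolding sieve_def by (rule measurable_compose) simp
qed

lemma sieve_event: "{z. R (map (sieve P z) [0..<L]) (map (sieve P' z) [0..<L])} \<in> sets residue_space"
proof -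
  have "(\<lambda>z. map (sieve P z) [0..<L]) \<in> measurable residue_space (count_space UNIV)" for P
  proof (induction L)
    case (Suc L)
    then show ?case
      using measurable_sieve[of P L] by simp
  qed simp
  then have "(\<lambda>z. (map (sieve P z) [0..<L], map (sieve P' z) [0..<L])) \<in> measurable residue_space (count_space UNIV)"
    by (simp add: measurable_pair_iff flip: pair_measure_countable)
  from measurable_sets[OF this, of "{(a, b). R a b}"] show ?thesis
    by (simp add: vimage_def)
qed

lemma prob_residues:
  assumes "finite P" "\<And>p. p \<in> P \<Longrightarrow> 0 < p"
  shows "measure residue_space {z. \<forall>p\<in>P. z p \<in> A p} = (\<Prod>p\<in>P. real (card (A p \<inter> {..<p\<^sup>2})) / real (p\<^sup>2))"
proof -
  have "measure residue_space (prod_emb UNIV (\<lambda>p. measure_pmf (pmf_of_set {..<p\<^sup>2})) P (Pi\<^sub>E P A))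
     = (\<Prod>p\<in>P. measure (measure_pmf (pmf_of_set {..<p\<^sup>2})) (A p))"
    unfolding residue_space_def using assms(1) by (intro residues.measure_PiM_emb) auto
  also have "prod_emb UNIV (\<lambda>p. measure_pmf (pmf_of_set {..<p\<^sup>2})) P (Pi\<^sub>E P A) = {z. \<forall>p\<in>P. z p \<in> A p}"
    by (auto simp: prod_emb_def)
  also have "(\<Prod>p\<in>P. measure (measure_pmf (pmf_of_set {..<p\<^sup>2})) (A p))
      = (\<Prod>p\<in>P. real (card (A p \<inter> {..<p\<^sup>2})) / real (p\<^sup>2))"
    using assms(2) by (intro prod.cong) (auto simp: measure_pmf_of_set Int_commute lessThan_empty_iff)
  finally show ?thesis .
qed

lemma unique_residue:
  fixes m :: nat
  assumes "0 < m"
  shows "{r. m dvd j + r} \<inter> {..<m} = {(m - j mod m) mod m}"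
proof -
  have "m dvd j + (m - j mod m) mod m"
  proof -
    have "(j + (m - j mod m) mod m) mod m = (j mod m + (m - j mod m)) mod m"
      by (simp add: mod_simps)
    also have "\<dots> = 0" using assms by (simp add: le_mod_geq mod_le_divisor less_imp_le)
    finally show ?thesis by (simp add: mod_eq_0_iff_dvd)
  qed
  moreover have "r = s" if "m dvd j + r" "r < m" "m dvd j + s" "s < m" for r s
  proof -
    have "[j + r = j + s] (mod m)" using that by (simp add: cong_def mod_eq_0_iff_dvd)
    then have "[r = s] (mod m)" by (simp add: cong_add_lcancel_nat)
    then show ?thesis using that by (simp add: cong_def)
  qed
  ultimately show ?thesis using assms by auto
qed

lemma card_residue_avoid:
  fixes m :: nat
  assumes "0 < m"
  shows "card ({r. m dvd j + r} \<inter> {..<m}) = 1" "card ({r. \<not> m dvd j + r} \<inter> {..<m}) = m - 1"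
proof -
  show 1: "card ({r. m dvd j + r} \<inter> {..<m}) = 1" by (simp add: unique_residue[OF assms])
  have "{r. \<not> m dvd j + r} \<inter> {..<m} = {..<m} - ({r. m dvd j + r} \<inter> {..<m})" by auto
  then show "card ({r. \<not> m dvd j + r} \<inter> {..<m}) = m - 1"
    using 1 by (simp add: card_Diff_subset)
qed

lemma sieve_tail_event: "{z. \<exists>p. prime p \<and> K < p \<and> p\<^sup>2 dvd j + z p} \<in> sets residue_space"
  by (rule residue_event) measurable

lemma prob_sieve_tail_le:
  assumes "0 < K"
  shows "measure residue_space {z. \<exists>p. prime p \<and> K < p \<and> p\<^sup>2 dvd j + z p} \<le> 1 / real K"
proof -
  define B where "B p = {z. prime p \<and> K < p \<and> p\<^sup>2 dvd j + z p}" for p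
  have B[measurable]: "B p \<in> sets residue_space" for p
    unfolding B_def by (rule residue_event) measurable
  have le: "measure residue_space (B p) \<le> (if K < p then 1 / real p ^ 2 else 0)" for p
  proof (cases "prime p \<and> K < p")
    case True
    then have "B p = {z. \<forall>q\<in>{p}. z q \<in> {r. q\<^sup>2 dvd j + r}}"
      by (auto simp: B_def)
    then have "measure residue_space (B p) = 1 / real p ^ 2"
      using True prob_residues[of "{p}" "\<lambda>p. {r. p\<^sup>2 dvd j + r}"] card_residue_avoid(1)[of "p\<^sup>2" j]
      by (simp add: prime_gt_0_nat)
    then show ?thesis using True by simp
  next
    case False
    then have "B p = {}" by (auto simp: B_def)
    then show ?thesis by simp
  qed
  have fin: "(\<Sum>p<n. measure residue_space (B p)) \<le> 1 / real K" for n
  proof -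
    have "(\<Sum>p<n. measure residue_space (B p)) \<le> (\<Sum>p<n. if K < p then 1 / real p ^ 2 else 0)"
      by (intro sum_mono le)
    also have "\<dots> = (\<Sum>p\<in>{K<..<n}. 1 / real p ^ 2)"
      by (simp add: sum.If_cases) (intro sum.cong, auto)
    also have "\<dots> \<le> 1 / real K"
      using assms by (intro sum_inverse_squares_le) auto
    finally show ?thesis .
  qed
  have sm: "summable (\<lambda>p. measure residue_space (B p))"
    by (rule bounded_imp_summable[OF _ , of _ "1 / real K"]) (use fin[of "Suc _"] in \<open>auto simp: lessThan_Suc_atMost\<close>)
  have "{z. \<exists>p. prime p \<and> K < p \<and> p\<^sup>2 dvd j + z p} = (\<Union>p. B p)"
    by (auto simp: B_def)
  then have "measure residue_space {z. \<exists>p. prime p \<and> K < p \<and> p\<^sup>2 dvd j + z p} \<le> (\<Sum>p. measure residue_space (B p))"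
    using residue_space.finite_measure_subadditive_countably[OF _ sm] B by (simp add: image_subset_iff)
  also have "\<dots> \<le> 1 / real K"
    by (rule suminf_le_const[OF sm fin])
  finally show ?thesis .
qed

lemma prob_sieve_upto: "measure residue_space {z. sieve (primes_upto K) z i = 1} = (\<Prod>p\<in>primes_upto K. 1 - 1 / real p ^ 2)"
proof -
  have "{z. sieve (primes_upto K) z i = 1} = {z. \<forall>p\<in>primes_upto K. z p \<in> {r. \<not> p\<^sup>2 dvd Suc i + r}}"
    by (auto simp: sieve_def)
  then have "measure residue_space {z. sieve (primes_upto K) z i = 1} =
      (\<Prod>p\<in>primes_upto K. real (card ({r. \<not> p\<^sup>2 dvd Suc i + r} \<inter> {..<p\<^sup>2})) / real (p\<^sup>2))"
    using prob_residues[OF finite_primes_upto, of K "\<lambda>p. {r. \<not> p\<^sup>2 dvd Suc i + r}"]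
    by (auto simp: primes_upto_def prime_gt_0_nat)
  also have "\<dots> = (\<Prod>p\<in>primes_upto K. 1 - 1 / real p ^ 2)"
  proof (rule prod.cong)
    fix p assume "p \<in> primes_upto K"
    then have "0 < p" by (simp add: primes_upto_def prime_gt_0_nat)
    then show "real (card ({r. \<not> p\<^sup>2 dvd Suc i + r} \<inter> {..<p\<^sup>2})) / real (p\<^sup>2) = 1 - 1 / real p ^ 2"
      by (subst card_residue_avoid) (simp_all add: of_nat_diff field_simps)
  qed simp
  finally show ?thesis .
qed

lemma sieve_neq_imp:
  assumes "sieve {p. prime p} z i \<noteq> sieve (primes_upto K) z i"
  shows "\<exists>p. prime p \<and> K < p \<and> p\<^sup>2 dvd Suc i + z p"
  using assms by (auto simp: sieve_def primes_upto_def split: if_splits) (meson not_le)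

lemma prob_sieve_neq_le:
  assumes "0 < K"
  shows "measure residue_space {z. sieve {p. prime p} z i \<noteq> sieve (primes_upto K) z i} \<le> 1 / real K"
proof -
  have "measure residue_space {z. sieve {p. prime p} z i \<noteq> sieve (primes_upto K) z i}
      \<le> measure residue_space {z. \<exists>p. prime p \<and> K < p \<and> p\<^sup>2 dvd Suc i + z p}"
    using sieve_neq_imp by (intro residue_space.finite_measure_mono sieve_tail_event) blast
  also have "\<dots> \<le> 1 / real K" by (rule prob_sieve_tail_le[OF assms])
  finally show ?thesis .
qed

lemma prob_sieve: "measure residue_space {z. sieve {p. prime p} z i = 1} = 6 / pi\<^sup>2"
proof -
  let ?s = "measure residue_space {z. sieve {p. prime p} z i = 1}"
  let ?t = "\<lambda>K. measure residue_space {z. sieve (primes_upto K) z i = 1}"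
  have close: "\<bar>?t K - ?s\<bar> \<le> 1 / real K" if "0 < K" for K
  proof -
    have ms: "{z. sieve P z i = 1} \<in> sets residue_space" for P
      using measurable_sets[OF measurable_sieve[of P i], of "{1}"] by (simp add: vimage_def)
    have md: "{z. sieve {p. prime p} z i \<noteq> sieve (primes_upto K) z i} \<in> sets residue_space"
      using sieve_event[of "\<lambda>a b. last a \<noteq> last b" "{p. prime p}" "Suc i" "primes_upto K"] by simp
    have "?s \<le> ?t K"
      by (intro residue_space.finite_measure_mono ms) (auto simp: sieve_def primes_upto_def)
    moreover have "?t K \<le> measure residue_space ({z. sieve {p. prime p} z i = 1} \<union> {z. sieve {p. prime p} z i \<noteq> sieve (primes_upto K) z i})"
      by (intro residue_space.finite_measure_mono sets.Un ms md) auto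
    moreover have "\<dots> \<le> ?s + measure residue_space {z. sieve {p. prime p} z i \<noteq> sieve (primes_upto K) z i}"
      by (intro measure_Un_le ms md)
    ultimately show ?thesis using prob_sieve_neq_le[OF that, of i] by linarith
  qed
  have "(\<lambda>K. 1 / real K) \<longlonglongrightarrow> 0" by real_asymp
  then have "(\<lambda>K. ?t K - ?s) \<longlonglongrightarrow> 0"
    by (rule Lim_null_comparison[rotated]) (use close in \<open>auto simp: eventually_sequentially intro!: exI[of _ 1]\<close>)
  then have "?t \<longlonglongrightarrow> ?s" by (simp add: LIM_zero_iff)
  moreover have "?t \<longlonglongrightarrow> 6 / pi\<^sup>2"
    using LIMSEQ_euler_product by (simp add: prob_sieve_upto)
  ultimately show ?thesis by (rule LIMSEQ_unique)
qed

section \<open>Word frequencies along the square-free numbers\<close>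

definition sieve_period :: "nat \<Rightarrow> nat" where
  "sieve_period K = (\<Prod>p\<in>primes_upto K. p\<^sup>2)"

lemma sieve_period_pos: "0 < sieve_period K"
  unfolding sieve_period_def by (rule prod_pos) (auto simp: primes_upto_def prime_gt_0_nat)

lemma sieve_cong:
  assumes "\<And>p. p \<in> P \<Longrightarrow> [z p = z' p] (mod p\<^sup>2)"
  shows "sieve P z = sieve P z'"
proof -
  have "p\<^sup>2 dvd Suc i + z p \<longleftrightarrow> p\<^sup>2 dvd Suc i + z' p" if "p \<in> P" for p i
    using cong_dvd_iff[of "Suc i + z p" "Suc i + z' p" "p\<^sup>2"] assms[OF that]
    by (metis cong_add_lcancel_nat cong_dvd_iff cong_sym)
  then show ?thesis unfolding sieve_def by (intro ext) auto
qed

lemma sieve_periodic: "sieve (primes_upto K) (\<lambda>_. n mod sieve_period K) = sieve (primes_upto K) (\<lambda>_. n)"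
proof (rule sieve_cong)
  fix p assume "p \<in> primes_upto K"
  then have "p\<^sup>2 dvd sieve_period K"
    unfolding sieve_period_def by (intro dvd_prodI finite_primes_upto)
  then show "[n mod sieve_period K = n] (mod p\<^sup>2)"
    by (simp add: cong_def mod_mod_cancel)
qed

text \<open>
  The Chinese remainder theorem in probabilistic form.  For \<open>n\<close> below the product \<open>Q\<close> of the moduli
  the events that \<open>z p = n mod p\<^sup>2\<close> for all \<open>p \<le> K\<close> are disjoint and have probability \<open>1 / Q\<close>
  each, so they exhaust the space up to a null set; on each of them the sieve is constant.
\<close>

lemma prob_sieve_eq_period_average:
  "measure residue_space {z. map (sieve (primes_upto K) z) [0..<L] \<in> W}
    = real (card {n. n < sieve_period K \<and> map (sieve (primes_upto K) (\<lambda>_. n)) [0..<L] \<in> W}) / real (sieve_period K)"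
proof -
  let ?P = "primes_upto K" and ?Q = "sieve_period K"
  have Ppos: "0 < p" if "p \<in> ?P" for p using that by (auto simp: primes_upto_def prime_gt_0_nat)
  define E where "E n = {z. \<forall>p\<in>?P. z p \<in> {n mod p\<^sup>2}}" for n
  define V where "V = {z. map (sieve ?P z) [0..<L] \<in> W}"
  define G where "G = {n. n < ?Q \<and> map (sieve ?P (\<lambda>_. n)) [0..<L] \<in> W}"
  have Es: "E n \<in> sets residue_space" for n
    unfolding E_def by (intro residue_event pred_intros_finite finite_primes_upto measurable_compose[OF measurable_residue]) simp
  have Vs: "V \<in> sets residue_space"
    unfolding V_def using sieve_event[of "\<lambda>a b. a \<in> W" ?P L ?P] by simp
  have prE: "measure residue_space (E n) = 1 / real ?Q" for n
  proof -
    have "measure residue_space (E n) = (\<Prod>p\<in>?P. real (card ({n mod p\<^sup>2} \<inter> {..<p\<^sup>2})) / real (p\<^sup>2))"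
      unfolding E_def by (rule prob_residues[OF finite_primes_upto Ppos])
    also have "\<dots> = (\<Prod>p\<in>?P. 1 / real (p\<^sup>2))"
      using Ppos by (intro prod.cong) auto
    also have "\<dots> = 1 / real ?Q" by (simp add: sieve_period_def prod_dividef)
    finally show ?thesis .
  qed
  have inj: "n = n'" if "n < ?Q" "n' < ?Q" "z \<in> E n" "z \<in> E n'" for n n' z
  proof -
    have "[n = n'] (mod ?Q)"
      unfolding sieve_period_def
    proof (rule coprime_cong_prod_nat)
      fix p q assume "p \<in> ?P" "q \<in> ?P" "p \<noteq> q"
      then show "coprime (p\<^sup>2) (q\<^sup>2)"
        by (auto simp: primes_upto_def intro!: primes_coprime)
    next
      fix p assume "p \<in> ?P"
      then show "[n = n'] (mod p\<^sup>2)"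
        using that(3,4) by (auto simp: E_def cong_def)
    qed
    then show ?thesis using that by (simp add: cong_def)
  qed
  have disj: "disjoint_family_on E I" if "I \<subseteq> {..<?Q}" for I
    unfolding disjoint_family_on_def using inj that by blast
  have prU: "measure residue_space (\<Union>n\<in>I. E n) = real (card I) / real ?Q" if "I \<subseteq> {..<?Q}" for I
  proof -
    have "finite I" using that finite_subset by blast
    then have "measure residue_space (\<Union>n\<in>I. E n) = (\<Sum>n\<in>I. measure residue_space (E n))"
      using Es by (intro residue_space.finite_measure_finite_Union disj that) auto
    then show ?thesis by (simp add: prE)
  qed
  have full: "measure residue_space (\<Union>n<?Q. E n) = 1"
    using prU[of "{..<?Q}"] sieve_period_pos[of K] by simp
  have eqV: "sieve ?P z = sieve ?P (\<lambda>_. n)" if "z \<in> E n" for z n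
    using that by (intro sieve_cong) (auto simp: E_def cong_def)
  have "V \<inter> (\<Union>n<?Q. E n) = (\<Union>n\<in>G. E n)"
    using eqV by (auto simp: V_def G_def)
  moreover have "measure residue_space (V \<inter> (\<Union>n<?Q. E n)) = measure residue_space V"
    using Es Vs full residue_space.prob_space by (intro residue_space.measure_space_inter) auto
  moreover have "measure residue_space (\<Union>n\<in>G. E n) = real (card G) / real ?Q"
    by (rule prU) (auto simp: G_def)
  ultimately show ?thesis by (simp add: V_def G_def)
qed

lemma LIMSEQ_average_periodic:
  fixes A :: "nat \<Rightarrow> bool"
  assumes "0 < Q" and per: "\<And>n. A (n mod Q) = A n"
  shows "(\<lambda>N. real (card {n. n < N \<and> A n}) / real N) \<longlonglongrightarrow> real (card {n. n < Q \<and> A n}) / real Q"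
proof -
  let ?c = "\<lambda>N. card {n. n < N \<and> A n}"
  have add: "?c (N + Q) = ?c N + ?c Q" for N
  proof -
    have "bij_betw (\<lambda>n. n mod Q) {n. N \<le> n \<and> n < N + Q \<and> A n} {n. n < Q \<and> A n}"
    proof (rule bij_betw_imageI)
      show "inj_on (\<lambda>n. n mod Q) {n. N \<le> n \<and> n < N + Q \<and> A n}"
      proof (rule inj_onI)
        have *: "x = y" if "x mod Q = y mod Q" "N \<le> x" "x \<le> y" "y < N + Q" for x y
        proof -
          have "Q dvd y - x" using that(1,3) by (metis mod_eq_dvd_iff_nat)
          moreover have "y - x < Q" using that by linarith
          ultimately show ?thesis using that(3) by (metis dvd_imp_mod_0 mod_less diff_is_0_eq le_antisym)
        qed
        fix x y assume "x \<in> {n. N \<le> n \<and> n < N + Q \<and> A n}" "y \<in> {n. N \<le> n \<and> n < N + Q \<and> A n}" "x mod Q = y mod Q"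
        then show "x = y" using *[of x y] *[of y x] by (cases "x \<le> y") auto
      qed
      show "(\<lambda>n. n mod Q) ` {n. N \<le> n \<and> n < N + Q \<and> A n} = {n. n < Q \<and> A n}"
      proof (intro set_eqI iffI)
        fix r assume "r \<in> (\<lambda>n. n mod Q) ` {n. N \<le> n \<and> n < N + Q \<and> A n}"
        then show "r \<in> {n. n < Q \<and> A n}" using per \<open>0 < Q\<close> by auto
      next
        fix r assume r: "r \<in> {n. n < Q \<and> A n}"
        (* The element of the window from N to N + Q - 1 that is congruent to r. *)
        define n where "n = N + (r + (Q - N mod Q)) mod Q"
        have "n mod Q = (N mod Q + (r + (Q - N mod Q))) mod Q"
          unfolding n_def by (simp add: mod_simps)
        also have "\<dots> = (r + Q) mod Q"
        proof -
          have "N mod Q + (r + (Q - N mod Q)) = r + Q"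
            using \<open>0 < Q\<close> mod_le_divisor[of Q N] by linarith
          then show ?thesis by simp
        qed
        also have "\<dots> = r" using r by simp
        finally have "n mod Q = r" .
        moreover have "N \<le> n" "n < N + Q" unfolding n_def using \<open>0 < Q\<close> by auto
        moreover have "A n" using per[of n] r \<open>n mod Q = r\<close> by simp
        ultimately show "r \<in> (\<lambda>n. n mod Q) ` {n. N \<le> n \<and> n < N + Q \<and> A n}" by force
      qed
    qed
    then have "card {n. N \<le> n \<and> n < N + Q \<and> A n} = ?c Q" by (rule bij_betw_same_card)
    moreover have "{n. n < N + Q \<and> A n} = {n. n < N \<and> A n} \<union> {n. N \<le> n \<and> n < N + Q \<and> A n}" by auto
    moreover have "card ({n. n < N \<and> A n} \<union> {n. N \<le> n \<and> n < N + Q \<and> A n})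
        = ?c N + card {n. N \<le> n \<and> n < N + Q \<and> A n}"
      by (rule card_Un_disjoint) auto
    ultimately show ?thesis by simp
  qed
  have step: "?c (k * Q + r) = k * ?c Q + ?c r" for k r
  proof (induction k)
    case (Suc k)
    have "?c (Suc k * Q + r) = ?c ((k * Q + r) + Q)" by (simp add: algebra_simps)
    then show ?case using Suc add[of "k * Q + r"] by simp
  qed simp
  have close: "\<bar>real (?c N) / real N - real (?c Q) / real Q\<bar> \<le> 2 * real Q / real N" if "0 < N" for N
  proof -
    let ?k = "N div Q" and ?r = "N mod Q"
    have "card {n. n < ?r \<and> A n} \<le> card {..<?r}" by (rule card_mono) auto
    then have cr: "?c ?r \<le> Q" using \<open>0 < Q\<close> mod_less_divisor[of Q N] by (simp add: less_imp_le le_trans)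
    have "card {n. n < Q \<and> A n} \<le> card {..<Q}" by (rule card_mono) auto
    then have cQ: "?c Q \<le> Q" by simp
    have "N = ?k * Q + ?r" by simp
    then have cN: "?c N = ?k * ?c Q + ?c ?r" using step[of ?k ?r] by simp
    have NN: "real N = real ?k * real Q + real ?r"
      by (metis \<open>N = ?k * Q + ?r\<close> of_nat_add of_nat_mult)
    have "real (?c N) * real Q - real (?c Q) * real N = real (?c ?r) * real Q - real (?c Q) * real ?r"
      unfolding cN by (subst NN) (simp add: algebra_simps)
    moreover have "0 \<le> real (?c ?r) * real Q" "real (?c ?r) * real Q \<le> real Q * real Q"
      using cr by (auto intro: mult_right_mono)
    moreover have "0 \<le> real (?c Q) * real ?r" "real (?c Q) * real ?r \<le> real Q * real Q"
      using cQ mod_less_divisor[OF \<open>0 < Q\<close>, of N] by (simp_all add: mult_mono)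
    ultimately have "\<bar>real (?c N) * real Q - real (?c Q) * real N\<bar> \<le> 2 * real Q * real Q"
      by linarith
    moreover have "real (?c N) / real N - real (?c Q) / real Q = (real (?c N) * real Q - real (?c Q) * real N) / (real N * real Q)"
      using \<open>0 < Q\<close> that by (simp add: field_simps)
    moreover have "\<bar>x\<bar> / (real N * real Q) \<le> 2 * real Q / real N" if "\<bar>x\<bar> \<le> 2 * real Q * real Q" for x
      using divide_right_mono[OF that, of "real N * real Q"] \<open>0 < Q\<close> by simp
    ultimately show ?thesis by (simp add: abs_divide)
  qed
  have "(\<lambda>N. 2 * real Q / real N) \<longlonglongrightarrow> 0" by real_asymp
  then have "(\<lambda>N. real (?c N) / real N - real (?c Q) / real Q) \<longlonglongrightarrow> 0"
    by (rule Lim_null_comparison[rotated]) (use close in \<open>auto simp: eventually_sequentially intro!: exI[of _ 1]\<close>)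
  then show ?thesis by (simp add: LIM_zero_iff)
qed

text \<open>
  The counterpart for frequencies of the tail bound for the random sieve.
\<close>

lemma card_square_multiples_le:
  assumes "0 < K" "0 < j"
  shows "real (card {n. n < N \<and> (\<exists>p. prime p \<and> K < p \<and> p\<^sup>2 dvd j + n)}) \<le> real (N + j) / real K"
proof -
  let ?D = "{K<..N + j}"
  have one: "real (card {n. n < N \<and> d\<^sup>2 dvd j + n}) \<le> real (N + j) * (1 / real d ^ 2)" if "d \<in> ?D" for d
  proof -
    have "0 < d" using that assms by auto
    have "card {n. n < N \<and> d\<^sup>2 dvd j + n} \<le> card ((\<lambda>k. d\<^sup>2 * k - j) ` {1..(N + j) div d\<^sup>2})"
    proof (rule card_mono)
      show "{n. n < N \<and> d\<^sup>2 dvd j + n} \<subseteq> (\<lambda>k. d\<^sup>2 * k - j) ` {1..(N + j) div d\<^sup>2}"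
      proof
        fix n assume n: "n \<in> {n. n < N \<and> d\<^sup>2 dvd j + n}"
        then obtain k where k: "j + n = d\<^sup>2 * k" by auto
        have "k \<noteq> 0" using k \<open>0 < j\<close> by (metis add_is_0 mult_0_right less_numeral_extra(3))
        moreover have "k \<le> (N + j) div d\<^sup>2"
        proof -
          have "(d\<^sup>2 * k) div d\<^sup>2 \<le> (N + j) div d\<^sup>2"
            using n k by (intro div_le_mono) auto
          then show ?thesis using \<open>0 < d\<close> by simp
        qed
        moreover have "n = d\<^sup>2 * k - j" using k by simp
        ultimately show "n \<in> (\<lambda>k. d\<^sup>2 * k - j) ` {1..(N + j) div d\<^sup>2}" by auto
      qed
    qed simp
    also have "\<dots> \<le> (N + j) div d\<^sup>2"
      using card_image_le[of "{1..(N + j) div d\<^sup>2}"] by fastforce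
    finally have "real (card {n. n < N \<and> d\<^sup>2 dvd j + n}) \<le> real ((N + j) div d\<^sup>2)" by simp
    also have "\<dots> \<le> real (N + j) / real (d\<^sup>2)" by (rule of_nat_div_le_of_nat)
    finally show ?thesis by simp
  qed
  have "{n. n < N \<and> (\<exists>p. prime p \<and> K < p \<and> p\<^sup>2 dvd j + n)} \<subseteq> (\<Union>d\<in>?D. {n. n < N \<and> d\<^sup>2 dvd j + n})"
  proof
    fix n assume "n \<in> {n. n < N \<and> (\<exists>p. prime p \<and> K < p \<and> p\<^sup>2 dvd j + n)}"
    then obtain p where p: "n < N" "prime p" "K < p" "p\<^sup>2 dvd j + n" by auto
    have "p \<le> p\<^sup>2" by (simp add: power2_eq_square)
    also have "p\<^sup>2 \<le> j + n" using p(4) \<open>0 < j\<close> by (intro dvd_imp_le) auto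
    finally have "p \<in> ?D" using p by auto
    then show "n \<in> (\<Union>d\<in>?D. {n. n < N \<and> d\<^sup>2 dvd j + n})" using p by blast
  qed
  then have "card {n. n < N \<and> (\<exists>p. prime p \<and> K < p \<and> p\<^sup>2 dvd j + n)} \<le> card (\<Union>d\<in>?D. {n. n < N \<and> d\<^sup>2 dvd j + n})"
    by (intro card_mono) auto
  also have "\<dots> \<le> (\<Sum>d\<in>?D. card {n. n < N \<and> d\<^sup>2 dvd j + n})"
    by (rule card_UN_le) simp
  finally have "real (card {n. n < N \<and> (\<exists>p. prime p \<and> K < p \<and> p\<^sup>2 dvd j + n)}) \<le> (\<Sum>d\<in>?D. real (card {n. n < N \<and> d\<^sup>2 dvd j + n}))"
    by (simp flip: of_nat_sum)
  also have "\<dots> \<le> (\<Sum>d\<in>?D. real (N + j) * (1 / real d ^ 2))"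
    by (intro sum_mono one)
  also have "\<dots> = real (N + j) * (\<Sum>d\<in>?D. 1 / real d ^ 2)"
    by (simp add: sum_distrib_left)
  also have "\<dots> \<le> real (N + j) * (1 / real K)"
    using assms by (intro mult_left_mono sum_inverse_squares_le) auto
  finally show ?thesis by simp
qed

lemma map_neq_ex: "map f [0..<L] \<noteq> map g [0..<L] \<Longrightarrow> \<exists>i<L. f i \<noteq> g i"
  by auto

text \<open>
  Words of \<open>\<mu>\<^sup>2\<close> appear with the frequencies that the random sieve predicts.  The truncated sieve is
  periodic, so its frequencies converge; truncation costs at most about \<open>L / K\<close> on either side.
\<close>

theorem LIMSEQ_word_frequency:
  "(\<lambda>N. real (card {n. n < N \<and> map (sieve {p. prime p} (\<lambda>_. n)) [0..<L] \<in> W}) / real N)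
    \<longlonglongrightarrow> measure residue_space {z. map (sieve {p. prime p} z) [0..<L] \<in> W}"
proof -
  let ?P = "{p :: nat. prime p}"
  define a where "a N = real (card {n. n < N \<and> map (sieve ?P (\<lambda>_. n)) [0..<L] \<in> W}) / real N" for N
  define b where "b K N = real (card {n. n < N \<and> map (sieve (primes_upto K) (\<lambda>_. n)) [0..<L] \<in> W}) / real N" for K N
  define \<alpha> where "\<alpha> = measure residue_space {z. map (sieve ?P z) [0..<L] \<in> W}"
  define \<beta> where "\<beta> K = measure residue_space {z. map (sieve (primes_upto K) z) [0..<L] \<in> W}" for K
  have lim_b: "b K \<longlonglongrightarrow> \<beta> K" for K
    unfolding b_def \<beta>_def prob_sieve_eq_period_average
    by (rule LIMSEQ_average_periodic[OF sieve_period_pos]) (simp add: sieve_periodic)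
  have \<alpha>\<beta>: "\<bar>\<alpha> - \<beta> K\<bar> \<le> real L / real K" if "0 < K" for K
  proof -
    let ?A = "{z. map (sieve ?P z) [0..<L] \<in> W}" and ?B = "{z. map (sieve (primes_upto K) z) [0..<L] \<in> W}"
    let ?E = "\<lambda>i. {z. \<exists>p. prime p \<and> K < p \<and> p\<^sup>2 dvd Suc i + z p}"
    have As: "?A \<in> sets residue_space" and Bs: "?B \<in> sets residue_space"
      using sieve_event[of "\<lambda>a b. a \<in> W" ?P L ?P] sieve_event[of "\<lambda>a b. a \<in> W" "primes_upto K" L ?P] by simp_all
    have Es: "(\<Union>i<L. ?E i) \<in> sets residue_space"
      by (intro sets.finite_UN sieve_tail_event) simp
    have "measure residue_space (\<Union>i<L. ?E i) \<le> (\<Sum>i<L. measure residue_space (?E i))"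
      by (rule residue_space.finite_measure_subadditive_finite[OF finite_lessThan image_subsetI])
        (rule sieve_tail_event)
    also have "\<dots> \<le> (\<Sum>i<L. 1 / real K)"
      by (intro sum_mono prob_sieve_tail_le that)
    finally have E: "measure residue_space (\<Union>i<L. ?E i) \<le> real L / real K" by simp
    have diff: "z \<in> (\<Union>i<L. ?E i)" if "map (sieve ?P z) [0..<L] \<noteq> map (sieve (primes_upto K) z) [0..<L]" for z
      using map_neq_ex[OF that] sieve_neq_imp by blast
    have "z \<in> ?A \<longleftrightarrow> z \<in> ?B" if "z \<notin> (\<Union>i<L. ?E i)" for z
      using diff[of z] that by (simp only: mem_Collect_eq) metis
    then have "?A \<subseteq> ?B \<union> (\<Union>i<L. ?E i)" "?B \<subseteq> ?A \<union> (\<Union>i<L. ?E i)"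
      by blast+
    then have "\<alpha> \<le> measure residue_space (?B \<union> (\<Union>i<L. ?E i))" "\<beta> K \<le> measure residue_space (?A \<union> (\<Union>i<L. ?E i))"
      unfolding \<alpha>_def \<beta>_def using As Bs Es by (auto intro!: residue_space.finite_measure_mono)
    moreover have "measure residue_space (?B \<union> (\<Union>i<L. ?E i)) \<le> \<beta> K + measure residue_space (\<Union>i<L. ?E i)"
      "measure residue_space (?A \<union> (\<Union>i<L. ?E i)) \<le> \<alpha> + measure residue_space (\<Union>i<L. ?E i)"
      unfolding \<alpha>_def \<beta>_def using As Bs Es by (auto intro!: measure_Un_le)
    ultimately show ?thesis using E by linarith
  qed
  have ab: "\<bar>a N - b K N\<bar> \<le> real L * real (N + L) / (real K * real N)" if "0 < K" for K N
  proof -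
    let ?A = "{n. n < N \<and> map (sieve ?P (\<lambda>_. n)) [0..<L] \<in> W}"
    let ?B = "{n. n < N \<and> map (sieve (primes_upto K) (\<lambda>_. n)) [0..<L] \<in> W}"
    let ?E = "\<lambda>i. {n. n < N \<and> (\<exists>p. prime p \<and> K < p \<and> p\<^sup>2 dvd Suc i + n)}"
    have "real (card (\<Union>i<L. ?E i)) \<le> real (\<Sum>i<L. card (?E i))"
      by (intro of_nat_mono card_UN_le) simp
    also have "\<dots> \<le> (\<Sum>i<L. real (N + L) / real K)"
    proof -
      have "real (card (?E i)) \<le> real (N + L) / real K" if "i < L" for i
      proof -
        have "real (N + Suc i) / real K \<le> real (N + L) / real K"
          using that by (intro divide_right_mono) auto
        then show ?thesis
          using card_square_multiples_le[OF \<open>0 < K\<close>, of "Suc i" N] by linarith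
      qed
      then show ?thesis unfolding of_nat_sum by (intro sum_mono) auto
    qed
    finally have E: "real (card (\<Union>i<L. ?E i)) \<le> real L * (real (N + L) / real K)" by simp
    have diff: "n \<in> (\<Union>i<L. ?E i)" if "n < N" "map (sieve ?P (\<lambda>_. n)) [0..<L] \<noteq> map (sieve (primes_upto K) (\<lambda>_. n)) [0..<L]" for n
      using map_neq_ex[OF that(2)] sieve_neq_imp[of "\<lambda>_. n"] that(1) by blast
    have "n \<in> ?A \<longleftrightarrow> n \<in> ?B" if "n \<notin> (\<Union>i<L. ?E i)" for n
      using diff[of n] that by (simp only: mem_Collect_eq) metis
    then have "?A \<subseteq> ?B \<union> (\<Union>i<L. ?E i)" "?B \<subseteq> ?A \<union> (\<Union>i<L. ?E i)"
      by blast+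
    then have "card ?A \<le> card (?B \<union> (\<Union>i<L. ?E i))" "card ?B \<le> card (?A \<union> (\<Union>i<L. ?E i))"
      by (auto intro!: card_mono)
    moreover have "card (?B \<union> (\<Union>i<L. ?E i)) \<le> card ?B + card (\<Union>i<L. ?E i)"
      "card (?A \<union> (\<Union>i<L. ?E i)) \<le> card ?A + card (\<Union>i<L. ?E i)"
      by (auto intro: card_Un_le)
    ultimately have "\<bar>real (card ?A) - real (card ?B)\<bar> \<le> real L * (real (N + L) / real K)"
      using E by linarith
    then have "\<bar>real (card ?A) - real (card ?B)\<bar> / real N \<le> real L * (real (N + L) / real K) / real N"
      by (intro divide_right_mono) auto
    then show ?thesis
      by (simp add: a_def b_def abs_divide flip: diff_divide_distrib)
  qed
  have "a \<longlonglongrightarrow> \<alpha>"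
  proof (rule LIMSEQ_I)
    fix \<epsilon> :: real assume "0 < \<epsilon>"
    obtain K where K: "4 * real L / \<epsilon> < real K" "0 < K"
      by (metis reals_Archimedean2 gr0I less_trans of_nat_0_less_iff zero_less_Suc less_imp_le max_less_iff_conj max.strict_coboundedI1 of_nat_less_iff lessI)
    have LK: "real L / real K < \<epsilon> / 4"
      using K \<open>0 < \<epsilon>\<close> by (simp add: field_simps)
    have "(\<lambda>N. real L * real (N + L) / (real K * real N)) \<longlonglongrightarrow> real L * inverse (real K)"
      using K(2) by real_asymp
    then have "(\<lambda>N. real L * real (N + L) / (real K * real N)) \<longlonglongrightarrow> real L / real K"
      by (simp add: divide_inverse)
    then have "\<forall>\<^sub>F N in sequentially. real L * real (N + L) / (real K * real N) < \<epsilon> / 4"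
      using LK by (rule order_tendstoD)
    moreover have "\<forall>\<^sub>F N in sequentially. \<bar>b K N - \<beta> K\<bar> < \<epsilon> / 4"
      using lim_b[of K] \<open>0 < \<epsilon>\<close> by (auto simp: tendsto_iff dist_real_def elim!: allE[of _ "\<epsilon> / 4"])
    ultimately have "\<forall>\<^sub>F N in sequentially. norm (a N - \<alpha>) < \<epsilon>"
    proof eventually_elim
      case (elim N)
      then show ?case
        using ab[OF K(2), of N] \<alpha>\<beta>[OF K(2)] LK unfolding real_norm_def by linarith
    qed
    then show "\<exists>no. \<forall>n\<ge>no. norm (a n - \<alpha>) < \<epsilon>"
      by (simp add: eventually_sequentially)
  qed
  then show ?thesis unfolding a_def \<alpha>_def .
qed

section \<open>The Mirsky measure as a sieve\<close>

lemma card_residues_less_iff: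
  assumes "0 < m"
  shows "card ((\<lambda>n::nat. n mod m) ` A) < m \<longleftrightarrow> (\<exists>r<m. \<forall>n\<in>A. n mod m \<noteq> r)"
proof -
  have sub: "(\<lambda>n. n mod m) ` A \<subseteq> {..<m}" using assms by auto
  have "card ((\<lambda>n. n mod m) ` A) < m \<longleftrightarrow> (\<lambda>n. n mod m) ` A \<noteq> {..<m}"
  proof
    show "card ((\<lambda>n. n mod m) ` A) < m \<Longrightarrow> (\<lambda>n. n mod m) ` A \<noteq> {..<m}"
      by auto
    assume "(\<lambda>n. n mod m) ` A \<noteq> {..<m}"
    then have "card ((\<lambda>n. n mod m) ` A) < card {..<m}"
      using sub by (intro psubset_card_mono) auto
    then show "card ((\<lambda>n. n mod m) ` A) < m" by simp
  qed
  also have "\<dots> \<longleftrightarrow> (\<exists>r<m. r \<notin> (\<lambda>n. n mod m) ` A)" using sub by blast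
  also have "\<dots> \<longleftrightarrow> (\<exists>r<m. \<forall>n\<in>A. n mod m \<noteq> r)" by (auto simp: image_iff)
  finally show ?thesis .
qed

lemma admissible_iff: "admissible A \<longleftrightarrow> (\<forall>p. prime p \<longrightarrow> (\<exists>r<p\<^sup>2. \<forall>n\<in>A. n mod p\<^sup>2 \<noteq> r))"
  unfolding admissible_def by (simp add: card_residues_less_iff prime_gt_0_nat)

lemma admissible_supp_iff:
  "admissible (supp x) \<longleftrightarrow> (\<forall>p. prime p \<longrightarrow> (\<exists>r<p\<^sup>2. \<forall>i. x i \<noteq> 0 \<longrightarrow> Suc i mod p\<^sup>2 \<noteq> r))"
proof -
  have "(\<forall>n\<in>supp x. Q n) \<longleftrightarrow> (\<forall>i. x i \<noteq> 0 \<longrightarrow> Q (Suc i))" for Q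
  proof
    assume *: "\<forall>i. x i \<noteq> 0 \<longrightarrow> Q (Suc i)"
    show "\<forall>n\<in>supp x. Q n"
    proof
      fix n assume "n \<in> supp x"
      then show "Q n" using *[rule_format, of "n - 1"] by (simp add: supp_def pr_def)
    qed
  qed (auto simp: supp_def pr_def)
  then show ?thesis by (simp only: admissible_iff)
qed

text \<open>
  The sieve by \<open>p\<close> deletes the whole residue class of \<open>- z p\<close> modulo \<open>p\<^sup>2\<close>.
\<close>

lemma sieve_in_XA2: "sieve {p. prime p} z \<in> XA2"
proof -
  have "\<exists>r<p\<^sup>2. \<forall>i. sieve {p. prime p} z i \<noteq> 0 \<longrightarrow> Suc i mod p\<^sup>2 \<noteq> r" if "prime p" for p
  proof -
    (* The residue class of - z p. *)
    define r where "r = (p\<^sup>2 - z p mod p\<^sup>2) mod p\<^sup>2"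
    have pos: "0 < p\<^sup>2" using prime_gt_0_nat[OF that] by simp
    then have "r \<in> {r. p\<^sup>2 dvd z p + r}"
      using unique_residue[of "p\<^sup>2" "z p"] by (auto simp: r_def)
    then have r: "p\<^sup>2 dvd z p + r" "r < p\<^sup>2" using pos by (simp_all add: r_def)
    have "sieve {p. prime p} z i = 0" if "Suc i mod p\<^sup>2 = r" for i
    proof -
      have "(z p + Suc i) mod p\<^sup>2 = (z p + r) mod p\<^sup>2"
        using that by (simp add: mod_simps flip: that)
      then have "p\<^sup>2 dvd Suc i + z p"
        using r(1) by (simp add: dvd_eq_mod_eq_0 add.commute)
      then show ?thesis using \<open>prime p\<close> by (auto simp: sieve_def)
    qed
    then show ?thesis using r(2) by blast
  qed
  then show ?thesis
    unfolding XA2_def admissible_supp_iff by (auto simp: sieve_def)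
qed

lemma funpow_seq_shift: "(seq_shift ^^ n) x = (\<lambda>i. x (i + n))"
  by (induction n) (auto simp: seq_shift_def)

lemma shift_mu_sq: "(seq_shift ^^ n) mu_sq = sieve {p. prime p} (\<lambda>_. n)"
proof
  fix i
  have "(moebius_mu k)\<^sup>2 = of_bool (squarefree k)" for k
    by (simp add: moebius_mu_def flip: power_mult_distrib power_mult)
  then show "(seq_shift ^^ n) mu_sq i = sieve {p. prime p} (\<lambda>_. n) i"
    by (simp add: funpow_seq_shift mu_sq_def sieve_def squarefree_factorial_semiring)
qed

lemma seq_shift_sieve: "seq_shift (sieve P (\<lambda>_. n)) = sieve P (\<lambda>_. Suc n)"
  by (auto simp: seq_shift_def sieve_def)

lemma seq_shift_XA2: "x \<in> XA2 \<Longrightarrow> seq_shift x \<in> XA2"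
  and seq_shift_XA3: "x \<in> XA3 \<Longrightarrow> seq_shift x \<in> XA3"
proof -
  have *: "\<exists>r<m. \<forall>i. x (Suc i) \<noteq> 0 \<longrightarrow> Suc i mod m \<noteq> r" if ex: "\<exists>r<m. \<forall>i. x i \<noteq> 0 \<longrightarrow> Suc i mod m \<noteq> r"
    for m :: nat and x :: "nat \<Rightarrow> int"
  proof -
    obtain r where r: "r < m" "\<forall>i. x i \<noteq> 0 \<longrightarrow> Suc i mod m \<noteq> r" using ex by (elim exE conjE)
    (* If the class r is missing, then the class r - 1 is missing after the shift. *)
    define s where "s = (r + (m - 1)) mod m"
    have "Suc s mod m = (Suc (r + (m - 1))) mod m" unfolding s_def by (rule mod_Suc_eq)
    also have "\<dots> = r" using r(1) by simp
    finally have s: "Suc s mod m = r" .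
    have "Suc i mod m \<noteq> s" if "x (Suc i) \<noteq> 0" for i
    proof
      assume "Suc i mod m = s"
      then have "Suc (Suc i) mod m = Suc s mod m" by (metis mod_Suc_eq)
      then show False using s r(2) that by blast
    qed
    moreover have "s < m" unfolding s_def using r(1) by simp
    ultimately show ?thesis by blast
  qed
  have adm: "admissible (supp x) \<Longrightarrow> admissible (supp (seq_shift x))" for x
    unfolding admissible_supp_iff seq_shift_def using * by blast
  show "x \<in> XA2 \<Longrightarrow> seq_shift x \<in> XA2" "x \<in> XA3 \<Longrightarrow> seq_shift x \<in> XA3"
    using adm by (auto simp: XA2_def XA3_def seq_shift_def)
qed

lemma seq_shift_measurable: 
  assumes "\<And>x. x \<in> X \<Longrightarrow> seq_shift x \<in> X"
  shows "seq_shift \<in> measurable (restrict_space borel X) (restrict_space borel X)"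
proof (rule measurable_restrict_space2)
  show "seq_shift \<in> space (restrict_space borel X) \<rightarrow> X"
    using assms by (auto simp: space_restrict_space)
  have "seq_shift \<in> measurable borel borel"
    unfolding seq_shift_def
    by (intro measurable_coordinatewise_then_product measurable_coordinate)
  then show "seq_shift \<in> borel_measurable (restrict_space borel X)"
    by (rule measurable_restrict_space1)
qed

lemma open_cylinder_neighbourhood:
  fixes U :: "(nat \<Rightarrow> int) set"
  assumes "open U" "x \<in> U"
  obtains L where "\<And>y. map y [0..<L] = map x [0..<L] \<Longrightarrow> y \<in> U"
proof -
  have "openin (product_topology (\<lambda>i. euclidean) UNIV) U"
    using assms(1) by (simp add: open_fun_def)
  then obtain B where B: "x \<in> Pi\<^sub>E UNIV B" "finite {i. B i \<noteq> UNIV}" "Pi\<^sub>E UNIV B \<subseteq> U"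
    using product_topology_open_contains_basis[OF _ assms(2), of "\<lambda>_. euclidean" UNIV] by auto
  obtain L where L: "{i. B i \<noteq> UNIV} \<subseteq> {..<L}"
    using B(2) unfolding finite_nat_iff_bounded by (elim exE)
  have "y \<in> U" if y: "map y [0..<L] = map x [0..<L]" for y
  proof -
    have "y i \<in> B i" for i
    proof (cases "i < L")
      case True
      then have "y i = x i" using y by auto
      then show ?thesis using B(1) by auto
    next
      case False
      then have "B i = UNIV" using L by auto
      then show ?thesis by simp
    qed
    then show ?thesis using B(3) by auto
  qed
  then show thesis by (rule that)
qed

lemma continuous_on_coordinate_fun:
  fixes g :: "int \<Rightarrow> 'b :: topological_space"
  shows "continuous_on S (\<lambda>x :: nat \<Rightarrow> int. g (x i))"
proof -
  have "continuous_on S (\<lambda>x :: nat \<Rightarrow> int. x i)"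
    by (rule continuous_on_subset[OF continuous_on_product_coordinates]) simp
  then show ?thesis
    by (rule continuous_on_compose2[rotated]) (auto intro: Topological_Spaces.continuous_on_discrete)
qed

lemma open_coordinate: "open {x :: nat \<Rightarrow> int. x i \<in> A}"
proof -
  have "open ((\<lambda>x :: nat \<Rightarrow> int. x i) -` A)"
    by (rule open_vimage[OF Topological_Spaces.open_discrete continuous_on_product_coordinates])
  then show ?thesis by (simp add: vimage_def)
qed

lemma open_prefix: "open {y :: nat \<Rightarrow> int. map y [0..<L] = map x [0..<L]}"
proof -
  have "{y :: nat \<Rightarrow> int. map y [0..<L] = map x [0..<L]} = (\<Inter>i<L. {y. y i \<in> {x i}})"
    by auto
  also have "open \<dots>" by (intro open_INT ballI open_coordinate) simp
  finally show ?thesis .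
qed

text \<open>
  A sequence violates admissibility at \<open>p\<close> as soon as finitely many of its coordinates occupy all
  residue classes modulo \<open>p\<^sup>2\<close>, so the violation is an open condition.
\<close>

lemma compact_XA2: "compact XA2"
proof -
  let ?K = "Pi\<^sub>E UNIV (\<lambda>_ :: nat. {0, 1 :: int})"
  have "compactin (product_topology (\<lambda>_ :: nat. euclidean) UNIV) ?K"
    by (subst compactin_PiE) auto
  then have K: "compact ?K"
    by (simp add: euclidean_product_topology)
  have op: "open {x :: nat \<Rightarrow> int. \<forall>r<m. \<exists>i. x i \<noteq> 0 \<and> Suc i mod m = r}" for m
  proof -
    have "{x :: nat \<Rightarrow> int. \<forall>r<m. \<exists>i. x i \<noteq> 0 \<and> Suc i mod m = r} = (\<Inter>r<m. \<Union>i\<in>{i. Suc i mod m = r}. {x. x i \<in> - {0}})"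
      by auto
    also have "open \<dots>" by (intro open_INT ballI open_UN open_coordinate) simp
    finally show ?thesis .
  qed
  have "closed (\<Inter>p\<in>{p. prime p}. - {x :: nat \<Rightarrow> int. \<forall>r<p\<^sup>2. \<exists>i. x i \<noteq> 0 \<and> Suc i mod p\<^sup>2 = r})"
    by (intro closed_INT ballI closed_Compl op)
  then have "compact (?K \<inter> (\<Inter>p\<in>{p. prime p}. - {x :: nat \<Rightarrow> int. \<forall>r<p\<^sup>2. \<exists>i. x i \<noteq> 0 \<and> Suc i mod p\<^sup>2 = r}))"
    by (rule compact_Int_closed[OF K])
  also have "?K \<inter> (\<Inter>p\<in>{p. prime p}. - {x :: nat \<Rightarrow> int. \<forall>r<p\<^sup>2. \<exists>i. x i \<noteq> 0 \<and> Suc i mod p\<^sup>2 = r}) = XA2"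
  proof -
    have "x \<in> ?K \<longleftrightarrow> range x \<subseteq> {0, 1}" for x by (auto simp: PiE_iff)
    then show ?thesis unfolding XA2_def admissible_supp_iff by blast
  qed
  finally show ?thesis .
qed

text \<open>
  Uniform continuity on a compact set of sequences, in terms of coordinates.
\<close>

lemma continuous_on_finitely_determined:
  fixes f :: "(nat \<Rightarrow> int) \<Rightarrow> real"
  assumes X: "compact X" and f: "continuous_on X f" and "0 < \<epsilon>"
  obtains L where "\<And>x y. x \<in> X \<Longrightarrow> y \<in> X \<Longrightarrow> map x [0..<L] = map y [0..<L] \<Longrightarrow> \<bar>f x - f y\<bar> < \<epsilon>"
proof -
  have "\<exists>L. \<forall>y\<in>X. map y [0..<L] = map x [0..<L] \<longrightarrow> \<bar>f y - f x\<bar> < \<epsilon> / 2" if "x \<in> X" for x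
  proof -
    have "open {f x - \<epsilon> / 2 <..< f x + \<epsilon> / 2}" by simp
    then obtain U where U: "open U" "U \<inter> X = f -` {f x - \<epsilon> / 2 <..< f x + \<epsilon> / 2} \<inter> X"
      using f unfolding continuous_on_open_invariant by meson
    have "x \<in> U" using U(2) that \<open>0 < \<epsilon>\<close> by auto
    obtain L where L: "\<And>y. map y [0..<L] = map x [0..<L] \<Longrightarrow> y \<in> U"
      using open_cylinder_neighbourhood[OF U(1) \<open>x \<in> U\<close>] by blast
    have "\<bar>f y - f x\<bar> < \<epsilon> / 2" if "y \<in> X" "map y [0..<L] = map x [0..<L]" for y
    proof -
      have "y \<in> f -` {f x - \<epsilon> / 2 <..< f x + \<epsilon> / 2}" using L[OF that(2)] that(1) U(2) by blast
      then show ?thesis unfolding vimage_eq greaterThanLessThan_iff by linarith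
    qed
    then show ?thesis by blast
  qed
  then obtain l where l: "\<And>x y. x \<in> X \<Longrightarrow> y \<in> X \<Longrightarrow> map y [0..<l x] = map x [0..<l x] \<Longrightarrow> \<bar>f y - f x\<bar> < \<epsilon> / 2"
    by metis
  define C where "C x = {y :: nat \<Rightarrow> int. map y [0..<l x] = map x [0..<l x]}" for x
  have op: "open (C x)" for x
    unfolding C_def by (rule open_prefix)
  have cover: "X \<subseteq> (\<Union>x\<in>X. C x)"
    by (auto simp: C_def)
  obtain F where F: "F \<subseteq> X" "finite F" "X \<subseteq> (\<Union>x\<in>F. C x)"
    by (rule compactE_image[OF X op cover])
  define L where "L = Max (insert 0 (l ` F))"
  have "\<bar>f x - f y\<bar> < \<epsilon>" if xy: "x \<in> X" "y \<in> X" "map x [0..<L] = map y [0..<L]" for x y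
  proof -
    obtain c where c: "c \<in> F" "x \<in> C c" using F(3) xy(1) by blast
    have "l c \<le> L" unfolding L_def using F(2) c(1) by (intro Max_ge) auto
    then have "map y [0..<l c] = map x [0..<l c]" using xy(3) by auto
    then have "map y [0..<l c] = map c [0..<l c]" using c(2) by (simp add: C_def)
    then have "\<bar>f y - f c\<bar> < \<epsilon> / 2" using l[of c y] xy(2) c(1) F(1) by auto
    moreover have "\<bar>f x - f c\<bar> < \<epsilon> / 2" using l[of c x] xy(1) c F(1) by (auto simp: C_def)
    ultimately show ?thesis by linarith
  qed
  then show thesis by (rule that)
qed

definition sieve_measure :: "(nat \<Rightarrow> int) measure" where
  "sieve_measure = distr residue_space (restrict_space borel XA2) (sieve {p. prime p})"

lemma sieve_measurable: "sieve {p. prime p} \<in> measurable residue_space (restrict_space borel XA2)"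
proof (rule measurable_restrict_space2)
  have "(\<lambda>z. sieve {p. prime p} z i) \<in> borel_measurable residue_space" for i
    using measurable_sieve by (simp add: measurable_cong_sets[OF refl sets_borel_eq_count_space])
  then show "sieve {p. prime p} \<in> borel_measurable residue_space"
    by (intro measurable_coordinatewise_then_product)
qed (simp add: sieve_in_XA2)

lemma sets_sieve_measure [measurable_cong]: "sets sieve_measure = sets (restrict_space borel XA2)"
  and space_sieve_measure [simp]: "space sieve_measure = XA2"
  by (simp_all add: sieve_measure_def space_restrict_space)

lemma prob_space_sieve_measure: "prob_space sieve_measure"
  unfolding sieve_measure_def by (rule residue_space.prob_space_distr[OF sieve_measurable])

lemma measure_sieve_measure:
  assumes "A \<in> sets (restrict_space borel XA2)"
  shows "measure sieve_measure A = measure residue_space {z. sieve {p. prime p} z \<in> A}"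
  unfolding sieve_measure_def using measure_distr[OF sieve_measurable assms] by (simp add: vimage_def)

lemma measure_sieve_prefix:
  "measure sieve_measure {x \<in> XA2. map x [0..<L] \<in> W} = measure residue_space {z. map (sieve {p. prime p} z) [0..<L] \<in> W}"
proof -
  have "{x \<in> XA2. map x [0..<L] \<in> W} = (\<lambda>x. map x [0..<L]) -` W \<inter> XA2" by auto
  then have "{x \<in> XA2. map x [0..<L] \<in> W} \<in> sets (restrict_space borel XA2)"
    by (simp only: prefix_event)
  then show ?thesis by (simp add: measure_sieve_measure sieve_in_XA2)
qed

text \<open>
  Invariance is inherited from the averages along \<open>\<mu>\<^sup>2\<close>: shifting the orbit by one step changes the
  number of occurrences of a word by at most one.
\<close>

lemma sieve_measure_invariant: "distr sieve_measure sieve_measure seq_shift = sieve_measure"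
proof -
  interpret prob_space sieve_measure by (rule prob_space_sieve_measure)
  have sm: "seq_shift \<in> measurable sieve_measure sieve_measure"
    using seq_shift_measurable[OF seq_shift_XA2] by (simp cong: measurable_cong_sets add: sets_sieve_measure)
  show ?thesis
  proof (rule prob_measure_eqI_cylinders[where X=XA2])
    show "prob_space (distr sieve_measure sieve_measure seq_shift)" by (rule prob_space_distr[OF sm])
    fix w :: "int list"
    let ?L = "length w"
    have cs: "cylinder XA2 w \<in> sets sieve_measure" by (simp add: sets_sieve_measure cylinder_event)
    have shift: "map (seq_shift x) [0..<?L] = tl (map x [0..<Suc ?L])" for x
      by (simp add: seq_shift_def map_upt_Suc del: upt_Suc)
    have "measure (distr sieve_measure sieve_measure seq_shift) (cylinder XA2 w)
        = measure sieve_measure (seq_shift -` cylinder XA2 w \<inter> XA2)"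
      by (simp add: measure_distr[OF sm cs])
    also have "seq_shift -` cylinder XA2 w \<inter> XA2 = {x \<in> XA2. map x [0..<Suc ?L] \<in> {v. tl v = w}}"
      using seq_shift_XA2 by (auto simp: cylinder_def shift simp del: upt_Suc)
    finally have 1: "measure (distr sieve_measure sieve_measure seq_shift) (cylinder XA2 w)
        = measure residue_space {z. map (sieve {p. prime p} z) [0..<Suc ?L] \<in> {v. tl v = w}}"
      by (simp only: measure_sieve_prefix)
    have 2: "measure sieve_measure (cylinder XA2 w) = measure residue_space {z. map (sieve {p. prime p} z) [0..<?L] \<in> {w}}"
      using measure_sieve_prefix[of ?L "{w}"] by (simp add: cylinder_def)
    define c where "c N = real (card {n. n < N \<and> map (sieve {p. prime p} (\<lambda>_. n)) [0..<?L] \<in> {w}})" for N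
    define d where "d N = real (card {n. n < N \<and> map (sieve {p. prime p} (\<lambda>_. n)) [0..<Suc ?L] \<in> {v. tl v = w}})" for N
    have close: "\<bar>d N / real N - c N / real N\<bar> \<le> 1 / real N" for N
    proof -
      let ?A = "\<lambda>n. map (sieve {p. prime p} (\<lambda>_. n)) [0..<?L] = w"
      have "d N = real (card {n. n < N \<and> ?A (Suc n)})"
        by (simp add: d_def shift[symmetric] seq_shift_sieve del: upt_Suc)
      also have "{n. n < N \<and> ?A (Suc n)} = (\<lambda>n. n - 1) ` {n. 0 < n \<and> n < Suc N \<and> ?A n}"
      proof (intro set_eqI iffI)
        fix n assume "n \<in> {n. n < N \<and> ?A (Suc n)}"
        then show "n \<in> (\<lambda>n. n - 1) ` {n. 0 < n \<and> n < Suc N \<and> ?A n}"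
          by (intro image_eqI[of _ _ "Suc n"]) auto
      qed auto
      also have "card \<dots> = card {n. 0 < n \<and> n < Suc N \<and> ?A n}"
        by (rule card_image) (auto simp: inj_on_def)
      finally have d: "d N = real (card {n. 0 < n \<and> n < Suc N \<and> ?A n})" .
      have c: "c N = real (card {n. n < N \<and> ?A n})" by (simp add: c_def)
      have "card {n. 0 < n \<and> n < Suc N \<and> ?A n} \<le> card (insert N {n. n < N \<and> ?A n})"
        by (rule card_mono) auto
      also have "\<dots> \<le> Suc (card {n. n < N \<and> ?A n})" by (rule card_insert_le_m1) auto
      finally have 1: "d N \<le> c N + 1" unfolding c d by simp
      have "card {n. n < N \<and> ?A n} \<le> card (insert 0 {n. 0 < n \<and> n < Suc N \<and> ?A n})"
        by (rule card_mono) auto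
      also have "\<dots> \<le> Suc (card {n. 0 < n \<and> n < Suc N \<and> ?A n})" by (rule card_insert_le_m1) auto
      finally have 2: "c N \<le> d N + 1" unfolding c d by simp
      have "\<bar>d N - c N\<bar> / real N \<le> 1 / real N" using 1 2 by (intro divide_right_mono) auto
      then show ?thesis by (simp add: abs_divide flip: diff_divide_distrib)
    qed
    have "(\<lambda>N. 1 / real N) \<longlonglongrightarrow> 0" by real_asymp
    then have "(\<lambda>N. d N / real N - c N / real N) \<longlonglongrightarrow> 0"
      by (rule Lim_null_comparison[rotated]) (use close in auto)
    moreover have "(\<lambda>N. d N / real N - c N / real N) \<longlonglongrightarrow>
        measure residue_space {z. map (sieve {p. prime p} z) [0..<Suc ?L] \<in> {v. tl v = w}} -
        measure residue_space {z. map (sieve {p. prime p} z) [0..<?L] \<in> {w}}"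
      unfolding c_def d_def by (intro tendsto_diff LIMSEQ_word_frequency)
    ultimately show "measure (distr sieve_measure sieve_measure seq_shift) (cylinder XA2 w) = measure sieve_measure (cylinder XA2 w)"
      unfolding 1 2 using LIMSEQ_unique by fastforce
  qed (simp_all add: sets_sieve_measure prob_space_sieve_measure)
qed

text \<open>
  By compactness \<open>f\<close> is uniformly close to a function of the first \<open>L\<close> coordinates, and for such a
  function convergence of the averages is convergence of word frequencies.
\<close>

lemma sieve_measure_generic:
  fixes f :: "(nat \<Rightarrow> int) \<Rightarrow> real"
  assumes f: "continuous_on XA2 f"
  shows "(\<lambda>N. 1 / real N * (\<Sum>n=0..N. f ((seq_shift ^^ n) mu_sq))) \<longlonglongrightarrow> (\<integral>x. f x \<partial>sieve_measure)"
proof -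
  interpret prob_space sieve_measure by (rule prob_space_sieve_measure)
  let ?x = "\<lambda>n :: nat. sieve {p. prime p} (\<lambda>_. n)"
  have "bounded (f ` XA2)"
    using compact_continuous_image[OF f compact_XA2] by (rule compact_imp_bounded)
  then obtain B where B: "\<And>x. x \<in> XA2 \<Longrightarrow> \<bar>f x\<bar> \<le> B"
    by (auto simp: bounded_iff)
  have fm: "f \<in> borel_measurable sieve_measure"
    using borel_measurable_continuous_on_restrict[OF f] by (simp cong: measurable_cong_sets add: sets_sieve_measure)
  have fi: "integrable sieve_measure f"
    by (rule integrable_const_bound[where B=B]) (use B fm in auto)
  define a where "a N = (\<Sum>n<N. f (?x n)) / real N" for N
  have "a \<longlonglongrightarrow> integral\<^sup>L sieve_measure f"
  proof (rule LIMSEQ_I)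
    fix \<epsilon> :: real assume "0 < \<epsilon>"
    obtain L where L: "\<And>x y. x \<in> XA2 \<Longrightarrow> y \<in> XA2 \<Longrightarrow> map x [0..<L] = map y [0..<L] \<Longrightarrow> \<bar>f x - f y\<bar> < \<epsilon> / 4"
      using continuous_on_finitely_determined[OF compact_XA2 f, of "\<epsilon> / 4"] \<open>0 < \<epsilon>\<close> by auto
    define S where "S = (\<lambda>x. map x [0..<L]) ` XA2"
    have finS: "finite S"
    proof (rule finite_subset)
      show "S \<subseteq> {w. set w \<subseteq> {0, 1} \<and> length w = L}"
        by (auto simp: S_def XA2_def image_subset_iff)
      show "finite {w. set w \<subseteq> {0, 1 :: int} \<and> length w = L}"
        by (rule finite_lists_length_eq) simp
    qed
    (* A representative of each word that occurs in XA2; g replaces a sequence by it. *)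
    define \<rho> where "\<rho> w = (SOME x. x \<in> XA2 \<and> map x [0..<L] = w)" for w
    have \<rho>: "\<rho> w \<in> XA2 \<and> map (\<rho> w) [0..<L] = w" if "w \<in> S" for w
    proof -
      from that obtain x where "x \<in> XA2 \<and> map x [0..<L] = w" unfolding S_def by blast
      then show ?thesis unfolding \<rho>_def by (rule someI[where P="\<lambda>x. x \<in> XA2 \<and> map x [0..<L] = w"])
    qed
    define g where "g x = (\<Sum>w\<in>S. f (\<rho> w) * indicator {x \<in> XA2. map x [0..<L] \<in> {w}} x)" for x
    have g: "g x = f (\<rho> (map x [0..<L]))" if "x \<in> XA2" for x
    proof -
      have "g x = (\<Sum>w\<in>S. if w = map x [0..<L] then f (\<rho> w) else 0)"
        unfolding g_def using that by (intro sum.cong) auto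
      moreover have "map x [0..<L] \<in> S" unfolding S_def using that by (rule imageI)
      ultimately show ?thesis using finS by simp
    qed
    have fg: "\<bar>f x - g x\<bar> \<le> \<epsilon> / 4" if "x \<in> XA2" for x
    proof -
      have "map x [0..<L] \<in> S" using that by (auto simp: S_def)
      then show ?thesis using L[of x "\<rho> (map x [0..<L])"] \<rho> that by (simp add: g less_imp_le)
    qed
    have cs: "{x \<in> XA2. map x [0..<L] \<in> {w}} \<in> events" for w
    proof -
      have "{x \<in> XA2. map x [0..<L] \<in> {w}} = (\<lambda>x. map x [0..<L]) -` {w} \<inter> XA2" by auto
      then show ?thesis by (simp only: sets_sieve_measure prefix_event)
    qed
    have gi: "integrable sieve_measure g"
      unfolding g_def using cs by (intro Bochner_Integration.integrable_sum integrable_mult_right integrable_real_indicator) (auto simp: emeasure_eq_measure)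
    have ig: "integral\<^sup>L sieve_measure g = (\<Sum>w\<in>S. f (\<rho> w) * measure residue_space {z. map (sieve {p. prime p} z) [0..<L] \<in> {w}})"
    proof -
      have "integral\<^sup>L sieve_measure g = (\<Sum>w\<in>S. f (\<rho> w) * measure sieve_measure {x \<in> XA2. map x [0..<L] \<in> {w}})"
        unfolding g_def using cs
        by (subst Bochner_Integration.integral_sum)
          (auto intro!: integrable_mult_right integrable_real_indicator sum.cong simp: emeasure_eq_measure Int_absorb2 subset_eq)
      then show ?thesis by (simp only: measure_sieve_prefix)
    qed
    have int_close: "\<bar>integral\<^sup>L sieve_measure f - integral\<^sup>L sieve_measure g\<bar> \<le> \<epsilon> / 4"
    proof -
      have "\<bar>integral\<^sup>L sieve_measure f - integral\<^sup>L sieve_measure g\<bar> = \<bar>\<integral>x. f x - g x \<partial>sieve_measure\<bar>"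
        using fi gi by simp
      also have "\<dots> \<le> (\<integral>x. \<bar>f x - g x\<bar> \<partial>sieve_measure)"
        by (rule integral_abs_bound)
      also have "\<dots> \<le> (\<integral>x. \<epsilon> / 4 \<partial>sieve_measure)"
        using fi gi fg by (intro integral_mono) auto
      finally show ?thesis using prob_space by simp
    qed
    define b where "b N = (\<Sum>n<N. g (?x n)) / real N" for N
    have b: "b N = (\<Sum>w\<in>S. f (\<rho> w) * (real (card {n. n < N \<and> map (?x n) [0..<L] \<in> {w}}) / real N))" for N
    proof -
      have "(\<Sum>n<N. g (?x n)) = (\<Sum>w\<in>S. \<Sum>n<N. f (\<rho> w) * of_bool (map (?x n) [0..<L] \<in> {w}))"
        unfolding g_def by (subst sum.swap) (auto simp: sieve_in_XA2 intro!: sum.cong)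
      also have "\<dots> = (\<Sum>w\<in>S. f (\<rho> w) * real (card {n. n < N \<and> map (?x n) [0..<L] \<in> {w}}))"
        by (simp add: sum_of_bool_eq Int_def flip: sum_distrib_left)
      finally show ?thesis by (simp add: b_def sum_divide_distrib)
    qed
    have "b \<longlonglongrightarrow> integral\<^sup>L sieve_measure g"
      unfolding ig b by (intro tendsto_sum tendsto_mult_left LIMSEQ_word_frequency)
    then have "\<forall>\<^sub>F N in sequentially. \<bar>b N - integral\<^sup>L sieve_measure g\<bar> < \<epsilon> / 4"
      using \<open>0 < \<epsilon>\<close> by (auto simp: tendsto_iff dist_real_def elim!: allE[of _ "\<epsilon> / 4"])
    then have "\<forall>\<^sub>F N in sequentially. norm (a N - integral\<^sup>L sieve_measure f) < \<epsilon>"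
    proof eventually_elim
      case (elim N)
      have "\<bar>(\<Sum>n<N. f (?x n)) - (\<Sum>n<N. g (?x n))\<bar> \<le> (\<Sum>n<N. \<bar>f (?x n) - g (?x n)\<bar>)"
        unfolding sum_subtractf[symmetric] by (rule sum_abs)
      also have "\<dots> \<le> (\<Sum>n<N. \<epsilon> / 4)" by (intro sum_mono fg sieve_in_XA2)
      also have "\<dots> = real N * (\<epsilon> / 4)" by simp
      finally have "\<bar>(\<Sum>n<N. f (?x n)) - (\<Sum>n<N. g (?x n))\<bar> / real N \<le> real N * (\<epsilon> / 4) / real N"
        by (rule divide_right_mono) simp
      also have "\<dots> \<le> \<epsilon> / 4" using \<open>0 < \<epsilon>\<close> by (cases "N = 0") auto
      finally have "\<bar>a N - b N\<bar> \<le> \<epsilon> / 4"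
        by (simp add: a_def b_def abs_divide flip: diff_divide_distrib)
      then show ?case using elim int_close \<open>0 < \<epsilon>\<close> unfolding real_norm_def by linarith
    qed
    then show "\<exists>no. \<forall>n\<ge>no. norm (a n - integral\<^sup>L sieve_measure f) < \<epsilon>"
      by (simp add: eventually_sequentially)
  qed
  moreover have "(\<lambda>N. f (?x N) / real N) \<longlonglongrightarrow> 0"
  proof (rule Lim_null_comparison)
    show "\<forall>\<^sub>F N in sequentially. norm (f (?x N) / real N) \<le> B / real N"
      using B[OF sieve_in_XA2] by (auto simp: abs_divide intro!: always_eventually divide_right_mono)
    show "(\<lambda>N. B / real N) \<longlonglongrightarrow> 0" by real_asymp
  qed
  ultimately have "(\<lambda>N. a N + f (?x N) / real N) \<longlonglongrightarrow> integral\<^sup>L sieve_measure f + 0"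
    by (rule tendsto_add)
  moreover have "1 / real N * (\<Sum>n=0..N. f ((seq_shift ^^ n) mu_sq)) = a N + f (?x N) / real N" for N
  proof -
    have "{0..N} = insert N {..<N}" by auto
    then show ?thesis by (simp add: a_def shift_mu_sq add_divide_distrib)
  qed
  ultimately show ?thesis by simp
qed

lemma is_mirsky_sieve_measure: "is_mirsky sieve_measure"
  unfolding is_mirsky_def
  using prob_space_sieve_measure sets_sieve_measure sieve_measure_invariant sieve_measure_generic by blast

text \<open>
  Cylinders are open and closed, so their indicators are admissible test functions, and weak
  convergence fixes the measure of every cylinder.
\<close>

lemma is_mirsky_unique:
  assumes m: "is_mirsky m" and m': "is_mirsky m'"
  shows "m = m'"
proof (rule prob_measure_eqI_cylinders[where X=XA2])
  fix w :: "int list"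
  define f where "f x = (\<Prod>i<length w. of_bool (x i = w ! i) :: real)" for x :: "nat \<Rightarrow> int"
  have f: "f x = indicator (cylinder XA2 w) x" if "x \<in> XA2" for x
  proof -
    have "f x = of_bool (\<forall>i<length w. x i = w ! i)" by (auto simp: f_def)
    then show ?thesis using that by (simp add: cylinder_def map_upt_eq_iff indicator_def)
  qed
  have "continuous_on XA2 f"
    unfolding f_def by (intro continuous_on_prod continuous_on_coordinate_fun)
  then have "integral\<^sup>L m f = integral\<^sup>L m' f"
    using m m' unfolding is_mirsky_def by (meson LIMSEQ_unique)
  moreover have "integral\<^sup>L n f = measure n (cylinder XA2 w)" if "is_mirsky n" for n
  proof -
    have s: "sets n = sets (restrict_space borel XA2)" using that by (simp add: is_mirsky_def)
    then have sp: "space n = XA2" using sets_eq_imp_space_eq[OF s] by (simp add: space_restrict_space)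
    have "integral\<^sup>L n f = integral\<^sup>L n (indicator (cylinder XA2 w))"
      using f sp by (intro Bochner_Integration.integral_cong) auto
    also have "\<dots> = measure n (cylinder XA2 w \<inter> space n)" by simp
    also have "cylinder XA2 w \<inter> space n = cylinder XA2 w" by (auto simp: sp cylinder_def)
    finally show ?thesis .
  qed
  ultimately show "measure m (cylinder XA2 w) = measure m' (cylinder XA2 w)"
    using m m' by simp
qed (use m m' in \<open>auto simp: is_mirsky_def\<close>)

theorem mirsky_measure_eq: "mirsky_measure = sieve_measure"
  unfolding mirsky_measure_def
  by (intro the_equality is_mirsky_sieve_measure is_mirsky_unique[OF _ is_mirsky_sieve_measure])

section \<open>Cylinder probabilities of the Sarnak--Veech measure\<close>

abbreviation nonzeros :: "int list \<Rightarrow> int list" where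
  "nonzeros w \<equiv> filter (\<lambda>a. a \<noteq> 0) w"

interpretation coins: product_prob_space "\<lambda>_ :: nat. uniform_count_measure {-1, 1 :: int}" UNIV
  by (rule product_prob_spaceI, rule prob_space_uniform_count_measure) auto

interpretation bernoulli: prob_space bernoulli_measure
  unfolding bernoulli_measure_def by unfold_locales

lemma space_bernoulli_measure: "space bernoulli_measure = {\<omega>. range \<omega> \<subseteq> {-1, 1}}"
  by (auto simp: bernoulli_measure_def space_PiM PiE_iff space_uniform_count_measure image_subset_iff)

lemma measurable_prefix_bernoulli: "(\<lambda>\<omega>. map \<omega> [0..<n]) \<in> measurable bernoulli_measure (count_space UNIV)"
proof (induction n)
  case (Suc n)
  have "(\<lambda>\<omega>. \<omega> n) \<in> measurable bernoulli_measure (uniform_count_measure {-1, 1 :: int})"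
    unfolding bernoulli_measure_def by (rule measurable_component_singleton) simp
  then have "(\<lambda>\<omega>. \<omega> n) \<in> measurable bernoulli_measure (count_space {-1, 1 :: int})"
    using measurable_cong_sets[OF refl sets_uniform_count_measure_count_space, of bernoulli_measure "{-1, 1 :: int}"]
    by simp
  then have "(\<lambda>\<omega>. \<omega> n) \<in> measurable bernoulli_measure (count_space (UNIV :: int set))"
    by (rule measurable_compose) simp
  then have "(\<lambda>\<omega>. (map \<omega> [0..<n], \<omega> n)) \<in> measurable bernoulli_measure (count_space UNIV)"
    using Suc by (simp add: measurable_pair_iff flip: pair_measure_countable)
  then have "(\<lambda>\<omega>. (\<lambda>(w, a). w @ [a]) (map \<omega> [0..<n], \<omega> n)) \<in> measurable bernoulli_measure (count_space UNIV)"
    by (rule measurable_compose) simp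
  then show ?case by simp
qed simp

lemma prob_bernoulli_prefix:
  assumes "set u \<subseteq> {-1, 1}"
  shows "measure bernoulli_measure {\<omega> \<in> space bernoulli_measure. map \<omega> [0..<length u] = u} = (1 / 2) ^ length u"
proof -
  let ?A = "\<lambda>i. {u ! i}"
  have "{\<omega> \<in> space bernoulli_measure. map \<omega> [0..<length u] = u}
      = prod_emb UNIV (\<lambda>_. uniform_count_measure {-1, 1 :: int}) {..<length u} (Pi\<^sub>E {..<length u} ?A)"
    unfolding map_upt_eq_iff by (auto simp: prod_emb_def bernoulli_measure_def space_PiM PiE_iff)
  also have "measure bernoulli_measure \<dots> = (\<Prod>i<length u. measure (uniform_count_measure {-1, 1 :: int}) (?A i))"
    unfolding bernoulli_measure_def
    using assms nth_mem by (intro coins.measure_PiM_emb) (fastforce simp: sets_uniform_count_measure)+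
  also have "\<dots> = (\<Prod>i<length u. 1 / 2)"
  proof (rule prod.cong)
    fix i assume "i \<in> {..<length u}"
    then have "u ! i \<in> {-1, 1}" using assms nth_mem by blast
    then show "measure (uniform_count_measure {-1, 1 :: int}) (?A i) = 1 / 2"
      by (subst measure_uniform_count_measure) auto
  qed simp
  finally show ?thesis by simp
qed

text \<open>
  The sign used at a support point is indexed, counting from zero, by the number of earlier support
  points.
\<close>

lemma Phi_nth:
  "Phi (x, \<omega>) i = (if x i = 0 then 0 else \<omega> (length (nonzeros (map x [0..<i]))))"
proof (cases "x i = 0")
  case True
  then show ?thesis by (simp add: Phi_def Let_def supp_def pr_def)
next
  case False
  have "bij_betw Suc {j. j < Suc i \<and> x j \<noteq> 0} {j \<in> supp x. j \<le> Suc i}"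
    by (rule bij_betw_byWitness[where f'="\<lambda>j. j - 1"]) (auto simp: supp_def pr_def)
  then have "card {j \<in> supp x. j \<le> Suc i} = card {j. j < Suc i \<and> x j \<noteq> 0}"
    by (rule bij_betw_same_card[symmetric])
  also have "\<dots> = length (nonzeros (map x [0..<Suc i]))"
    unfolding length_filter_conv_card
    by (rule arg_cong[where f=card], rule Collect_cong) (auto simp: nth_append less_Suc_eq)
  also have "\<dots> = Suc (length (nonzeros (map x [0..<i])))"
    using False by simp
  finally show ?thesis
    using False by (simp add: Phi_def Let_def supp_def pr_def)
qed

lemma abs_Phi:
  assumes "range x \<subseteq> {0, 1}" "range \<omega> \<subseteq> {-1, 1}"
  shows "(\<lambda>i. \<bar>Phi (x, \<omega>) i\<bar>) = x"
proof
  fix i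
  obtain k where k: "length (nonzeros (map x [0..<i])) = k" by blast
  have "x i \<in> {0, 1}" "\<omega> k \<in> {-1, 1}" using assms by auto
  then show "\<bar>Phi (x, \<omega>) i\<bar> = x i" unfolding Phi_nth k by auto
qed

text \<open>
  A prefix of \<open>Phi (x, \<omega>)\<close> constrains \<open>x\<close> and \<open>\<omega>\<close> separately: the pattern by the absolute values,
  and an initial segment of the signs by the nonzero letters.  Hence cylinders pull back to rectangles.
\<close>

lemma Phi_prefix_iff:
  assumes x: "range x \<subseteq> {0, 1}" and \<omega>: "range \<omega> \<subseteq> {-1, 1}"
  shows "map (Phi (x, \<omega>)) [0..<length w] = w \<longleftrightarrow>
    map x [0..<length w] = map abs w \<and> map \<omega> [0..<length (nonzeros w)] = nonzeros w"
proof (induction w rule: rev_induct)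
  case (snoc v w)
  let ?k = "length (nonzeros w)"
  have last: "Phi (x, \<omega>) (length w) = v \<longleftrightarrow> x (length w) = \<bar>v\<bar> \<and> (v \<noteq> 0 \<longrightarrow> \<omega> ?k = v)"
    if "map x [0..<length w] = map abs w"
  proof -
    have "length (nonzeros (map x [0..<length w])) = ?k"
      unfolding that by (simp add: filter_map comp_def)
    then have "Phi (x, \<omega>) (length w) = (if x (length w) = 0 then 0 else \<omega> ?k)"
      by (simp add: Phi_nth)
    moreover have "x (length w) \<in> {0, 1}" "\<omega> ?k \<in> {-1, 1}" using x \<omega> by auto
    ultimately show ?thesis by auto
  qed
  show ?case
    using snoc last by (auto simp del: upt_Suc simp add: upt_Suc_append)
qed simp

lemma supp_abs: "supp (\<lambda>i. \<bar>y i\<bar>) = supp y"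
  by (simp add: supp_def pr_def)

lemma abs_XA3: "y \<in> XA3 \<Longrightarrow> (\<lambda>i. \<bar>y i\<bar>) \<in> XA2"
proof -
  assume y: "y \<in> XA3"
  have "\<bar>y i\<bar> \<in> {0, 1}" for i
  proof -
    have "y i \<in> {-1, 0, 1}" using y by (auto simp: XA3_def)
    then show ?thesis by auto
  qed
  then show ?thesis using y by (auto simp: XA2_def XA3_def supp_abs)
qed

lemma Phi_in_XA3:
  assumes "x \<in> XA2" "range \<omega> \<subseteq> {-1, 1}"
  shows "Phi (x, \<omega>) \<in> XA3"
proof -
  have "supp (Phi (x, \<omega>)) = supp x"
    using supp_abs[of "Phi (x, \<omega>)"] abs_Phi[of x \<omega>] assms by (simp add: XA2_def)
  moreover have "Phi (x, \<omega>) i \<in> {-1, 0, 1}" for i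
    using assms(2) by (auto simp: Phi_nth)
  ultimately show ?thesis
    using assms(1) by (auto simp: XA2_def XA3_def)
qed

abbreviation pattern_sign_measure :: "((nat \<Rightarrow> int) \<times> (nat \<Rightarrow> int)) measure" where
  "pattern_sign_measure \<equiv> sieve_measure \<Otimes>\<^sub>M bernoulli_measure"

lemma space_pattern_sign_measure: "space pattern_sign_measure = XA2 \<times> {\<omega>. range \<omega> \<subseteq> {-1, 1}}"
  by (simp add: space_pair_measure space_bernoulli_measure)

lemma Phi_measurable: "Phi \<in> measurable pattern_sign_measure (restrict_space borel XA3)"
proof (rule measurable_restrict_space2)
  show "Phi \<in> space pattern_sign_measure \<rightarrow> XA3"
    using Phi_in_XA3 by (auto simp: space_pattern_sign_measure)
  have "(\<lambda>q. Phi q i) \<in> measurable pattern_sign_measure (count_space UNIV)" for i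
  proof -
    have "(\<lambda>x. map x [0..<Suc i]) \<in> measurable sieve_measure (count_space UNIV)"
      using measurable_restrict_space1[OF measurable_prefix, of "Suc i" XA2]
      by (simp cong: measurable_cong_sets add: sets_sieve_measure)
    then have "(\<lambda>q. map (fst q) [0..<Suc i]) \<in> measurable pattern_sign_measure (count_space UNIV)"
      by (rule measurable_compose[OF measurable_fst])
    moreover have "(\<lambda>q. map (snd q) [0..<Suc i]) \<in> measurable pattern_sign_measure (count_space UNIV)"
      by (rule measurable_compose[OF measurable_snd measurable_prefix_bernoulli])
    ultimately have "(\<lambda>q. (map (fst q) [0..<Suc i], map (snd q) [0..<Suc i])) \<in> measurable pattern_sign_measure (count_space UNIV)"
      by (simp add: measurable_pair_iff del: upt_Suc flip: pair_measure_countable)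
    then have m: "(\<lambda>q. (\<lambda>(a, b). if a ! i = 0 then 0 else b ! length (nonzeros (take i a)))
        (map (fst q) [0..<Suc i], map (snd q) [0..<Suc i])) \<in> measurable pattern_sign_measure (count_space UNIV)"
      by (rule measurable_compose) simp
    have "Phi (x, \<omega>) i = (\<lambda>(a, b). if a ! i = 0 then 0 else b ! length (nonzeros (take i a)))
        (map x [0..<Suc i], map \<omega> [0..<Suc i])" for x \<omega>
    proof -
      have "length (nonzeros (map x [0..<i])) < Suc i"
        using length_filter_le[of "\<lambda>a. a \<noteq> 0" "map x [0..<i]"] by simp
      then show ?thesis by (simp add: Phi_nth take_map take_upt nth_append del: upt_Suc)
    qed
    then have "(\<lambda>q. Phi q i) = (\<lambda>q. (\<lambda>(a, b). if a ! i = 0 then 0 else b ! length (nonzeros (take i a)))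
        (map (fst q) [0..<Suc i], map (snd q) [0..<Suc i]))"
      by (intro ext) (metis prod.collapse)
    then show ?thesis using m by (simp only:)
  qed
  then have "(\<lambda>q. Phi q i) \<in> borel_measurable pattern_sign_measure" for i
    by (simp add: measurable_cong_sets[OF refl sets_borel_eq_count_space])
  then show "Phi \<in> borel_measurable pattern_sign_measure"
    by (intro measurable_coordinatewise_then_product)
qed

lemma prob_space_pattern_sign_measure: "prob_space pattern_sign_measure"
  using prob_space_sieve_measure bernoulli.prob_space_axioms by (rule prob_space_pair)

lemma sarnak_veech_eq: "sarnak_veech_measure = distr pattern_sign_measure (restrict_space borel XA3) Phi"
  by (simp add: sarnak_veech_measure_def mirsky_measure_eq)

lemma sets_sarnak_veech: "sets sarnak_veech_measure = sets (restrict_space borel XA3)"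
  and space_sarnak_veech [simp]: "space sarnak_veech_measure = XA3"
  by (simp_all add: sarnak_veech_eq space_restrict_space)

lemma prob_space_sarnak_veech: "prob_space sarnak_veech_measure"
  unfolding sarnak_veech_eq by (rule prob_space.prob_space_distr[OF prob_space_pattern_sign_measure Phi_measurable])

lemma measure_sarnak_veech_cylinder:
  "measure sarnak_veech_measure (cylinder XA3 w)
    = measure sieve_measure (cylinder XA2 (map abs w)) * (1 / 2) ^ length (nonzeros w)"
proof -
  interpret prob_space sieve_measure by (rule prob_space_sieve_measure)
  let ?A = "cylinder XA2 (map abs w)"
  let ?B = "{\<omega> \<in> space bernoulli_measure. map \<omega> [0..<length (nonzeros w)] = nonzeros w}"
  have A: "?A \<in> sets sieve_measure" by (simp add: sets_sieve_measure cylinder_event)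
  have "?B = (\<lambda>\<omega>. map \<omega> [0..<length (nonzeros w)]) -` {nonzeros w} \<inter> space bernoulli_measure" by auto
  then have B: "?B \<in> sets bernoulli_measure"
    using measurable_sets[OF measurable_prefix_bernoulli, of "{nonzeros w}"] by (simp only:) simp
  have "measure sarnak_veech_measure (cylinder XA3 w) = measure pattern_sign_measure (Phi -` cylinder XA3 w \<inter> space pattern_sign_measure)"
    unfolding sarnak_veech_eq by (rule measure_distr[OF Phi_measurable cylinder_event])
  also have "Phi -` cylinder XA3 w \<inter> space pattern_sign_measure = ?A \<times> ?B"
  proof -
    have "(x, \<omega>) \<in> Phi -` cylinder XA3 w \<longleftrightarrow> x \<in> ?A \<and> \<omega> \<in> ?B" if "x \<in> XA2" "range \<omega> \<subseteq> {-1, 1}" for x \<omega>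
      using that Phi_in_XA3[OF that] Phi_prefix_iff[of x \<omega> w]
      by (simp add: cylinder_def space_bernoulli_measure XA2_def)
    moreover have "?A \<subseteq> XA2" "?B \<subseteq> {\<omega>. range \<omega> \<subseteq> {-1, 1}}"
      by (auto simp: cylinder_def space_bernoulli_measure)
    ultimately show ?thesis unfolding space_pattern_sign_measure by blast
  qed
  also have "measure pattern_sign_measure (?A \<times> ?B) = measure sieve_measure ?A * measure bernoulli_measure ?B"
    by (simp add: measure_def bernoulli.emeasure_pair_measure_Times[OF A B] enn2real_mult)
  also have "\<dots> = measure sieve_measure ?A * (1 / 2) ^ length (nonzeros w)"
  proof (cases "?A = {}")
    case False
    then obtain x where x: "range x \<subseteq> {0, 1}" "map x [0..<length w] = map abs w"
      by (auto simp: cylinder_def XA2_def)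
    have "a \<in> {-1, 1}" if "a \<in> set (nonzeros w)" for a
    proof -
      have "\<bar>a\<bar> \<in> set (map x [0..<length w])" unfolding x(2) using that by auto
      then obtain j where j: "\<bar>a\<bar> = x j" by auto
      have "x j \<in> {0, 1}" using x(1) by auto
      then show ?thesis using that j by auto
    qed
    then show ?thesis by (subst prob_bernoulli_prefix) auto
  qed simp
  finally show ?thesis .
qed

text \<open>
  Forgetting the signs undoes \<open>Phi\<close> in the first component.
\<close>

lemma distr_abs_sarnak_veech:
  "distr sarnak_veech_measure sieve_measure (\<lambda>y i. \<bar>y i\<bar>) = sieve_measure"
  and measurable_abs: "(\<lambda>y i. \<bar>y i\<bar>) \<in> measurable sarnak_veech_measure sieve_measure"
proof -
  have "(\<lambda>y i. \<bar>y i\<bar>) \<in> measurable (restrict_space borel XA3) (restrict_space borel XA2)"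
  proof (rule measurable_restrict_space2)
    show "(\<lambda>y i. \<bar>y i\<bar>) \<in> space (restrict_space borel XA3) \<rightarrow> XA2"
      using abs_XA3 by (auto simp: space_restrict_space)
    have "(\<lambda>y i. \<bar>y i\<bar>) \<in> measurable borel (borel :: (nat \<Rightarrow> int) measure)"
    proof (rule measurable_coordinatewise_then_product)
      fix i
      have "continuous_on UNIV (\<lambda>y :: nat \<Rightarrow> int. \<bar>y i\<bar>)" by (rule continuous_on_coordinate_fun)
      then show "(\<lambda>y :: nat \<Rightarrow> int. \<bar>y i\<bar>) \<in> borel_measurable borel"
        by (rule borel_measurable_continuous_onI)
    qed
    then show "(\<lambda>y i. \<bar>y i\<bar>) \<in> borel_measurable (restrict_space borel XA3)"
      by (rule measurable_restrict_space1)
  qed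
  then have m: "(\<lambda>y i. \<bar>y i\<bar>) \<in> measurable (restrict_space borel XA3) sieve_measure"
    by (simp cong: measurable_cong_sets add: sets_sieve_measure)
  then show "(\<lambda>y i. \<bar>y i\<bar>) \<in> measurable sarnak_veech_measure sieve_measure"
    by (simp cong: measurable_cong_sets add: sets_sarnak_veech)
  have "distr sarnak_veech_measure sieve_measure (\<lambda>y i. \<bar>y i\<bar>) = distr pattern_sign_measure sieve_measure ((\<lambda>y i. \<bar>y i\<bar>) \<circ> Phi)"
    unfolding sarnak_veech_eq by (rule distr_distr[OF m Phi_measurable])
  also have "\<dots> = distr pattern_sign_measure sieve_measure fst"
    by (rule distr_cong) (auto simp: space_pattern_sign_measure abs_Phi XA2_def)
  also have "\<dots> = sieve_measure" by (rule bernoulli.distr_pair_fst)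
  finally show "distr sarnak_veech_measure sieve_measure (\<lambda>y i. \<bar>y i\<bar>) = sieve_measure" .
qed

lemma cylinder_shift_eq_UN:
  assumes "\<And>x. x \<in> X \<Longrightarrow> x 0 \<in> A" and "\<And>x. x \<in> X \<Longrightarrow> seq_shift x \<in> X"
  shows "seq_shift -` cylinder X w \<inter> X = (\<Union>a\<in>A. cylinder X (a # w))"
proof -
  have "map x [0..<Suc (length w)] = x 0 # map (seq_shift x) [0..<length w]" for x
    by (simp add: seq_shift_def map_upt_Suc del: upt_Suc)
  then show ?thesis using assms by (auto simp: cylinder_def simp del: upt_Suc)
qed

text \<open>
  The preimage of a cylinder under the shift splits according to the letter that the shift drops.
\<close>

lemma measure_cylinder_shift:
  assumes M: "prob_space M" "sets M = sets (restrict_space borel X)" and A: "finite A"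
    and X: "\<And>x. x \<in> X \<Longrightarrow> x 0 \<in> A" "\<And>x. x \<in> X \<Longrightarrow> seq_shift x \<in> X"
  shows "measure (distr M M seq_shift) (cylinder X w) = (\<Sum>a\<in>A. measure M (cylinder X (a # w)))"
proof -
  interpret prob_space M by fact
  have sp: "space M = X" using sets_eq_imp_space_eq[OF M(2)] by (simp add: space_restrict_space)
  have sm: "seq_shift \<in> measurable M M"
    using seq_shift_measurable[OF X(2)] by (simp cong: measurable_cong_sets add: M(2))
  have cs: "cylinder X v \<in> events" for v by (simp add: M(2) cylinder_event)
  have "measure (distr M M seq_shift) (cylinder X w) = prob (seq_shift -` cylinder X w \<inter> X)"
    using measure_distr[OF sm cs] by (simp add: sp)
  also have "seq_shift -` cylinder X w \<inter> X = (\<Union>a\<in>A. cylinder X (a # w))"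
    using X by (rule cylinder_shift_eq_UN)
  also have "prob (\<Union>a\<in>A. cylinder X (a # w)) = (\<Sum>a\<in>A. prob (cylinder X (a # w)))"
  proof (rule finite_measure_finite_Union[OF A])
    show "disjoint_family_on (\<lambda>a. cylinder X (a # w)) A"
      unfolding disjoint_family_on_def by (simp add: cylinder_Int)
  qed (use cs in auto)
  finally show ?thesis .
qed

text \<open>
  The two signs in front of a word share the weight of the letter \<open>1\<close> equally, so summing over the
  dropped letter reduces invariance to that of the Mirsky measure.
\<close>

lemma sarnak_veech_invariant: "distr sarnak_veech_measure sarnak_veech_measure seq_shift = sarnak_veech_measure"
proof (rule prob_measure_eqI_cylinders[where X=XA3])
  have sm: "seq_shift \<in> measurable sarnak_veech_measure sarnak_veech_measure"
    using seq_shift_measurable[OF seq_shift_XA3] by (simp cong: measurable_cong_sets add: sets_sarnak_veech)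
  show "prob_space (distr sarnak_veech_measure sarnak_veech_measure seq_shift)"
    by (rule prob_space.prob_space_distr[OF prob_space_sarnak_veech sm])
  fix w :: "int list"
  have "measure (distr sarnak_veech_measure sarnak_veech_measure seq_shift) (cylinder XA3 w)
      = (\<Sum>a\<in>{-1, 0, 1}. measure sarnak_veech_measure (cylinder XA3 (a # w)))"
    by (rule measure_cylinder_shift[OF prob_space_sarnak_veech sets_sarnak_veech _ _ seq_shift_XA3])
      (auto simp: XA3_def)
  also have "\<dots> = (\<Sum>a\<in>{0, 1}. measure sieve_measure (cylinder XA2 (a # map abs w))) * (1 / 2) ^ length (nonzeros w)"
    by (simp add: measure_sarnak_veech_cylinder algebra_simps)
  also have "(\<Sum>a\<in>{0, 1}. measure sieve_measure (cylinder XA2 (a # map abs w)))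
      = measure (distr sieve_measure sieve_measure seq_shift) (cylinder XA2 (map abs w))"
    by (rule measure_cylinder_shift[OF prob_space_sieve_measure sets_sieve_measure _ _ seq_shift_XA2, symmetric])
      (auto simp: XA2_def)
  also have "\<dots> = measure sieve_measure (cylinder XA2 (map abs w))"
    by (simp only: sieve_measure_invariant)
  finally show "measure (distr sarnak_veech_measure sarnak_veech_measure seq_shift) (cylinder XA3 w)
      = measure sarnak_veech_measure (cylinder XA3 w)"
    by (simp add: measure_sarnak_veech_cylinder)
qed (simp_all add: sets_sarnak_veech prob_space_sarnak_veech)

section \<open>Entropy of the Moebius flow\<close>

lemma sieve_cases: "sieve P z i \<in> {0, 1}"
proof -
  have "of_bool b \<in> {0, 1 :: int}" for b by (cases b) auto
  then show ?thesis unfolding sieve_def .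
qed

lemma simple_function_sieve: "simple_function residue_space (\<lambda>z. sieve P z i)"
  unfolding simple_function_def
proof (intro conjI ballI)
  show "finite ((\<lambda>z. sieve P z i) ` space residue_space)"
    by (rule finite_subset[of _ "{0, 1}"]) (use sieve_cases in auto)
  show "(\<lambda>z. sieve P z i) -` {v} \<inter> space residue_space \<in> sets residue_space" for v
    by (rule measurable_sets[OF measurable_sieve]) simp
qed

text \<open>
  The Mirsky measure has entropy zero.  The residues modulo \<open>p\<^sup>2\<close> for \<open>p \<le> K\<close> form a variable \<open>C\<close>
  with finitely many values whose entropy is independent of \<open>n\<close>, and the truncated sieve computed from
  \<open>C\<close> guesses each letter with error probability at most \<open>1 / K\<close>.
\<close>

lemma rv_entropy_sieve_sublinear:
  assumes "0 < \<delta>"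
  shows "\<exists>C. \<forall>n. rv_entropy residue_space (\<lambda>z. map (sieve {p. prime p} z) [0..<n]) \<le> C + real n * \<delta>"
proof -
  obtain \<epsilon> where \<epsilon>: "0 < \<epsilon>"
    "\<forall>X Y. simple_function residue_space X \<longrightarrow> simple_function residue_space Y \<longrightarrow>
       X ` space residue_space \<subseteq> {0, 1 :: int} \<longrightarrow> Y ` space residue_space \<subseteq> {0, 1} \<longrightarrow>
       measure residue_space {\<omega> \<in> space residue_space. X \<omega> \<noteq> Y \<omega>} < \<epsilon> \<longrightarrow>
       rv_entropy residue_space (\<lambda>\<omega>. (X \<omega>, Y \<omega>)) - rv_entropy residue_space Y \<le> \<delta>"
    using residue_space.fano_continuity[OF _ assms, of "{0, 1 :: int}"] by auto
  obtain K where K: "0 < K" "1 / real K < \<epsilon>"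
  proof -
    obtain n where "inverse (real (Suc n)) < \<epsilon>" using reals_Archimedean[OF \<epsilon>(1)] by blast
    then show thesis using that[of "Suc n"] by (simp add: divide_inverse)
  qed
  let ?P = "primes_upto K"
  define C where "C z = restrict (\<lambda>p. z p mod p\<^sup>2) ?P" for z :: "nat \<Rightarrow> nat"
  have pos: "0 < p" if "p \<in> ?P" for p
    using that by (simp add: primes_upto_def prime_gt_0_nat)
  have C: "simple_function residue_space C"
    unfolding simple_function_def
  proof (intro conjI ballI)
    have "C ` space residue_space \<subseteq> Pi\<^sub>E ?P (\<lambda>p. {..<p\<^sup>2})"
      using pos by (auto simp: C_def)
    then show "finite (C ` space residue_space)"
      by (rule finite_subset) (intro finite_PiE finite_primes_upto finite_lessThan)
    fix v assume "v \<in> C ` space residue_space"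
    then have v: "v \<in> extensional ?P" by (auto simp: C_def)
    have "C z = v \<longleftrightarrow> (\<forall>p\<in>?P. z p mod p\<^sup>2 = v p)" for z
    proof
      assume "\<forall>p\<in>?P. z p mod p\<^sup>2 = v p"
      then show "C z = v"
        using v by (intro extensionalityI[of _ ?P]) (auto simp: C_def)
    qed (auto simp: C_def)
    then have "C -` {v} \<inter> space residue_space = {z. \<forall>p\<in>?P. z p mod p\<^sup>2 = v p}" by auto
    moreover have "{z. \<forall>p\<in>?P. z p mod p\<^sup>2 = v p} \<in> sets residue_space"
      by (intro residue_event pred_intros_finite finite_primes_upto measurable_compose[OF measurable_residue]) simp
    ultimately show "C -` {v} \<inter> space residue_space \<in> sets residue_space" by simp
  qed
  have fC: "sieve ?P (C z) = sieve ?P z" for z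
    by (rule sieve_cong) (simp add: C_def cong_def)
  have close: "rv_entropy residue_space (\<lambda>z. (sieve {p. prime p} z i, sieve ?P (C z) i))
      - rv_entropy residue_space (\<lambda>z. sieve ?P (C z) i) \<le> \<delta>" for i
    unfolding fC
  proof (rule \<epsilon>(2)[rule_format])
    have "measure residue_space {z. sieve {p. prime p} z i \<noteq> sieve ?P z i} < \<epsilon>"
      using prob_sieve_neq_le[OF K(1), of i] K(2) by linarith
    then show "measure residue_space {z \<in> space residue_space. sieve {p. prime p} z i \<noteq> sieve ?P z i} < \<epsilon>"
      by simp
  qed (rule simple_function_sieve image_subsetI[OF sieve_cases])+
  have "rv_entropy residue_space (\<lambda>z. map (sieve {p. prime p} z) [0..<n]) \<le> rv_entropy residue_space C + real n * \<delta>" for n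
  proof -
    note L = residue_space.conditional_entropy_list_le[of n "\<lambda>i z. sieve {p. prime p} z i" C "\<lambda>i c. sieve ?P c i" \<delta>,
        OF simple_function_sieve C close]
    have "rv_entropy residue_space (\<lambda>z. map (sieve {p. prime p} z) [0..<n])
        \<le> rv_entropy residue_space (\<lambda>z. (map (sieve {p. prime p} z) [0..<n], C z))"
      using residue_space.rv_entropy_comp_le[OF simple_function_Pair[OF L(1) C], of fst] by simp
    then show ?thesis using L(2) by linarith
  qed
  then show ?thesis by blast
qed

interpretation moebius_flow: measure_preserving_system sarnak_veech_measure seq_shift
proof -
  interpret prob_space sarnak_veech_measure by (rule prob_space_sarnak_veech)
  show "measure_preserving_system sarnak_veech_measure seq_shift"
  proof
    show "seq_shift \<in> measurable sarnak_veech_measure sarnak_veech_measure"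
      using seq_shift_measurable[OF seq_shift_XA3] by (simp cong: measurable_cong_sets add: sets_sarnak_veech)
  qed (rule sarnak_veech_invariant)
qed

lemma itinerary_seq_shift: "itinerary seq_shift (\<lambda>y. y 0) n y = map y [0..<n]"
  by (simp add: itinerary_def funpow_seq_shift)

lemma simple_function_prefix:
  fixes X :: "(nat \<Rightarrow> int) set"
  assumes "sets M = sets (restrict_space borel X)" and "finite A" and "\<And>x. x \<in> X \<Longrightarrow> range x \<subseteq> A"
  shows "simple_function M (\<lambda>x. map x [0..<n])"
  unfolding simple_function_def
proof (intro conjI ballI)
  have sp: "space M = X" using sets_eq_imp_space_eq[OF assms(1)] by (simp add: space_restrict_space)
  have "(\<lambda>x. map x [0..<n]) ` space M \<subseteq> {w. set w \<subseteq> A \<and> length w = n}"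
    using assms(3) by (fastforce simp: sp)
  then show "finite ((\<lambda>x. map x [0..<n]) ` space M)"
    by (rule finite_subset) (rule finite_lists_length_eq[OF assms(2)])
  show "(\<lambda>x. map x [0..<n]) -` {w} \<inter> space M \<in> sets M" for w
    unfolding assms(1) sp by (rule prefix_event)
qed

lemma simple_function_prefix_sieve_measure: "simple_function sieve_measure (\<lambda>x. map x [0..<n])"
  by (rule simple_function_prefix[OF sets_sieve_measure, of "{0, 1}"]) (auto simp: XA2_def)

lemma simple_function_prefix_sarnak_veech: "simple_function sarnak_veech_measure (\<lambda>x. map x [0..<n])"
  by (rule simple_function_prefix[OF sets_sarnak_veech, of "{-1, 0, 1}"]) (auto simp: XA3_def)

lemma prob_nonzero_coordinate: "measure sarnak_veech_measure {y \<in> XA3. y i \<noteq> 0} = 6 / pi\<^sup>2"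
proof -
  have s: "{x \<in> XA2. x i = 1} \<in> sets (restrict_space borel XA2)"
  proof -
    have "{x \<in> XA2. x i = 1} = (\<lambda>x. map x [0..<Suc i]) -` {w. last w = 1} \<inter> XA2" by auto
    then show ?thesis by (simp only: prefix_event)
  qed
  have "measure sieve_measure {x \<in> XA2. x i = 1} = 6 / pi\<^sup>2"
    using measure_sieve_measure[OF s] prob_sieve[of i] by (simp add: sieve_in_XA2)
  moreover have "measure sieve_measure {x \<in> XA2. x i = 1}
      = measure sarnak_veech_measure ((\<lambda>y i. \<bar>y i\<bar>) -` {x \<in> XA2. x i = 1} \<inter> XA3)"
    using measure_distr[OF measurable_abs, of "{x \<in> XA2. x i = 1}"] s
    by (simp add: distr_abs_sarnak_veech sets_sieve_measure)
  moreover have "(\<lambda>y i. \<bar>y i\<bar>) -` {x \<in> XA2. x i = 1} \<inter> XA3 = {y \<in> XA3. y i \<noteq> 0}"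
  proof -
    have "y i \<in> {-1, 0, 1}" if "y \<in> XA3" for y using that by (auto simp: XA3_def)
    then have "\<bar>y i\<bar> = 1 \<longleftrightarrow> y i \<noteq> 0" if "y \<in> XA3" for y using that by fastforce
    then show ?thesis using abs_XA3 by auto
  qed
  ultimately show ?thesis by simp
qed

text \<open>
  By the cylinder formula \<open>- ln\<close> of the probability of a word is \<open>- ln\<close> of the probability of the
  unsigned word plus \<open>ln 2\<close> for every nonzero letter.  Take expectations: the first part yields the
  entropy of the unsigned words, the second the expected number of nonzero letters.
\<close>

lemma rv_entropy_sarnak_veech_words:
  "rv_entropy sarnak_veech_measure (\<lambda>y. map y [0..<n])
    = rv_entropy residue_space (\<lambda>z. map (sieve {p. prime p} z) [0..<n]) + real n * (6 / pi\<^sup>2 * ln 2)"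
proof -
  let ?\<eta> = sarnak_veech_measure
  let ?U = "\<lambda>y :: nat \<Rightarrow> int. map y [0..<n]"
  let ?V = "\<lambda>y :: nat \<Rightarrow> int. map (\<lambda>i. \<bar>y i\<bar>) [0..<n]"
  let ?p = "\<lambda>u. measure ?\<eta> (?U -` {u} \<inter> space ?\<eta>)"
  let ?q = "\<lambda>v. measure ?\<eta> (?V -` {v} \<inter> space ?\<eta>)"
  let ?S = "?U ` space ?\<eta>"
  note U = simple_function_prefix_sarnak_veech[of n]
  have "rv_entropy sieve_measure ?U = rv_entropy ?\<eta> ?V"
    using rv_entropy_distr[OF measurable_abs simple_function_prefix_sieve_measure[of n]]
    by (simp add: distr_abs_sarnak_veech)
  moreover have "rv_entropy sieve_measure ?U = rv_entropy residue_space (\<lambda>z. map (sieve {p. prime p} z) [0..<n])"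
    unfolding sieve_measure_def
  proof (rule rv_entropy_distr[OF sieve_measurable])
    show "simple_function (restrict_space borel XA2) ?U"
      by (rule simple_function_prefix[OF refl, of "{0, 1}"]) (auto simp: XA2_def)
  qed
  ultimately have HV: "rv_entropy ?\<eta> ?V = rv_entropy residue_space (\<lambda>z. map (sieve {p. prime p} z) [0..<n])"
    by simp
  have HV': "rv_entropy ?\<eta> ?V = - (\<Sum>u\<in>?S. ?p u * ln (?q (map abs u)))"
    using moebius_flow.rv_entropy_comp[OF U, of "map abs"] by (simp add: comp_def)
  have pq: "?p u = ?q (map abs u) * (1 / 2) ^ length (nonzeros u)" if "length u = n" for u
  proof -
    have "?U -` {u} \<inter> space ?\<eta> = cylinder XA3 u" using that by (auto simp: cylinder_def)
    moreover have "measure sieve_measure (cylinder XA2 (map abs u)) = ?q (map abs u)"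
    proof -
      have "(\<lambda>y i. \<bar>y i\<bar>) -` cylinder XA2 (map abs u) \<inter> XA3 = ?V -` {map abs u} \<inter> XA3"
        using abs_XA3 that by (auto simp: cylinder_def)
      then show ?thesis
        using measure_distr[OF measurable_abs, of "cylinder XA2 (map abs u)"]
        by (simp add: distr_abs_sarnak_veech sets_sieve_measure cylinder_event)
    qed
    ultimately show ?thesis by (simp only: measure_sarnak_veech_cylinder)
  qed
  have ln_p: "?p u * ln (?p u) = ?p u * ln (?q (map abs u)) - ln 2 * (?p u * real (length (nonzeros u)))" if "u \<in> ?S" for u
  proof (cases "?p u = 0")
    case False
    have len: "length u = n" using that by auto
    then have "?q (map abs u) \<noteq> 0" using pq[OF len] False by auto
    then have "0 < ?q (map abs u)" by (simp add: less_le)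
    then have lnp: "ln (?p u) = ln (?q (map abs u)) - real (length (nonzeros u)) * ln 2"
      unfolding pq[OF len] by (simp add: ln_mult ln_realpow ln_div)
    then show ?thesis by (simp only: lnp) (simp add: algebra_simps)
  qed simp
  have count: "(\<Sum>u\<in>?S. ?p u * real (length (nonzeros u))) = real n * (6 / pi\<^sup>2)"
  proof -
    have "real (length (nonzeros u)) = (\<Sum>i<n. of_bool (u ! i \<noteq> 0))" if "u \<in> ?S" for u
    proof -
      have "length u = n" using that by auto
      then show ?thesis by (simp add: length_filter_conv_card sum_of_bool_eq Int_def conj_commute)
    qed
    then have "(\<Sum>u\<in>?S. ?p u * real (length (nonzeros u))) = (\<Sum>u\<in>?S. \<Sum>i<n. ?p u * of_bool (u ! i \<noteq> 0))"
      by (intro sum.cong) (simp_all add: sum_distrib_left)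
    also have "\<dots> = (\<Sum>i<n. \<Sum>u\<in>?S. ?p u * of_bool (u ! i \<noteq> 0))"
      by (rule sum.swap)
    also have "\<dots> = (\<Sum>i<n. 6 / pi\<^sup>2)"
    proof (rule sum.cong)
      fix i assume i: "i \<in> {..<n}"
      have "(\<Sum>u\<in>?S. ?p u * of_bool (u ! i \<noteq> 0)) = (\<Sum>u | u \<in> ?S \<and> (u ! i \<noteq> 0) = True. ?p u)"
        using simple_functionD(1)[OF U] by (simp add: of_bool_def sum.If_cases Int_def if_distrib cong: if_cong)
      also have "\<dots> = measure ?\<eta> ((\<lambda>y. ?U y ! i \<noteq> 0) -` {True} \<inter> space ?\<eta>)"
        by (rule moebius_flow.prob_fibre_comp[OF U, symmetric])
      also have "(\<lambda>y. ?U y ! i \<noteq> 0) -` {True} \<inter> space ?\<eta> = {y \<in> XA3. y i \<noteq> 0}"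
        using i by auto
      also have "measure ?\<eta> \<dots> = 6 / pi\<^sup>2" by (rule prob_nonzero_coordinate)
      finally show "(\<Sum>u\<in>?S. ?p u * of_bool (u ! i \<noteq> 0)) = 6 / pi\<^sup>2" .
    qed simp
    finally show ?thesis by simp
  qed
  have "rv_entropy ?\<eta> ?U = - (\<Sum>u\<in>?S. ?p u * ln (?q (map abs u)) - ln 2 * (?p u * real (length (nonzeros u))))"
    unfolding rv_entropy_def using ln_p by (simp cong: sum.cong)
  also have "\<dots> = rv_entropy ?\<eta> ?V + ln 2 * (\<Sum>u\<in>?S. ?p u * real (length (nonzeros u)))"
    unfolding HV' by (simp add: sum_subtractf sum_distrib_left)
  finally show ?thesis unfolding HV count by (simp add: algebra_simps)
qed

theorem theorem5p5:
  shows "ks_entropy sarnak_veech_measure seq_shift = ereal (6 / pi\<^sup>2 * ln 2)"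
proof (rule antisym)
  let ?\<eta> = sarnak_veech_measure
  let ?c = "6 / pi\<^sup>2 * ln 2"
  let ?Y = "\<lambda>y :: nat \<Rightarrow> int. y 0"
  have it: "itinerary seq_shift ?Y n = (\<lambda>y. map y [0..<n])" for n
    by (rule ext) (rule itinerary_seq_shift)
  have Y: "simple_function ?\<eta> ?Y"
    using simple_function_compose[OF simple_function_prefix_sarnak_veech[of 1], of hd] by (simp add: comp_def)
  show "ks_entropy ?\<eta> seq_shift \<le> ereal ?c"
    unfolding ks_entropy_def
  proof (rule SUP_least)
    fix \<xi> assume "\<xi> \<in> {\<xi>. finite_measurable_partition ?\<eta> \<xi>}"
    then have \<xi>: "finite_measurable_partition ?\<eta> \<xi>" by simp
    have "entropy_wrt ?\<eta> seq_shift \<xi> \<le> ?c"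
    proof (rule moebius_flow.entropy_wrt_le_generator[OF Y _ _ \<xi>])
      fix A and \<epsilon> :: real assume "A \<in> sets ?\<eta>" "0 < \<epsilon>"
      then show "\<exists>L S. measure ?\<eta> (sym_diff A (itinerary seq_shift ?Y L -` S \<inter> space ?\<eta>)) < \<epsilon>"
        unfolding it space_sarnak_veech
        by (rule approximate_by_cylinders[OF moebius_flow.finite_measure_axioms sets_sarnak_veech])
    next
      fix \<delta> :: real assume "0 < \<delta>"
      then obtain C where "\<And>n. rv_entropy residue_space (\<lambda>z. map (sieve {p. prime p} z) [0..<n]) \<le> C + real n * \<delta>"
        using rv_entropy_sieve_sublinear by blast
      then have "rv_entropy ?\<eta> (itinerary seq_shift ?Y n) \<le> C + real n * (?c + \<delta>)" for n
        unfolding it rv_entropy_sarnak_veech_words distrib_left by (simp add: add.commute add_left_mono)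
      then show "\<exists>C. \<forall>n. rv_entropy ?\<eta> (itinerary seq_shift ?Y n) \<le> C + real n * (?c + \<delta>)"
        by blast
    qed
    then show "ereal (entropy_wrt ?\<eta> seq_shift \<xi>) \<le> ereal ?c" by simp
  qed
  let ?\<xi> = "fibre_partition ?\<eta> ?Y"
  have \<xi>: "finite_measurable_partition ?\<eta> ?\<xi>"
    by (rule finite_measurable_partition_fibres[OF Y])
  have "?c \<le> entropy_wrt ?\<eta> seq_shift ?\<xi>"
  proof (rule LIMSEQ_le_const[OF moebius_flow.entropy_wrt_LIMSEQ[OF \<xi>]], intro exI allI impI)
    fix n :: nat assume n: "1 \<le> n"
    have "real n * ?c \<le> rv_entropy ?\<eta> (itinerary seq_shift ?Y n)"
      unfolding it rv_entropy_sarnak_veech_words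
      using residue_space.rv_entropy_nonneg by simp
    also have "\<dots> \<le> rv_entropy ?\<eta> (itinerary seq_shift (atom_label ?\<xi> id) n)"
      by (rule moebius_flow.rv_entropy_itinerary_le_fibre_labels[OF Y])
    finally show "?c \<le> rv_entropy ?\<eta> (itinerary seq_shift (atom_label ?\<xi> id) n) / real n"
      using n by (simp add: field_simps)
  qed
  then show "ereal ?c \<le> ks_entropy ?\<eta> seq_shift"
    unfolding ks_entropy_def using \<xi> by (intro SUP_upper2[of ?\<xi>]) auto
qed

end
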